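(* Fix any $a,d$. There is an algorithm which, given positive integers $m,n$, an integer $m\times n$ matrix $A$ satisfying $\Delta(A)\le a$ and $\min\{\mathrm{td}(A),\mathrm{td}(A^T)\}\le d$, integer vectors $b\in\mathbb{Z}^m$ and $w,l,u\in\mathbb{Z}^n$, and any point $x^0$ feasible for the integer program $$\mathrm{IP}:\ \max\{wx\,:\,x\in\mathbb{Z}^n,\ Ax=b,\ l\le x\le u\},$$ computes in polynomial time a Graver walk starting at $x^0$ (and terminating at an optimal point of IP).
   Context: $\Delta(A)$ denotes the maximum absolute value of any subdeterminant of $A$ (determinant of a square submatrix of $A$). Let $P:=\{x\in\mathbb{R}^n : Ax=b,\ l\le x\le u\}$. Polynomial time means polynomial in the binary encoding length of the input, for fixed $a,d$. Tree-depth: the height of a rooted tree is the maximum number of vertices on a path from the root to a leaf. Given a graph $G=(V,E)$, a rooted tree on $V$ is valid for $G$ if for each edge $\{j,k\}\in E$, either $j$ lies on the path from the root to $k$ or vice versa. The tree-depth $\mathrm{td}(G)$ of $G$ is the smallest height of a rooted tree which is valid for $G$. The graph of an $m\times n$ matrix $A$ is the graph $G(A)$ on $[n]=\{1,\dots,n\}$ where $\{j,k\}$ ($j\neq k$) is an edge if and only if there is an $i\in[m]$ such that $A_{i,j}A_{i,k}\ne 0$. The tree-depth of the matrix $A$ is $\mathrm{td}(A):=\mathrm{td}(G(A))$; $A^T$ is the transpose. For $c,h\in\mathbb{R}^n$, $c$ is conformal to $h$, denoted $c\preceq h$, if $c_ih_i\ge 0$ and $|c_i|\le|h_i|$ for all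 $i$. A Graver-element of $A$ is a vector $g\in\mathbb{Z}^n$, $g\neq 0$, $Ag=0$, such that there is no $f\in\mathbb{Z}^n$, $f\ne 0$, $Af=0$, with $f\preceq g$ and $f\ne g$. A Graver walk starting at $x^0\in P\cap\mathbb{Z}^n$ is a finite sequence $x^0,x^1,\dots,x^s=x^*$ ($s\ge 0$) of integer points in $P$, terminating at a point $x^*$ optimal for IP, such that for all $k=1,\dots,s$: (i) $wx^k>wx^{k-1}$; and (ii) $f^k:=x^k-x^{k-1}$ is a positive integer multiple of some Graver-element $g^k$ of $A$ forming a maximal step in direction $g^k$ at $x^{k-1}$, that is, $x^{k-1}+\alpha f^k\notin P\cap\mathbb{Z}^n$ for all real $\alpha>1$. *)

theory Defs
  imports
    "Jordan_Normal_Form.Determinant"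
    "Jordan_Normal_Form.DL_Submatrix"
    "HOL-Library.Log_Nat"
    "HOL-Computational_Algebra.Polynomial"
begin

section \<open>Subdeterminants\<close>

text \<open>Square submatrices are those with at least one row; the empty determinant is not counted.\<close>

definition max_subdet :: "int mat \<Rightarrow> int" where
  "max_subdet A = Max {\<bar>det (submatrix A I J)\<bar> | I J.
     I \<subseteq> {..<dim_row A} \<and> J \<subseteq> {..<dim_col A} \<and> card I = card J \<and> I \<noteq> {}}"


section \<open>Tree-depth\<close>

definition dpath :: "('v \<times> 'v) set \<Rightarrow> 'v \<Rightarrow> 'v list \<Rightarrow> 'v \<Rightarrow> bool" where
  "dpath T x p y \<longleftrightarrow> p \<noteq> [] \<and> hd p = x \<and> last p = y \<and> successively (\<lambda>i j. (i, j) \<in> T) p"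

text \<open>A rooted tree is given by its arcs, oriented away from the root. The
  vertices of a \<^const>\<open>dpath\<close> need not be distinct, so uniqueness rules out cycles,
  parallel branches that meet again, and arcs into the root.\<close>

definition rooted_tree :: "'v set \<Rightarrow> 'v \<Rightarrow> ('v \<times> 'v) set \<Rightarrow> bool" where
  "rooted_tree V r T \<longleftrightarrow> r \<in> V \<and> T \<subseteq> V \<times> V \<and> (\<forall>v\<in>V. \<exists>!p. dpath T r p v)"

definition tree_leaf :: "'v set \<Rightarrow> ('v \<times> 'v) set \<Rightarrow> 'v \<Rightarrow> bool" where
  "tree_leaf V T v \<longleftrightarrow> v \<in> V \<and> (\<nexists>c. (v, c) \<in> T)"

definition tree_height :: "'v set \<Rightarrow> 'v \<Rightarrow> ('v \<times> 'v) set \<Rightarrow> nat" where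
  "tree_height V r T = Max {length p | p v. tree_leaf V T v \<and> dpath T r p v}"

definition valid_tree :: "'v set \<Rightarrow> 'v set set \<Rightarrow> 'v \<Rightarrow> ('v \<times> 'v) set \<Rightarrow> bool" where
  "valid_tree V E r T \<longleftrightarrow> rooted_tree V r T \<and>
     (\<forall>j k. {j, k} \<in> E \<longrightarrow>
        (\<exists>p. dpath T r p k \<and> j \<in> set p) \<or> (\<exists>p. dpath T r p j \<and> k \<in> set p))"

definition treedepth :: "'v set \<Rightarrow> 'v set set \<Rightarrow> nat" where
  "treedepth V E = (LEAST h. \<exists>r T. valid_tree V E r T \<and> tree_height V r T = h)"

definition mat_graph_edges :: "int mat \<Rightarrow> nat set set" where
  "mat_graph_edges A = {{j, k} | j k. j < dim_col A \<and> k < dim_col A \<and> j \<noteq> k \<and>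
     (\<exists>i < dim_row A. A $$ (i, j) * A $$ (i, k) \<noteq> 0)}"

definition mat_treedepth :: "int mat \<Rightarrow> nat" where
  "mat_treedepth A = treedepth {..<dim_col A} (mat_graph_edges A)"


section \<open>Graver walks\<close>

definition conformal :: "'a :: linordered_idom vec \<Rightarrow> 'a vec \<Rightarrow> bool" where
  "conformal c h \<longleftrightarrow> dim_vec c = dim_vec h \<and>
     (\<forall>i < dim_vec h. c $ i * h $ i \<ge> 0 \<and> \<bar>c $ i\<bar> \<le> \<bar>h $ i\<bar>)"

definition graver_element :: "int mat \<Rightarrow> int vec \<Rightarrow> bool" where
  "graver_element A g \<longleftrightarrow>
     g \<in> carrier_vec (dim_col A) \<and> g \<noteq> 0\<^sub>v (dim_col A) \<and> A *\<^sub>v g = 0\<^sub>v (dim_row A) \<and>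
     (\<nexists>f. f \<in> carrier_vec (dim_col A) \<and> f \<noteq> 0\<^sub>v (dim_col A) \<and> A *\<^sub>v f = 0\<^sub>v (dim_row A) \<and>
          conformal f g \<and> f \<noteq> g)"

text \<open>At type \<^typ>\<open>int\<close> this is the feasible set of the integer program; at type
  \<^typ>\<open>real\<close> it is the polyhedron itself.\<close>

definition polyhedron ::
  "'a :: {semiring_0, ord} mat \<Rightarrow> 'a vec \<Rightarrow> 'a vec \<Rightarrow> 'a vec \<Rightarrow> 'a vec set" where
  "polyhedron A b l u = {x \<in> carrier_vec (dim_col A). A *\<^sub>v x = b \<and> l \<le> x \<and> x \<le> u}"

abbreviation rvec :: "int vec \<Rightarrow> real vec" where
  "rvec \<equiv> map_vec real_of_int"

abbreviation real_polyhedron :: "int mat \<Rightarrow> int vec \<Rightarrow> int vec \<Rightarrow> int vec \<Rightarrow> real vec set" where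
  "real_polyhedron A b l u \<equiv> polyhedron (map_mat real_of_int A) (rvec b) (rvec l) (rvec u)"

definition integer_points :: "nat \<Rightarrow> real vec set" where
  "integer_points n = rvec ` carrier_vec n"

definition ip_optimal ::
  "int mat \<Rightarrow> int vec \<Rightarrow> int vec \<Rightarrow> int vec \<Rightarrow> int vec \<Rightarrow> int vec \<Rightarrow> bool" where
  "ip_optimal A b w l u x \<longleftrightarrow> x \<in> polyhedron A b l u \<and> (\<forall>y \<in> polyhedron A b l u. w \<bullet> y \<le> w \<bullet> x)"

text \<open>\<open>graver_walk A b w l u x0 xs\<close>: the list \<open>xs\<close> of all points, the starting point \<open>x0\<close>
  included, is a Graver walk.\<close>

definition graver_walk ::
  "int mat \<Rightarrow> int vec \<Rightarrow> int vec \<Rightarrow> int vec \<Rightarrow> int vec \<Rightarrow> int vec \<Rightarrow> int vec list \<Rightarrow> bool" where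
  "graver_walk A b w l u x0 xs \<longleftrightarrow>
     xs \<noteq> [] \<and> hd xs = x0 \<and>
     (\<forall>x \<in> set xs. rvec x \<in> real_polyhedron A b l u \<inter> integer_points (dim_col A)) \<and>
     ip_optimal A b w l u (last xs) \<and>
     (\<forall>k. 1 \<le> k \<and> k < length xs \<longrightarrow>
        w \<bullet> (xs ! k) > w \<bullet> (xs ! (k - 1)) \<and>
        (let f = xs ! k - xs ! (k - 1) in
           (\<exists>g c. graver_element A g \<and> c > 0 \<and> f = c \<cdot>\<^sub>v g) \<and>
           (\<forall>\<alpha>::real. \<alpha> > 1 \<longrightarrow> rvec (xs ! (k - 1)) + \<alpha> \<cdot>\<^sub>v rvec f
                \<notin> real_polyhedron A b l u \<inter> integer_points (dim_col A))))"


section \<open>Algorithms and their running time\<close>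

text \<open>Algorithms are programs of a deterministic, first-order, call-by-value language whose data
  are nested lists of integers. Integers are measured by their binary length.\<close>

datatype val = IntV int | ListV "val list"

text \<open>Each integer and each list takes one unit (sign, respectively delimiter) in addition to its
  contents.\<close>

fun val_size :: "val \<Rightarrow> nat" where
  "val_size (IntV k) = 1 + floorlog 2 (nat \<bar>k\<bar>)"
| "val_size (ListV vs) = 1 + sum_list (map val_size vs)"

datatype unop = Head | Tail | IsEmpty

datatype binop = Add | Sub | Mul | Div | Leq | Prepend

text \<open>\<open>Var i\<close> refers to the \<open>i\<close>-th entry of the environment (de Bruijn index), and
  \<open>Call f es\<close> calls the \<open>f\<close>-th function of the program.\<close>

datatype expr =
    Var nat
  | Const int
  | Empty
  | Prim1 unop expr
  | Prim2 binop expr expr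
  | Cond expr expr expr
  | LetIn expr expr
  | Call nat "expr list"

text \<open>A result \<^const>\<open>None\<close> is a run-time error: the evaluation then has no value.\<close>

fun eval_unop :: "unop \<Rightarrow> val \<Rightarrow> val option" where
  "eval_unop Head (ListV (v # vs)) = Some v"
| "eval_unop Tail (ListV (v # vs)) = Some (ListV vs)"
| "eval_unop IsEmpty (ListV vs) = Some (IntV (if vs = [] then 1 else 0))"
| "eval_unop _ _ = None"

fun eval_binop :: "binop \<Rightarrow> val \<Rightarrow> val \<Rightarrow> val option" where
  "eval_binop Add (IntV x) (IntV y) = Some (IntV (x + y))"
| "eval_binop Sub (IntV x) (IntV y) = Some (IntV (x - y))"
| "eval_binop Mul (IntV x) (IntV y) = Some (IntV (x * y))"
| "eval_binop Div (IntV x) (IntV y) = Some (IntV (x div y))"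
| "eval_binop Leq (IntV x) (IntV y) = Some (IntV (if x \<le> y then 1 else 0))"
| "eval_binop Prepend v (ListV vs) = Some (ListV (v # vs))"
| "eval_binop _ _ _ = None"

text \<open>\<open>eval P env e v t\<close>: with function bodies \<open>P\<close>, in environment \<open>env\<close>, the expression \<open>e\<close>
  evaluates to \<open>v\<close> at cost \<open>t\<close>. Every node of the evaluation costs at least one unit, and every
  variable access, constant and primitive operation is charged in addition the full size of the value
  it delivers (as if that value were copied); the operands of a primitive operation have been
  charged when they were evaluated. So the cost bounds the total binary length of everything the
  computation handles, and each primitive operation is a polynomial-time operation on binary
  numbers and lists; up to a polynomial, the cost is the running time of a Turing machine.\<close>

inductive
  eval :: "expr list \<Rightarrow> val list \<Rightarrow> expr \<Rightarrow> val \<Rightarrow> nat \<Rightarrow> bool" and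
  evals :: "expr list \<Rightarrow> val list \<Rightarrow> expr list \<Rightarrow> val list \<Rightarrow> nat \<Rightarrow> bool"
  for P :: "expr list"
where
  eval_Var: "i < length env \<Longrightarrow> eval P env (Var i) (env ! i) (1 + val_size (env ! i))"
| eval_Const: "eval P env (Const k) (IntV k) (1 + val_size (IntV k))"
| eval_Empty: "eval P env Empty (ListV []) (1 + val_size (ListV []))"
| eval_Prim1: "eval P env e v t \<Longrightarrow> eval_unop f v = Some r \<Longrightarrow>
    eval P env (Prim1 f e) r (1 + val_size r + t)"
| eval_Prim2: "eval P env e1 v1 t1 \<Longrightarrow> eval P env e2 v2 t2 \<Longrightarrow> eval_binop f v1 v2 = Some r \<Longrightarrow>
    eval P env (Prim2 f e1 e2) r (1 + val_size r + t1 + t2)"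
| eval_Cond_true: "eval P env e (IntV k) t \<Longrightarrow> k \<noteq> 0 \<Longrightarrow> eval P env e1 v t1 \<Longrightarrow>
    eval P env (Cond e e1 e2) v (1 + t + t1)"
| eval_Cond_false: "eval P env e (IntV 0) t \<Longrightarrow> eval P env e2 v t2 \<Longrightarrow>
    eval P env (Cond e e1 e2) v (1 + t + t2)"
| eval_LetIn: "eval P env e1 v1 t1 \<Longrightarrow> eval P (v1 # env) e2 v2 t2 \<Longrightarrow>
    eval P env (LetIn e1 e2) v2 (1 + t1 + t2)"
| eval_Call: "evals P env es vs t \<Longrightarrow> f < length P \<Longrightarrow> eval P vs (P ! f) v t' \<Longrightarrow>
    eval P env (Call f es) v (1 + t + t')"
| evals_Nil: "evals P env [] [] 0"
| evals_Cons: "eval P env e v t \<Longrightarrow> evals P env es vs t' \<Longrightarrow>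
    evals P env (e # es) (v # vs) (t + t')"

inductive_cases eval_VarE: "eval P env (Var i) v t"
inductive_cases eval_ConstE: "eval P env (Const k) v t"
inductive_cases eval_EmptyE: "eval P env Empty v t"
inductive_cases eval_Prim1E: "eval P env (Prim1 f e) v t"
inductive_cases eval_Prim2E: "eval P env (Prim2 f e1 e2) v t"
inductive_cases eval_CondE: "eval P env (Cond e e1 e2) v t"
inductive_cases eval_LetInE: "eval P env (LetIn e1 e2) v t"
inductive_cases eval_CallE: "eval P env (Call f es) v t"
inductive_cases evals_NilE: "evals P env [] vs t"
inductive_cases evals_ConsE: "evals P env (e # es) vs t"

lemma eval_deterministic:
  "eval P env e v t \<Longrightarrow> eval P env e v' t' \<Longrightarrow> v' = v \<and> t' = t"
  "evals P env es vs t \<Longrightarrow> evals P env es vs' t' \<Longrightarrow> vs' = vs \<and> t' = t"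
proof (induction arbitrary: v' t' and vs' t' rule: eval_evals.inducts)
  case eval_Var then show ?case by (auto elim: eval_VarE)
next
  case eval_Const then show ?case by (auto elim: eval_ConstE)
next
  case eval_Empty then show ?case by (auto elim: eval_EmptyE)
next
  case (eval_Prim1 env e v t f r)
  from eval_Prim1.prems show ?case
    by (rule eval_Prim1E) (use eval_Prim1.hyps in \<open>auto dest!: eval_Prim1.IH(2)\<close>)
next
  case (eval_Prim2 env e1 v1 t1 e2 v2 t2 f r)
  from eval_Prim2.prems show ?case
    by (rule eval_Prim2E)
      (use eval_Prim2.hyps in \<open>auto dest!: eval_Prim2.IH(2) eval_Prim2.IH(4)\<close>)
next
  case (eval_Cond_true env e k t e1 v t1 e2)
  from eval_Cond_true.prems show ?case
    by (rule eval_CondE)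
      (use eval_Cond_true.hyps in \<open>auto dest!: eval_Cond_true.IH(2) eval_Cond_true.IH(4)\<close>)
next
  case (eval_Cond_false env e t e2 v t2 e1)
  from eval_Cond_false.prems show ?case
    by (rule eval_CondE) (auto dest!: eval_Cond_false.IH(2) eval_Cond_false.IH(4))
next
  case (eval_LetIn env e1 v1 t1 e2 v2 t2)
  from eval_LetIn.prems show ?case
    by (rule eval_LetInE) (auto dest!: eval_LetIn.IH(2) eval_LetIn.IH(4))
next
  case (eval_Call env es vs t f v ta)
  from eval_Call.prems show ?case
    by (rule eval_CallE) (auto dest!: eval_Call.IH(2) eval_Call.IH(5))
next
  case evals_Nil then show ?case by (auto elim: evals_NilE)
next
  case (evals_Cons env e v t es vs ta)
  from evals_Cons.prems show ?case
    by (rule evals_ConsE) (auto dest!: evals_Cons.IH(2) evals_Cons.IH(4))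
qed

lemma val_size_le_cost:
  "eval P env e v t \<Longrightarrow> val_size v \<le> t"
  "evals P env es vs t \<Longrightarrow> sum_list (map val_size vs) \<le> t"
  by (induction rule: eval_evals.inducts) auto

text \<open>A program is the list of its function bodies; it is started by calling function \<open>0\<close> on the
  input.\<close>

definition runs :: "expr list \<Rightarrow> val \<Rightarrow> val \<Rightarrow> nat \<Rightarrow> bool" where
  "runs P input output t \<longleftrightarrow> P \<noteq> [] \<and> eval P [input] (P ! 0) output t"


section \<open>Encoding of inputs and outputs\<close>

definition enc_vec :: "int vec \<Rightarrow> val" where
  "enc_vec v = ListV (map IntV (list_of_vec v))"

definition enc_instance ::
  "int mat \<Rightarrow> int vec \<Rightarrow> int vec \<Rightarrow> int vec \<Rightarrow> int vec \<Rightarrow> int vec \<Rightarrow> val" where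
  "enc_instance A b w l u x0 = ListV
     [IntV (int (dim_row A)), IntV (int (dim_col A)), ListV (map enc_vec (rows A)),
      enc_vec b, enc_vec w, enc_vec l, enc_vec u, enc_vec x0]"

definition enc_walk :: "int vec list \<Rightarrow> val" where
  "enc_walk xs = ListV (map enc_vec xs)"

end

theory Submission
  imports Defs
begin

text \<open>
  The two halves of the theorem are that \<^emph>\<open>few\<close> Graver steps lead to an optimum, and that each of
  them can be \<^emph>\<open>found\<close>. Both use that \<open>a\<close> and \<open>d\<close> are fixed: exponents may depend on them.

  \<^emph>\<open>Few steps.\<close> Let \<open>x\<close> be the current point and \<open>y\<close> a feasible point, so that \<open>z = y - x\<close> lies in
  the kernel of \<open>A\<close>. If all minors of \<open>A\<close> are at most \<open>a\<close>, then cofactors of a bordered maximal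
  minor give kernel vectors with entries at most \<open>max a 1\<close> that agree with \<open>z\<close> in sign
  (\<open>small_kernel_vector\<close>, \<open>small_conformal_kernel_vector\<close>). Writing \<open>z\<close> as a conic combination of at
  most \<open>n\<close> of them and rounding the coefficients down leaves one small remainder, so \<open>z\<close> is a sum of
  at most \<open>n + 1\<close> conformal terms \<open>\<mu> h\<close> with \<open>\<mu>\<close> a natural number and \<open>h\<close> an integer kernel vector
  of entries at most \<open>B = n max(a, 1)\<close> (\<open>few_bounded_terms\<close>). One of the terms has at least the
  fraction \<open>1 / (n + 1)\<close> of the gain of \<open>z\<close>. As \<open>h\<close> is the conformal sum of at most \<open>n B\<close> Graver
  elements, one of these has at least the fraction \<open>1 / (n B)\<close> of that. Hence some Graver step closes
  a fraction \<open>1 / N\<close> of the gap to the optimum, with \<open>N\<close> polynomial in \<open>n\<close>, and after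
  \<open>N \<cdot> log spread\<close> best steps the gap is less than \<open>1\<close>, that is, zero (\<open>partial_walk\<close>). Here
  \<open>spread\<close>, a bound on the initial gap, has polynomial binary length.

  \<^emph>\<open>Finding a step if the tree-depth of the transpose is at most \<open>d\<close>.\<close> Then the Graver elements have
  bounded \<open>l1\<close>-norm (\<open>l1_minimal_kern_le\<close>), and all of them can be listed.

  \<^emph>\<open>Finding a step if the tree-depth of \<open>A\<close> is at most \<open>d\<close>.\<close> For every \<open>\<mu>\<close> in a list of
  logarithmically many scales, maximize the objective over the kernel vectors \<open>h\<close> with entries in
  \<open>[-B, B]\<close> for which \<open>x + \<mu> h\<close> is feasible. This is done by recursion on the depth: split the
  columns into connected components, and in each component try every column as the root and every
  value of \<open>[-B, B]\<close> for it (\<open>solve\<close>). The optimum is peeled into Graver elements by the same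
  procedure: a conformal vector of minimal \<open>l1\<close>-norm among those not vanishing at a given coordinate
  is a Graver element (\<open>below_minimal\<close>).

  The tree-depths themselves are never computed. Both lists of candidates consist of Graver elements
  in any case: short vectors are tested for minimality, and an answer of the recursion certifies the
  decomposition that it used (\<open>solve_nonempty_tdp\<close>), so it is an optimum. The bound on one of the
  tree-depths guarantees that one of the lists contains a good step.

  A longest integer multiple of a Graver element is also a longest step in the real sense: a longer
  step to an integer point would leave, after subtracting an integer multiple, a proper conformal part
  of the Graver element (\<open>no_longer_step\<close>).

  \<^emph>\<open>Polynomial time.\<close> The predicate \<open>ptime\<close> says that a function between encodable types is computed
  by some program in polynomial time. It is closed under the usual ways to combine functions and under
  iterations whose number and whose intermediate results are polynomially bounded (\<open>ptime_while\<close>).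
  The algorithm is therefore written as a functional program on lists of integers, and the closure
  properties yield the actual program.
\<close>


section \<open>Polynomial-time functions on encoded data\<close>

class encodable = fixes enc :: "'a \<Rightarrow> val"

instantiation int :: encodable begin
definition "enc_int (k :: int) = IntV k"
instance ..
end

instantiation nat :: encodable begin
definition "enc_nat (k :: nat) = IntV (int k)"
instance ..
end

text \<open>
  The encoding agrees with the results of the primitive tests and with what conditionals expect.
\<close>

instantiation bool :: encodable begin
definition "enc_bool b = IntV (if b then 1 else 0)"
instance ..
end

instantiation list :: (encodable) encodable begin
definition "enc_list (xs :: 'a list) = ListV (map enc xs)"
instance ..
end

instantiation prod :: (encodable, encodable) encodable begin
definition "enc_prod (z :: 'a \<times> 'b) = ListV [enc (fst z), enc (snd z)]"
instance ..
end

definition sz :: "'a :: encodable \<Rightarrow> nat" where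
  "sz x = val_size (enc x)"

lemma val_size_pos: "1 \<le> val_size v"
  by (cases v) auto

lemma sz_pos: "1 \<le> sz x"
  unfolding sz_def by (rule val_size_pos)

lemma sz_pair [simp]: "sz (x, y) = 1 + sz x + sz y"
  by (simp add: sz_def enc_prod_def)

lemma sz_Nil [simp]: "sz [] = 1"
  by (simp add: sz_def enc_list_def)

lemma sz_Cons [simp]: "sz (x # xs) = sz x + sz xs"
  by (simp add: sz_def enc_list_def)

lemma sz_append: "sz (xs @ ys) + 1 = sz xs + sz ys"
  by (induction xs) auto

lemma sz_int: "sz (k :: int) = 1 + floorlog 2 (nat \<bar>k\<bar>)"
  by (simp add: sz_def enc_int_def)

lemma sz_nat: "sz (k :: nat) = 1 + floorlog 2 k"
  by (simp add: sz_def enc_nat_def)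

lemma sz_bool: "sz (b :: bool) \<le> 2"
  by (auto simp: sz_def enc_bool_def floorlog_def)

lemma sz_of_nat: "sz (int k) = sz k"
  by (simp add: sz_nat sz_int)

lemma length_le_sz: "length xs < sz xs"
proof (induction xs)
  case (Cons x xs)
  then show ?case using sz_pos[of x] by simp
qed simp

lemma sz_mem: "x \<in> set xs \<Longrightarrow> sz x < sz xs"
proof (induction xs)
  case (Cons y ys)
  then show ?case using sz_pos[of y] sz_pos[of ys] by auto
qed simp

lemma sz_fst_snd: "sz (fst z) \<le> sz z" "sz (snd z) \<le> sz z"
  by (cases z; simp)+

subsection \<open>Polynomial bounds\<close>

text \<open>
  Powers of \<open>sz x + 2\<close> dominate every polynomial in \<open>sz x\<close> without a coefficient in front, because
  the base is at least \<open>2\<close> (\<open>pbound_const\<close>). A single exponent therefore describes a bound.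
\<close>

definition pbound :: "('a :: encodable \<Rightarrow> nat) \<Rightarrow> bool" where
  "pbound f \<longleftrightarrow> (\<exists>k. \<forall>x. f x \<le> (sz x + 2) ^ k)"

lemma pboundI: "(\<And>x. f x \<le> (sz x + 2) ^ k) \<Longrightarrow> pbound f"
  unfolding pbound_def by blast

lemma pbound_mono: "pbound g \<Longrightarrow> (\<And>x. f x \<le> g x) \<Longrightarrow> pbound f"
  unfolding pbound_def by (meson le_trans)

lemma pbound_const: "pbound (\<lambda>x. c)"
proof (rule pboundI)
  fix x :: 'a
  have "c \<le> 2 ^ c" using less_exp[of c] by simp
  also have "\<dots> \<le> (sz x + 2) ^ c" by (rule power_mono) auto
  finally show "c \<le> (sz x + 2) ^ c" .
qed

lemma pbound_sz: "pbound sz"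
  by (rule pboundI[of _ 1]) simp

lemma pbound_mult: assumes "pbound f" "pbound g" shows "pbound (\<lambda>x. f x * g x)"
proof -
  obtain k j where "\<And>x. f x \<le> (sz x + 2) ^ k" "\<And>x. g x \<le> (sz x + 2) ^ j"
    using assms unfolding pbound_def by blast
  then have "f x * g x \<le> (sz x + 2) ^ (k + j)" for x
    unfolding power_add by (intro mult_le_mono)
  then show ?thesis by (rule pboundI)
qed

lemma pbound_add: assumes "pbound f" "pbound g" shows "pbound (\<lambda>x. f x + g x)"
proof -
  have "pbound (\<lambda>x. (f x + 1) * (g x + 1))" if "pbound (\<lambda>x. f x + 1)" "pbound (\<lambda>x. g x + 1)"
    using that by (rule pbound_mult)
  moreover have "pbound (\<lambda>x. h x + 1)" if "pbound h" for h :: "'a \<Rightarrow> nat"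
  proof -
    obtain k where k: "\<And>x. h x \<le> (sz x + 2) ^ k" using \<open>pbound h\<close> unfolding pbound_def by blast
    have "h x + 1 \<le> (sz x + 2) ^ Suc k" for x
    proof -
      have "1 \<le> (sz x + 2) ^ k" by simp
      then have "h x + 1 \<le> 2 * (sz x + 2) ^ k" using k[of x] by linarith
      also have "\<dots> \<le> (sz x + 2) ^ Suc k" by simp
      finally show ?thesis .
    qed
    then show ?thesis by (rule pboundI)
  qed
  ultimately have "pbound (\<lambda>x. (f x + 1) * (g x + 1))" using assms by blast
  then show ?thesis by (rule pbound_mono) simp
qed

lemma pbound_power: "pbound f \<Longrightarrow> pbound (\<lambda>x. f x ^ k)"
  by (induction k) (auto intro: pbound_mult pbound_const)

text \<open>
  The size of the intermediate value has to be bounded by \<^emph>\<open>some\<close> polynomially bounded function; for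
  a polynomial-time function this is automatic (\<open>ptime_pbound_sz\<close>).
\<close>

lemma pbound_comp:
  assumes "pbound g" "pbound s" "\<And>x. sz (f x) \<le> s x"
  shows "pbound (\<lambda>x. g (f x))"
proof -
  obtain k where k: "\<And>x. g x \<le> (sz x + 2) ^ k" using assms unfolding pbound_def by blast
  have "g (f x) \<le> (s x + 2) ^ k" for x
    by (rule order.trans[OF k]) (use assms(3) in \<open>auto intro: power_mono\<close>)
  moreover have "pbound (\<lambda>x. (s x + 2) ^ k)"
    by (intro pbound_power pbound_add assms pbound_const)
  ultimately show ?thesis by (rule pbound_mono[rotated])
qed

lemma pbound_Suc: "pbound f \<Longrightarrow> pbound (\<lambda>x. Suc (f x))"
  using pbound_add[OF pbound_const[of 1]] by simp

lemma pbound_fst: "pbound g \<Longrightarrow> pbound (\<lambda>z. g (fst z))"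
  and pbound_snd: "pbound g \<Longrightarrow> pbound (\<lambda>z. g (snd z))"
  by (rule pbound_comp[OF _ pbound_sz]; simp add: sz_fst_snd)+

lemmas pbound_intros = pbound_const pbound_Suc pbound_sz pbound_mult pbound_add pbound_power
  pbound_fst[OF pbound_sz] pbound_snd[OF pbound_sz]
  pbound_snd[OF pbound_fst[OF pbound_sz]] pbound_snd[OF pbound_snd[OF pbound_sz]]

subsection \<open>Linking programs\<close>

text \<open>
  Programs call functions by position. Appending functions to a program leaves these positions intact,
  but prepending \<open>s\<close> functions moves them by \<open>s\<close>; \<open>relocate\<close> adjusts the calls, so that programs for
  several functions can be put into one.
\<close>

fun relocate :: "nat \<Rightarrow> expr \<Rightarrow> expr" where
  "relocate s (Var i) = Var i"
| "relocate s (Const k) = Const k"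
| "relocate s Empty = Empty"
| "relocate s (Prim1 f e) = Prim1 f (relocate s e)"
| "relocate s (Prim2 f e1 e2) = Prim2 f (relocate s e1) (relocate s e2)"
| "relocate s (Cond e e1 e2) = Cond (relocate s e) (relocate s e1) (relocate s e2)"
| "relocate s (LetIn e1 e2) = LetIn (relocate s e1) (relocate s e2)"
| "relocate s (Call f es) = Call (s + f) (map (relocate s) es)"

lemma eval_append:
  "eval P env e v t \<Longrightarrow> eval (P @ Q) env e v t"
  "evals P env es vs t \<Longrightarrow> evals (P @ Q) env es vs t"
proof (induction rule: eval_evals.inducts)
  case (eval_Call env es vs t f v t')
  then show ?case by (intro eval_evals.eval_Call) (auto simp: nth_append)
qed (blast intro: eval_evals.intros)+

lemma eval_relocate:
  "eval P env e v t \<Longrightarrow> eval (Q @ map (relocate (length Q)) P) env (relocate (length Q) e) v t"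
  "evals P env es vs t \<Longrightarrow>
    evals (Q @ map (relocate (length Q)) P) env (map (relocate (length Q)) es) vs t"
proof (induction rule: eval_evals.inducts)
  case (eval_Call env es vs t f v t')
  then show ?case unfolding relocate.simps
    by (intro eval_evals.eval_Call) (auto simp: nth_append)
qed (simp only: relocate.simps list.map, blast intro: eval_evals.intros)+

text \<open>
  With de Bruijn indices, additional entries at the end of the environment are invisible. So an
  expression for a function of its variable \<open>0\<close> can be used below any number of further bindings.
\<close>

lemma eval_longer_env:
  "eval P env e v t \<Longrightarrow> eval P (env @ env') e v t"
  "evals P env es vs t \<Longrightarrow> evals P (env @ env') es vs t"
proof (induction rule: eval_evals.inducts)
  case (eval_Var i env)
  have "eval P (env @ env') (Var i) ((env @ env') ! i) (1 + val_size ((env @ env') ! i))"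
    using eval_Var by (intro eval_evals.eval_Var) simp
  with eval_Var show ?case by (simp add: nth_append)
next
  case (eval_Call env es vs t f v t')
  then show ?case by (intro eval_evals.eval_Call) auto
qed ((simp only: append_Cons)?, blast intro: eval_evals.intros)+

text \<open>
  Exact costs depend on the values involved; with an upper bound, the costs of subexpressions can be
  combined without computing them.
\<close>

definition evals_within :: "expr list \<Rightarrow> val list \<Rightarrow> expr \<Rightarrow> val \<Rightarrow> nat \<Rightarrow> bool" where
  "evals_within P env e v T \<longleftrightarrow> (\<exists>t. eval P env e v t \<and> t \<le> T)"

lemma evals_within_mono: "evals_within P env e v T \<Longrightarrow> T \<le> T' \<Longrightarrow> evals_within P env e v T'"
  unfolding evals_within_def by (meson le_trans)

lemma evals_within_Var0: "evals_within P (v # env) (Var 0) v (1 + val_size v)"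
  unfolding evals_within_def using eval_evals.eval_Var[of 0 "v # env" P] by auto

lemma evals_within_Empty: "evals_within P env Empty (ListV []) 2"
  unfolding evals_within_def using eval_evals.eval_Empty[of P env] by auto

lemma evals_within_Prim1:
  "evals_within P env e v T \<Longrightarrow> eval_unop f v = Some r \<Longrightarrow> evals_within P env (Prim1 f e) r (1 + val_size r + T)"
  unfolding evals_within_def by (meson add_left_mono eval_evals.eval_Prim1)

lemma evals_within_Prim2:
  "evals_within P env e1 v1 T1 \<Longrightarrow> evals_within P env e2 v2 T2 \<Longrightarrow> eval_binop f v1 v2 = Some r \<Longrightarrow>
    evals_within P env (Prim2 f e1 e2) r (1 + val_size r + T1 + T2)"
  unfolding evals_within_def by (meson add_mono order.refl eval_evals.eval_Prim2)

lemma evals_within_LetIn: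
  "evals_within P env e1 v1 T1 \<Longrightarrow> evals_within P (v1 # env) e2 v2 T2 \<Longrightarrow>
    evals_within P env (LetIn e1 e2) v2 (1 + T1 + T2)"
  unfolding evals_within_def by (meson add_mono order.refl eval_evals.eval_LetIn)

lemma evals_within_Cond:
  assumes "evals_within P env e (enc b) T" "evals_within P env (if b then e1 else e2) v T'"
  shows "evals_within P env (Cond e e1 e2) v (1 + T + T')"
proof -
  from assms obtain t t' where t: "eval P env e (IntV (if b then 1 else 0)) t" "t \<le> T"
    "eval P env (if b then e1 else e2) v t'" "t' \<le> T'"
    unfolding evals_within_def enc_bool_def by blast
  have "eval P env (Cond e e1 e2) v (1 + t + t')"
    using t by (cases b) (auto intro: eval_evals.eval_Cond_true[where k = 1, simplified]
        eval_evals.eval_Cond_false[simplified])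
  with t(2,4) show ?thesis unfolding evals_within_def by (intro exI[of _ "1 + t + t'"]) simp
qed

lemma evals_within_Call:
  assumes "evals_within P env e v T" "f < length P" "evals_within P [v] (P ! f) r T'"
  shows "evals_within P env (Call f [e]) r (1 + T + T')"
proof -
  from assms obtain t t' where t: "eval P env e v t" "t \<le> T" "eval P [v] (P ! f) r t'" "t' \<le> T'"
    unfolding evals_within_def by blast
  have "eval P env (Call f [e]) r (1 + (t + 0) + t')"
    by (rule eval_evals.eval_Call[OF eval_evals.evals_Cons[OF t(1) eval_evals.evals_Nil] assms(2) t(3)])
  with t(2,4) show ?thesis unfolding evals_within_def by (intro exI[of _ "1 + (t + 0) + t'"]) simp
qed

definition pair_expr :: "expr \<Rightarrow> expr \<Rightarrow> expr" where
  "pair_expr e e' = Prim2 Prepend e (Prim2 Prepend e' Empty)"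

lemma evals_within_pair:
  assumes "evals_within P env e (enc x) T" "evals_within P env e' (enc y) T'"
  shows "evals_within P env (pair_expr e e') (enc (x, y)) (6 + T + T' + sz x + 2 * sz y)"
proof -
  have 1: "evals_within P env (Prim2 Prepend e' Empty) (ListV [enc y]) (1 + val_size (ListV [enc y]) + T' + 2)"
    by (rule evals_within_Prim2[OF assms(2) evals_within_Empty]) simp
  have "evals_within P env (pair_expr e e') (enc (x, y)) (1 + val_size (enc (x, y)) + T +
      (1 + val_size (ListV [enc y]) + T' + 2))"
    unfolding pair_expr_def by (rule evals_within_Prim2[OF assms(1) 1]) (simp add: enc_prod_def)
  then show ?thesis by (rule evals_within_mono) (simp add: sz_def enc_prod_def)
qed

definition computes ::
  "expr list \<Rightarrow> expr \<Rightarrow> ('a \<Rightarrow> nat) \<Rightarrow> ('a :: encodable \<Rightarrow> 'b :: encodable) \<Rightarrow> bool" where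
  "computes P e T f \<longleftrightarrow> (\<forall>x. evals_within P [enc x] e (enc (f x)) (T x))"

text \<open>
  The bound is required on all values of the type, not only on those that are meaningful inputs.
  Composition would otherwise need proofs about the values passed on; instead, algorithms check what
  their running time depends on.
\<close>

definition ptime :: "('a :: encodable \<Rightarrow> 'b :: encodable) \<Rightarrow> bool" where
  "ptime f \<longleftrightarrow> (\<exists>P e T. pbound T \<and> computes P e T f)"

lemma ptimeI: "pbound T \<Longrightarrow> computes P e T f \<Longrightarrow> ptime f"
  unfolding ptime_def by blast

lemma computes_append: "computes P e T f \<Longrightarrow> computes (P @ Q) e T f"
  unfolding computes_def evals_within_def using eval_append by blast

lemma computes_relocate:
  "computes P e T f \<Longrightarrow> computes (Q @ map (relocate (length Q)) P) (relocate (length Q) e) T f"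
  unfolding computes_def evals_within_def using eval_relocate by blast

lemma computesD:
  assumes "computes P e T f"
  shows "evals_within P (enc x # env) e (enc (f x)) (T x)"
proof -
  from assms obtain t where "eval P [enc x] e (enc (f x)) t" "t \<le> T x"
    unfolding computes_def evals_within_def by blast
  from this(1)[THEN eval_longer_env(1), of env] this(2) show ?thesis unfolding evals_within_def by auto
qed

lemma computesI: "(\<And>x. evals_within P [enc x] e (enc (f x)) (T x)) \<Longrightarrow> computes P e T f"
  unfolding computes_def by blast

lemma ptimeE:
  assumes "ptime f"
  obtains P e T where "pbound T" "computes P e T f"
  using assms unfolding ptime_def by blast

lemma ptime_link2:
  assumes "ptime f" "ptime g"
  obtains P e e' T T' where "pbound T" "computes P e T f" "pbound T'" "computes P e' T' g"
proof -
  from assms(1) obtain P e T where 1: "pbound T" "computes P e T f" by (rule ptimeE)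
  from assms(2) obtain P' e' T' where 2: "pbound T'" "computes P' e' T' g" by (rule ptimeE)
  show thesis by (rule that[OF 1(1) computes_append[OF 1(2)] 2(1) computes_relocate[OF 2(2)]])
qed

lemma ptime_link3:
  assumes "ptime f" "ptime g" "ptime h"
  obtains P e e' e'' T T' T'' where
    "pbound T" "computes P e T f" "pbound T'" "computes P e' T' g" "pbound T''" "computes P e'' T'' h"
proof -
  from assms(1,2) obtain P e e' T T' where
    1: "pbound T" "computes P e T f" "pbound T'" "computes P e' T' g" by (rule ptime_link2)
  from assms(3) obtain P' e'' T'' where 2: "pbound T''" "computes P' e'' T'' h" by (rule ptimeE)
  show thesis
    by (rule that[OF 1(1) computes_append[OF 1(2)] 1(3) computes_append[OF 1(4)]
          2(1) computes_relocate[OF 2(2)]])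
qed

lemma ptime_pbound_sz:
  assumes "ptime f" shows "pbound (\<lambda>x. sz (f x))"
proof -
  from assms obtain P e T where T: "pbound T" "computes P e T f" unfolding ptime_def by blast
  have "sz (f x) \<le> T x" for x
    using T(2) val_size_le_cost(1) unfolding computes_def evals_within_def sz_def by (meson le_trans)
  with T(1) show ?thesis by (rule pbound_mono)
qed

subsection \<open>Closure properties of polynomial time\<close>

named_theorems ptime_intros

text \<open>
  Programs see encodings only. This transfers results between types with a common encoding, such as
  \<^typ>\<open>nat\<close> and the nonnegative part of \<^typ>\<open>int\<close>.
\<close>

lemma ptime_same_encoding:
  assumes "ptime f" "\<And>x. enc (g x) = enc (f x)"
  shows "ptime g"
  using assms(1) unfolding ptime_def computes_def assms(2) .

lemma ptime_cong: "ptime f \<Longrightarrow> (\<And>x. g x = f x) \<Longrightarrow> ptime g"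
  by (rule ptime_same_encoding) auto

lemma ptime_id [ptime_intros]: "ptime (\<lambda>x :: 'a :: encodable. x)"
proof (rule ptimeI)
  show "pbound (\<lambda>x :: 'a. 1 + sz x)" by (intro pbound_intros)
  show "computes [] (Var 0) (\<lambda>x :: 'a. 1 + sz x) (\<lambda>x. x)"
    by (rule computesI) (simp only: sz_def evals_within_Var0)
qed

lemma eval_literal: "\<exists>e t. \<forall>P env. eval P env e v t"
proof (induction v)
  case (IntV k)
  then show ?case using eval_evals.eval_Const by blast
next
  case (ListV vs)
  then show ?case
  proof (induction vs)
    case Nil
    then show ?case using eval_evals.eval_Empty by blast
  next
    case (Cons v vs)
    obtain e t where e: "\<And>P env. eval P env e v t" using Cons.prems by force
    obtain e' t' where e': "\<And>P env. eval P env e' (ListV vs) t'" using Cons by force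
    have "eval P env (Prim2 Prepend e e') (ListV (v # vs)) (1 + val_size (ListV (v # vs)) + t + t')" for P env
      by (rule eval_evals.eval_Prim2[OF e e']) simp
    then show ?case by blast
  qed
qed

lemma ptime_const [ptime_intros]: "ptime (\<lambda>x. c)"
proof -
  obtain e t where e: "\<And>P env. eval P env e (enc c) t" using eval_literal by blast
  show ?thesis
    by (rule ptimeI[OF pbound_const[of t], of "[]" e]) (use e in \<open>auto simp: computes_def evals_within_def\<close>)
qed

text \<open>
  The cost of \<open>g\<close> is measured on the intermediate value \<open>f x\<close>, whose size is at most the cost of
  computing it.
\<close>

lemma ptime_comp:
  assumes "ptime g" "ptime f" shows "ptime (\<lambda>x. g (f x))"
proof -
  from assms obtain P e e' T T' where
    T: "pbound T" "computes P e T g" "pbound T'" "computes P e' T' f" by (rule ptime_link2)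
  show ?thesis
  proof (rule ptimeI)
    show "pbound (\<lambda>x. 1 + T' x + T (f x))"
      by (intro pbound_intros T pbound_comp[OF T(1) ptime_pbound_sz[OF assms(2)]]) simp
    show "computes P (LetIn e' e) (\<lambda>x. 1 + T' x + T (f x)) (\<lambda>x. g (f x))"
      by (rule computesI, rule evals_within_LetIn[OF computesD[OF T(4)] computesD[OF T(2)]])
  qed
qed

lemma ptime_unop:
  assumes "\<And>x. eval_unop u (enc x) = Some (enc (h x))" "pbound (\<lambda>x. sz (h x))"
  shows "ptime h"
proof (rule ptimeI)
  show "pbound (\<lambda>x. 1 + sz (h x) + (1 + sz x))" by (intro pbound_intros assms)
  show "computes [] (Prim1 u (Var 0)) (\<lambda>x. 1 + sz (h x) + (1 + sz x)) h"
    unfolding sz_def by (intro computesI evals_within_Prim1[OF evals_within_Var0 assms(1)])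
qed

text \<open>
  The result of each primitive operation is at most as long as its operands together. Repeated use may
  still square a number many times; this is why iteration needs a bound on all intermediate
  sizes.
\<close>

lemma ptime_binop:
  assumes "\<And>a b. eval_binop u (enc a) (enc b) = Some (enc (h a b))" "\<And>a b. sz (h a b) \<le> sz a + sz b"
    and "ptime f" "ptime g"
  shows "ptime (\<lambda>x. h (f x) (g x))"
proof -
  from assms(3,4) obtain P e e' T T' where
    T: "pbound T" "computes P e T f" "pbound T'" "computes P e' T' g" by (rule ptime_link2)
  let ?T = "\<lambda>x. 1 + (sz (f x) + sz (g x)) + T x + T' x"
  show ?thesis
  proof (rule ptimeI)
    show "pbound ?T" by (intro pbound_intros T ptime_pbound_sz assms)
    show "computes P (Prim2 u e e') ?T (\<lambda>x. h (f x) (g x))"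
    proof (rule computesI)
      fix x
      show "evals_within P [enc x] (Prim2 u e e') (enc (h (f x) (g x))) (?T x)"
        by (rule evals_within_mono[OF evals_within_Prim2[OF computesD[OF T(2)] computesD[OF T(4)] assms(1)]])
          (use assms(2)[of "f x" "g x"] in \<open>simp add: sz_def\<close>)
    qed
  qed
qed

lemma ptime_Cons [ptime_intros]: "ptime f \<Longrightarrow> ptime g \<Longrightarrow> ptime (\<lambda>x. f x # g x)"
  by (rule ptime_binop[where u = Prepend]) (auto simp: enc_list_def)

lemma floorlog_add: "floorlog 2 (a + b) \<le> 1 + (floorlog 2 a + floorlog 2 b)"
proof -
  have "a < 2 ^ floorlog 2 a" "b < 2 ^ floorlog 2 b" by (auto intro: floorlog_leD)
  moreover have "(2::nat) ^ floorlog 2 a \<le> 2 ^ (floorlog 2 a + floorlog 2 b)"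
    "(2::nat) ^ floorlog 2 b \<le> 2 ^ (floorlog 2 a + floorlog 2 b)" by (auto intro: power_increasing)
  ultimately have "a + b < 2 * 2 ^ (floorlog 2 a + floorlog 2 b)" by linarith
  then have "a + b < 2 ^ (1 + (floorlog 2 a + floorlog 2 b))" by simp
  then show ?thesis by (intro floorlog_leI) auto
qed

lemma floorlog_mult: "floorlog 2 (a * b) \<le> floorlog 2 a + floorlog 2 b"
proof -
  have "a < 2 ^ floorlog 2 a" "b < 2 ^ floorlog 2 b" by (auto intro: floorlog_leD)
  then have "a * b < 2 ^ (floorlog 2 a + floorlog 2 b)"
    unfolding power_add by (intro mult_strict_mono) auto
  then show ?thesis by (intro floorlog_leI) auto
qed

lemma sz_int_mono: "\<bar>x\<bar> \<le> \<bar>y :: int\<bar> \<Longrightarrow> sz x \<le> sz y"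
  unfolding sz_int by (intro add_left_mono floorlog_mono) simp

lemma sz_add: "sz (x + y :: int) \<le> sz x + sz y"
proof -
  have "floorlog 2 (nat \<bar>x + y\<bar>) \<le> floorlog 2 (nat \<bar>x\<bar> + nat \<bar>y\<bar>)" by (intro floorlog_mono) linarith
  also have "\<dots> \<le> 1 + (floorlog 2 (nat \<bar>x\<bar>) + floorlog 2 (nat \<bar>y\<bar>))" by (rule floorlog_add)
  finally show ?thesis by (simp add: sz_int)
qed

lemma sz_diff: "sz (x - y :: int) \<le> sz x + sz y"
  using sz_add[of x "- y"] by (simp add: sz_int)

lemma sz_mult: "sz (x * y :: int) \<le> sz x + sz y"
  using floorlog_mult[of "nat \<bar>x\<bar>" "nat \<bar>y\<bar>"] by (simp add: sz_int abs_mult nat_mult_distrib)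

lemma abs_div_le: "\<bar>x div y\<bar> \<le> \<bar>x :: int\<bar>"
proof -
  have pos: "\<bar>x div y\<bar> \<le> \<bar>x\<bar>" if "0 < y" for x y :: int
  proof (cases "0 \<le> x")
    case True
    then have "x \<le> x * y" using mult_left_mono[of 1 y x] that by simp
    then have "x div y \<le> x * y div y" using that by (rule zdiv_mono1)
    moreover have "0 \<le> x div y" using True that by (simp add: pos_imp_zdiv_nonneg_iff)
    ultimately show ?thesis using that True by simp
  next
    case False
    then have "x * y \<le> x" using mult_left_mono_neg[of 1 y x] that by simp
    then have "x * y div y \<le> x div y" using that by (rule zdiv_mono1)
    moreover have "x div y < 0" using False that by (simp add: pos_imp_zdiv_neg_iff)
    ultimately show ?thesis using that False by simp
  qed
  consider "y = 0" | "0 < y" | "0 < - y" by linarith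
  then show ?thesis
    using pos[of y x] pos[of "- y" "- x"] by cases (auto simp: div_minus_minus)
qed

lemma sz_div: "sz (x div y :: int) \<le> sz x + sz y"
  using sz_int_mono[OF abs_div_le[of x y]] by simp

lemma ptime_int_ops [ptime_intros]:
  fixes f g :: "'a :: encodable \<Rightarrow> int"
  assumes "ptime f" "ptime g"
  shows "ptime (\<lambda>x. f x + g x)" "ptime (\<lambda>x. f x - g x)" "ptime (\<lambda>x. f x * g x)"
    "ptime (\<lambda>x. f x div g x)" "ptime (\<lambda>x. f x \<le> g x)"
proof -
  show "ptime (\<lambda>x. f x + g x)"
    by (rule ptime_binop[where u = Add, OF _ sz_add assms]) (simp add: enc_int_def)
  show "ptime (\<lambda>x. f x - g x)"
    by (rule ptime_binop[where u = Sub, OF _ sz_diff assms]) (simp add: enc_int_def)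
  show "ptime (\<lambda>x. f x * g x)"
    by (rule ptime_binop[where u = Mul, OF _ sz_mult assms]) (simp add: enc_int_def)
  show "ptime (\<lambda>x. f x div g x)"
    by (rule ptime_binop[where u = Div, OF _ sz_div assms]) (simp add: enc_int_def)
  show "ptime (\<lambda>x. f x \<le> g x)"
  proof (rule ptime_binop[where u = Leq, OF _ _ assms])
    fix a b :: int
    show "sz (a \<le> b) \<le> sz a + sz b"
      using sz_pos[of a] sz_pos[of b] sz_bool[of "a \<le> b"] by linarith
  qed (simp add: enc_int_def enc_bool_def)
qed

text \<open>
  A pair is encoded as a list of length two, so the second component is the head of the tail. The tail
  alone is a function into lists.
\<close>

lemma ptime_fst_snd:
  "ptime (fst :: 'a :: encodable \<times> 'b :: encodable \<Rightarrow> 'a)"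
  "ptime (snd :: 'a :: encodable \<times> 'b :: encodable \<Rightarrow> 'b)"
proof -
  show "ptime (fst :: 'a \<times> 'b \<Rightarrow> 'a)"
    by (rule ptime_unop[where u = Head])
      (auto simp: enc_prod_def sz_fst_snd intro: pbound_mono[OF pbound_sz])
  define tl_enc where "tl_enc z = [snd z]" for z :: "'a \<times> 'b"
  have 1: "ptime tl_enc"
    by (rule ptime_unop[where u = Tail])
      (auto simp: enc_prod_def enc_list_def tl_enc_def intro: pbound_intros)
  obtain P e T where T: "pbound T" "computes P e T tl_enc" using 1 unfolding ptime_def by blast
  show "ptime (snd :: 'a \<times> 'b \<Rightarrow> 'b)"
  proof (rule ptimeI)
    show "pbound (\<lambda>z::'a \<times> 'b. 1 + sz z + T z)" by (intro pbound_intros T)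
    show "computes P (Prim1 Head e) (\<lambda>z. 1 + sz z + T z) snd"
    proof (rule computesI)
      fix z
      have "eval_unop Head (enc (tl_enc z)) = Some (enc (snd z))" by (simp add: tl_enc_def enc_list_def)
      from evals_within_Prim1[OF computesD[OF T(2)] this]
      show "evals_within P [enc z] (Prim1 Head e) (enc (snd z)) (1 + sz z + T z)"
        by (rule evals_within_mono) (use sz_fst_snd(2)[of z] in \<open>simp add: sz_def\<close>)
    qed
  qed
qed

lemmas [ptime_intros] = ptime_comp[OF ptime_fst_snd(1)] ptime_comp[OF ptime_fst_snd(2)]

lemma ptime_Pair [ptime_intros]:
  assumes "ptime f" "ptime g"
  shows "ptime (\<lambda>x. (f x, g x))"
proof -
  from assms obtain P e e' T T' where
    T: "pbound T" "computes P e T f" "pbound T'" "computes P e' T' g" by (rule ptime_link2)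
  let ?T = "\<lambda>x. 6 + T x + T' x + sz (f x) + 2 * sz (g x)"
  show ?thesis
  proof (rule ptimeI)
    show "pbound ?T" by (intro pbound_intros T ptime_pbound_sz assms)
    show "computes P (pair_expr e e') ?T (\<lambda>x. (f x, g x))"
      by (intro computesI evals_within_pair computesD[OF T(2)] computesD[OF T(4)])
  qed
qed

lemma ptime_comp2:
  assumes "ptime (\<lambda>z. h (fst z) (snd z))" "ptime f" "ptime g"
  shows "ptime (\<lambda>x. h (f x) (g x))"
  using ptime_comp[OF assms(1) ptime_Pair[OF assms(2,3)]] by simp

lemma ptime_If [ptime_intros]:
  assumes "ptime b" "ptime f" "ptime g"
  shows "ptime (\<lambda>x. if b x then f x else g x)"
proof -
  from assms obtain P e e' e'' T T' T'' where
    T: "pbound T" "computes P e T b" "pbound T'" "computes P e' T' f" "pbound T''" "computes P e'' T'' g"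
    by (rule ptime_link3)
  let ?T = "\<lambda>x. 1 + T x + T' x + T'' x"
  show ?thesis
  proof (rule ptimeI)
    show "pbound ?T" by (intro pbound_intros T)
    show "computes P (Cond e e' e'') ?T (\<lambda>x. if b x then f x else g x)"
    proof (rule computesI)
      fix x
      have "evals_within P [enc x] (if b x then e' else e'') (enc (if b x then f x else g x)) (T' x + T'' x)"
        using evals_within_mono[OF computesD[OF T(4)]] evals_within_mono[OF computesD[OF T(6)]] by simp
      from evals_within_Cond[OF computesD[OF T(2)] this]
      show "evals_within P [enc x] (Cond e e' e'') (enc (if b x then f x else g x)) (?T x)"
        by (rule evals_within_mono) simp
    qed
  qed
qed

lemma ptime_bool_ops [ptime_intros]:
  assumes "ptime b" "ptime b'"
  shows "ptime (\<lambda>x. b x \<and> b' x)" "ptime (\<lambda>x. b x \<or> b' x)" "ptime (\<lambda>x. b x \<longrightarrow> b' x)"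
proof -
  show "ptime (\<lambda>x. b x \<and> b' x)"
    by (rule ptime_cong[where f = "\<lambda>x. if b x then b' x else False"], intro ptime_intros assms, simp)
  show "ptime (\<lambda>x. b x \<or> b' x)"
    by (rule ptime_cong[where f = "\<lambda>x. if b x then True else b' x"], intro ptime_intros assms, simp)
  show "ptime (\<lambda>x. b x \<longrightarrow> b' x)"
    by (rule ptime_cong[where f = "\<lambda>x. if b x then b' x else True"], intro ptime_intros assms, simp)
qed

lemma ptime_Not [ptime_intros]: "ptime b \<Longrightarrow> ptime (\<lambda>x. \<not> b x)"
  by (rule ptime_cong[where f = "\<lambda>x. if b x then False else True"], intro ptime_intros, assumption, simp)

lemma ptime_int_less_eq [ptime_intros]:
  fixes f g :: "'a :: encodable \<Rightarrow> int"
  assumes "ptime f" "ptime g"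
  shows "ptime (\<lambda>x. f x < g x)" "ptime (\<lambda>x. f x = g x)"
proof -
  show "ptime (\<lambda>x. f x < g x)"
    by (rule ptime_cong[where f = "\<lambda>x. \<not> (g x \<le> f x)"], intro ptime_intros assms, auto)
  show "ptime (\<lambda>x. f x = g x)"
    by (rule ptime_cong[where f = "\<lambda>x. f x \<le> g x \<and> g x \<le> f x"], intro ptime_intros assms, auto)
qed

lemma ptime_int_unary [ptime_intros]:
  fixes f :: "'a :: encodable \<Rightarrow> int"
  assumes "ptime f"
  shows "ptime (\<lambda>x. - f x)" "ptime (\<lambda>x. \<bar>f x\<bar>)" "ptime (\<lambda>x. sgn (f x))" "ptime (\<lambda>x. nat (f x))"
proof -
  show "ptime (\<lambda>x. - f x)"
    by (rule ptime_cong[where f = "\<lambda>x. 0 - f x"], intro ptime_intros assms, simp)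
  show "ptime (\<lambda>x. \<bar>f x\<bar>)"
    by (rule ptime_cong[where f = "\<lambda>x. if f x < 0 then 0 - f x else f x"], intro ptime_intros assms, simp)
  show "ptime (\<lambda>x. sgn (f x))"
    by (rule ptime_cong[where f = "\<lambda>x. if f x = 0 then 0 else if 0 < f x then 1 else -1"],
        intro ptime_intros assms, simp add: sgn_if)
  have "ptime (\<lambda>x. if f x < 0 then 0 else f x)" by (intro ptime_intros assms)
  then show "ptime (\<lambda>x. nat (f x))"
    by (rule ptime_same_encoding) (auto simp: enc_nat_def enc_int_def)
qed

lemma ptime_of_nat [ptime_intros]: "ptime f \<Longrightarrow> ptime (\<lambda>x. int (f x))"
  by (erule ptime_same_encoding) (auto simp: enc_nat_def enc_int_def)

lemma ptime_Suc [ptime_intros]: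
  assumes "ptime f" shows "ptime (\<lambda>x. Suc (f x))"
proof -
  have "ptime (\<lambda>x. int (f x) + 1)" by (intro ptime_intros assms)
  then show ?thesis
    by (rule ptime_same_encoding) (auto simp: enc_nat_def enc_int_def)
qed

lemma ptime_nat_ops [ptime_intros]:
  fixes f g :: "'a :: encodable \<Rightarrow> nat"
  assumes "ptime f" "ptime g"
  shows "ptime (\<lambda>x. f x = g x)" "ptime (\<lambda>x. f x - g x)"
proof -
  show "ptime (\<lambda>x. f x = g x)"
    by (rule ptime_cong[where f = "\<lambda>x. int (f x) = int (g x)"], intro ptime_intros assms, simp)
  show "ptime (\<lambda>x. f x - g x)"
    by (rule ptime_cong[where f = "\<lambda>x. nat (int (f x) - int (g x))"], intro ptime_intros assms, simp)
qed

lemma ptime_null [ptime_intros]: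
  assumes "ptime f" shows "ptime (\<lambda>x. f x = [])"
proof (rule ptime_comp[OF _ assms])
  show "ptime (\<lambda>xs::'b list. xs = [])"
    by (rule ptime_unop[where u = IsEmpty])
      (auto simp: enc_list_def enc_bool_def sz_def intro!: pbound_mono[OF pbound_const[of 2]] floorlog_leI)
qed

text \<open>
  The branch for a nonempty list is a function of three arguments, hence of the triple encoded by
  nested pairs; the expression builds this triple and binds it.
\<close>

lemma ptime_case_list [ptime_intros]:
  assumes "ptime l" "ptime f" "ptime (\<lambda>z. g (fst z) (fst (snd z)) (snd (snd z)))"
  shows "ptime (\<lambda>x. case l x of [] \<Rightarrow> f x | y # ys \<Rightarrow> g x y ys)"
proof -
  from assms obtain P e e' e'' T T' T'' where
    T: "pbound T" "computes P e T l" "pbound T'" "computes P e' T' f"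
       "pbound T''" "computes P e'' T'' (\<lambda>z. g (fst z) (fst (snd z)) (snd (snd z)))"
    by (rule ptime_link3)
  obtain k where k: "\<And>z. T'' z \<le> (sz z + 2) ^ k" using T(5) unfolding pbound_def by blast
  let ?p = "pair_expr (Var 0) (pair_expr (Prim1 Head e) (Prim1 Tail e))"
  let ?e = "Cond (Prim1 IsEmpty e) e' (LetIn ?p e'')"
  let ?T = "\<lambda>x. 40 + 10 * T x + T' x + 10 * sz x + 10 * sz (l x) + (sz x + sz (l x) + 10) ^ k"
  show ?thesis
  proof (rule ptimeI)
    show "pbound ?T" by (intro pbound_intros T ptime_pbound_sz assms)
    show "computes P ?e ?T (\<lambda>x. case l x of [] \<Rightarrow> f x | y # ys \<Rightarrow> g x y ys)"
    proof (rule computesI)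
      fix x
      note l = computesD[OF T(2), of x "[]"]
      have "eval_unop IsEmpty (enc (l x)) = Some (enc (l x = []))" by (simp add: enc_list_def enc_bool_def)
      note null = evals_within_Prim1[OF l this]
      have null_size: "val_size (enc (l x = [])) \<le> 2" using sz_bool by (simp only: sz_def)
      show "evals_within P [enc x] ?e (enc (case l x of [] \<Rightarrow> f x | y # ys \<Rightarrow> g x y ys)) (?T x)"
      proof (cases "l x")
        case Nil
        have "evals_within P [enc x] (if l x = [] then e' else LetIn ?p e'') (enc (f x)) (T' x)"
          using computesD[OF T(4)] Nil by simp
        from evals_within_Cond[OF null this] show ?thesis
          unfolding Nil list.case by (rule evals_within_mono) (use null_size Nil in simp)
      next
        case (Cons y ys)
        have "eval_unop Head (enc (l x)) = Some (enc y)" "eval_unop Tail (enc (l x)) = Some (enc ys)"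
          by (simp_all add: Cons enc_list_def)
        note hd = evals_within_Prim1[OF l this(1)] and tl = evals_within_Prim1[OF l this(2)]
        note p = evals_within_pair[OF evals_within_Var0[of P "enc x" "[]"] evals_within_pair[OF hd tl]]
        have "evals_within P (enc (x, y, ys) # [enc x]) e'' (enc (g x y ys)) (T'' (x, y, ys))"
          using computesD[OF T(6), of "(x, y, ys)"] by simp
        from evals_within_LetIn[OF p this]
        have "evals_within P [enc x] (if l x = [] then e' else LetIn ?p e'') (enc (g x y ys))
          (1 + (6 + (1 + val_size (enc x)) + (6 + (1 + val_size (enc y) + T x) + (1 + val_size (enc ys) + T x) +
            sz y + 2 * sz ys) + sz x + 2 * sz (y, ys)) + T'' (x, y, ys))" by (simp add: Cons)
        note body = evals_within_Cond[OF null this]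
        have "T'' (x, y, ys) \<le> (sz (x, y, ys) + 2) ^ k" by (rule k)
        also have "\<dots> \<le> (sz x + sz (l x) + 10) ^ k" by (rule power_mono) (auto simp: Cons)
        finally have "T'' (x, y, ys) \<le> (sz x + sz (l x) + 10) ^ k" .
        moreover have "val_size (enc (l x)) = val_size (enc y) + val_size (enc ys)"
          by (simp only: Cons sz_def[symmetric] sz_Cons)
        moreover have "sz (y, ys) = 1 + val_size (enc y) + val_size (enc ys)" by (simp add: sz_def enc_prod_def)
        ultimately show ?thesis unfolding Cons list.case
          by (intro evals_within_mono[OF body[unfolded Cons]]) (use null_size Cons in \<open>simp add: sz_def\<close>)
      qed
    qed
  qed
qed

text \<open>
  The only source of unbounded computation is a function that calls itself. If the loop stops after at
  most \<open>J x\<close> rounds and all states passed have size at most \<open>S x\<close>, each round costs at most a fixed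
  power of \<open>S x + 2\<close>. The bounds on the number of rounds and on the sizes are both indispensable:
  repeated squaring takes few rounds but produces exponentially long numbers.
\<close>

lemma ptime_while:
  fixes r :: "'a :: encodable \<Rightarrow> 'a"
  assumes "ptime b" "ptime s" and r: "\<And>x. r x = (if b x then r (s x) else x)"
    and "pbound J" "pbound S"
    and stop: "\<And>x. \<exists>j \<le> J x. \<not> b ((s ^^ j) x) \<and> (\<forall>i \<le> j. sz ((s ^^ i) x) \<le> S x)"
  shows "ptime r"
proof -
  from assms(1,2) obtain P e e' T T' where
    T: "pbound T" "computes P e T b" "pbound T'" "computes P e' T' s" by (rule ptime_link2)
  define c where "c x = 3 + T x + T' x + sz x" for x
  have "pbound c" unfolding c_def by (intro pbound_intros T)
  then obtain k where k: "\<And>x. c x \<le> (sz x + 2) ^ k" unfolding pbound_def by blast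
  let ?body = "Cond e (Call (length P) [e']) (Var 0)"
  let ?P = "P @ [?body]"
  have run: "evals_within ?P [enc x] ?body (enc (r x)) (Suc j * C)"
    if "\<not> b ((s ^^ j) x)" "\<And>i. i \<le> j \<Longrightarrow> c ((s ^^ i) x) \<le> C" for j x C
    using that
  proof (induction j arbitrary: x)
    case base: 0
    then have b: "\<not> b x" and C: "c x \<le> C" by auto
    have "evals_within ?P [enc x] (if b x then Call (length P) [e'] else Var 0) (enc (r x)) (1 + val_size (enc x))"
      using evals_within_Var0 b r[of x] by simp
    from evals_within_Cond[OF computesD[OF computes_append[OF T(2)]] this] show ?case
      by (rule evals_within_mono) (use C in \<open>simp add: c_def sz_def\<close>)
  next
    case (Suc j)
    have C: "c x \<le> C" using Suc.prems(2)[of 0] by simp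
    have "evals_within ?P [enc x] (if b x then Call (length P) [e'] else Var 0) (enc (r x))
        (1 + T' x + Suc j * C + sz x)"
    proof (cases "b x")
      case False
      then show ?thesis using evals_within_mono[OF evals_within_Var0, of "enc x"] r[of x] by (simp add: sz_def)
    next
      case True
      have "c ((s ^^ i) (s x)) \<le> C" if "i \<le> j" for i
        using Suc.prems(2)[of "Suc i"] that by (simp add: funpow_swap1)
      moreover have "\<not> b ((s ^^ j) (s x))" using Suc.prems(1) by (simp add: funpow_swap1)
      ultimately have "evals_within ?P [enc (s x)] (?P ! length P) (enc (r (s x))) (Suc j * C)"
        using Suc.IH by simp
      from evals_within_Call[OF computesD[OF computes_append[OF T(4)]] _ this]
      have "evals_within ?P [enc x] (Call (length P) [e']) (enc (r (s x))) (1 + T' x + Suc j * C)" by simp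
      then show ?thesis using True r[of x] by (simp add: evals_within_mono)
    qed
    from evals_within_Cond[OF computesD[OF computes_append[OF T(2)]] this] show ?case
      by (rule evals_within_mono) (use C in \<open>simp add: c_def\<close>)
  qed
  show ?thesis
  proof (rule ptimeI)
    show "pbound (\<lambda>x. Suc (J x) * (S x + 2) ^ k)"
      by (intro pbound_intros assms)
    show "computes ?P ?body (\<lambda>x. Suc (J x) * (S x + 2) ^ k) r"
    proof (rule computesI)
      fix x
      obtain j where j: "j \<le> J x" "\<not> b ((s ^^ j) x)" "\<And>i. i \<le> j \<Longrightarrow> sz ((s ^^ i) x) \<le> S x"
        using stop by blast
      have "c ((s ^^ i) x) \<le> (S x + 2) ^ k" if "i \<le> j" for i
        by (rule order.trans[OF k]) (use j(3)[OF that] in \<open>simp add: power_mono\<close>)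
      with j(2) have "evals_within ?P [enc x] ?body (enc (r x)) (Suc j * (S x + 2) ^ k)" by (rule run)
      then show "evals_within ?P [enc x] ?body (enc (r x)) (Suc (J x) * (S x + 2) ^ k)"
        by (rule evals_within_mono) (rule mult_le_mono1, use j(1) in simp)
    qed
  qed
qed

section \<open>Polynomial-time list processing\<close>

lemma sz_take_drop: "sz (take i xs) \<le> sz xs" "sz (drop i xs) \<le> sz xs"
  using sz_append[of "take i xs" "drop i xs"] sz_pos[of "take i xs"] sz_pos[of "drop i xs"] by auto

text \<open>
  The state of the loop is the triple of the parameter, the accumulator and the rest of the list. The
  parameter \<open>x\<close> is carried along since programs have no closures.
\<close>

lemma ptime_foldl_bounded:
  fixes f :: "'c :: encodable \<Rightarrow> 'a :: encodable \<Rightarrow> 'b :: encodable \<Rightarrow> 'a"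
  assumes f: "ptime (\<lambda>z. f (fst z) (fst (snd z)) (snd (snd z)))" and h: "ptime h" and g: "ptime g"
    and G: "pbound G" and bound: "\<And>c a xs. sz (foldl (f c) a xs) \<le> G (c, a, xs)"
  shows "ptime (\<lambda>x. foldl (f x) (h x) (g x))"
proof -
  define s where "s z = (case snd (snd z) of [] \<Rightarrow> z | y # ys \<Rightarrow> (fst z, f (fst z) (fst (snd z)) y, ys))"
    for z :: "'c \<times> 'a \<times> 'b list"
  define r where "r z = (fst z, foldl (f (fst z)) (fst (snd z)) (snd (snd z)), [] :: 'b list)"
    for z :: "'c \<times> 'a \<times> 'b list"
  obtain k where k: "\<And>z. G z \<le> (sz z + 2) ^ k" using G unfolding pbound_def by blast
  have it: "(s ^^ i) (c, a, xs) = (c, foldl (f c) a (take i xs), drop i xs)" for i c a xs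
  proof (induction i)
    case (Suc i)
    show ?case
    proof (cases "drop i xs")
      case Nil
      then show ?thesis using Suc by (simp add: s_def)
    next
      case (Cons y ys)
      then have i: "i < length xs" by (metis drop_eq_Nil leI list.distinct(1))
      then have "y = xs ! i" "ys = drop (Suc i) xs" using Cons by (auto simp: Cons_nth_drop_Suc[symmetric])
      with i show ?thesis using Suc Cons by (simp add: s_def take_Suc_conv_app_nth)
    qed
  qed simp
  have "ptime r"
  proof (rule ptime_while[where b = "\<lambda>z. snd (snd z) \<noteq> []" and s = s])
    show "ptime (\<lambda>z :: 'c \<times> 'a \<times> 'b list. snd (snd z) \<noteq> [])" by (intro ptime_intros)
    have "ptime (\<lambda>z :: ('c \<times> 'a \<times> 'b list) \<times> 'b \<times> 'b list.
        f (fst (fst z)) (fst (snd (fst z))) (fst (snd z)))"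
    proof -
      have "ptime (\<lambda>z :: ('c \<times> 'a \<times> 'b list) \<times> 'b \<times> 'b list. (fst (fst z), fst (snd (fst z)), fst (snd z)))"
        by (intro ptime_intros)
      from ptime_comp[OF f this] show ?thesis by simp
    qed
    then show "ptime s" unfolding s_def by (intro ptime_intros)
    show "r z = (if snd (snd z) \<noteq> [] then r (s z) else z)" for z
      by (cases z; cases "snd (snd z)") (auto simp: r_def s_def)
    show "pbound (sz :: 'c \<times> 'a \<times> 'b list \<Rightarrow> nat)" by (rule pbound_sz)
    show "pbound (\<lambda>z :: 'c \<times> 'a \<times> 'b list. 2 * sz z + (sz z + 2) ^ k)" by (intro pbound_intros)
    show "\<exists>j\<le>sz z. \<not> snd (snd ((s ^^ j) z)) \<noteq> [] \<and>
        (\<forall>i\<le>j. sz ((s ^^ i) z) \<le> 2 * sz z + (sz z + 2) ^ k)" for z :: "'c \<times> 'a \<times> 'b list"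
    proof (cases z)
      case (fields c a xs)
      have "sz ((s ^^ i) z) \<le> 2 * sz z + (sz z + 2) ^ k" for i
      proof -
        have "sz (foldl (f c) a (take i xs)) \<le> (sz (c, a, take i xs) + 2) ^ k"
          using bound k le_trans by blast
        also have "\<dots> \<le> (sz z + 2) ^ k"
          by (rule power_mono) (auto simp: fields sz_take_drop)
        finally show ?thesis using sz_take_drop(2)[of i xs] sz_pos[of z] by (simp add: fields it)
      qed
      moreover have "snd (snd ((s ^^ length xs) z)) = []" by (simp add: fields it)
      moreover have "length xs \<le> sz z" using length_le_sz[of xs] by (simp add: fields)
      ultimately show ?thesis by blast
    qed
  qed
  moreover have "ptime (\<lambda>x. (x, h x, g x))" by (intro ptime_intros h g)
  ultimately have "ptime (\<lambda>x. r (x, h x, g x))" by (rule ptime_comp)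
  then have "ptime (\<lambda>x. fst (snd (r (x, h x, g x))))" by (intro ptime_intros)
  then show ?thesis by (simp add: r_def)
qed

lemma sz_foldl_additive:
  assumes "\<And>a y. y \<in> set xs \<Longrightarrow> sz (f a y) \<le> sz a + b"
  shows "sz (foldl f a xs) \<le> sz a + length xs * b"
  using assms
proof (induction xs arbitrary: a)
  case (Cons y ys)
  have "sz (foldl f (f a y) ys) \<le> sz (f a y) + length ys * b" using Cons by simp
  also have "\<dots> \<le> sz a + b + length ys * b" using Cons.prems[of y a] by simp
  finally show ?case by simp
qed simp

text \<open>
  If one step adds to the size of the accumulator an amount that does not depend on the accumulator,
  then the final size is polynomial; a bound by a multiple of the accumulator would not be enough.
\<close>

lemma ptime_foldl:
  fixes f :: "'c :: encodable \<Rightarrow> 'a :: encodable \<Rightarrow> 'b :: encodable \<Rightarrow> 'a"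
  assumes f: "ptime (\<lambda>z. f (fst z) (fst (snd z)) (snd (snd z)))" and h: "ptime h" and g: "ptime g"
    and G: "pbound G" and bound: "\<And>c a y. sz (f c a y) \<le> sz a + G (c, y)"
  shows "ptime (\<lambda>x. foldl (f x) (h x) (g x))"
proof -
  obtain k where k: "\<And>z. G z \<le> (sz z + 2) ^ k" using G unfolding pbound_def by blast
  show ?thesis
  proof (rule ptime_foldl_bounded[OF f h g])
    show "pbound (\<lambda>z :: 'c \<times> 'a \<times> 'b list. sz z + sz z * (sz z + 3) ^ k)" by (intro pbound_intros)
    show "sz (foldl (f c) a xs) \<le> sz (c, a, xs) + sz (c, a, xs) * (sz (c, a, xs) + 3) ^ k" for c a xs
    proof -
      have step: "y \<in> set xs \<Longrightarrow> sz (f c a' y) \<le> sz a' + (sz (c, a, xs) + 3) ^ k" for a' y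
      proof -
        assume y: "y \<in> set xs"
        have "G (c, y) \<le> (sz (c, a, xs) + 3) ^ k"
          by (rule order.trans[OF k]) (use sz_mem[OF y] in \<open>simp add: power_mono\<close>)
        with bound[of c a' y] show "sz (f c a' y) \<le> sz a' + (sz (c, a, xs) + 3) ^ k" by linarith
      qed
      have "sz (foldl (f c) a xs) \<le> sz a + length xs * (sz (c, a, xs) + 3) ^ k"
        by (rule sz_foldl_additive) (rule step)
      also have "length xs * (sz (c, a, xs) + 3) ^ k \<le> sz (c, a, xs) * (sz (c, a, xs) + 3) ^ k"
        using length_le_sz[of xs] by (intro mult_le_mono1) simp
      finally show ?thesis by simp
    qed
  qed
qed

lemma ptime_rev_append: "ptime f \<Longrightarrow> ptime g \<Longrightarrow> ptime (\<lambda>x. rev (f x) @ g x)"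
proof -
  assume fg: "ptime f" "ptime g"
  have "ptime (\<lambda>x. foldl (\<lambda>acc y. y # acc) (g x) (f x))"
    by (rule ptime_foldl[where G = "\<lambda>z. sz (snd z)" and f = "\<lambda>_ acc y. y # acc"])
      (auto intro!: ptime_intros pbound_intros fg)
  moreover have "foldl (\<lambda>acc y. y # acc) ys xs = rev xs @ ys" for xs ys :: "'b list"
    by (induction xs arbitrary: ys) auto
  ultimately show ?thesis by simp
qed

lemma ptime_rev [ptime_intros]: "ptime f \<Longrightarrow> ptime (\<lambda>x. rev (f x))"
  using ptime_rev_append[OF _ ptime_const[of "[]"], of f] by simp

lemma ptime_append [ptime_intros]: "ptime f \<Longrightarrow> ptime g \<Longrightarrow> ptime (\<lambda>x. f x @ g x)"
  using ptime_rev_append[OF ptime_rev] by fastforce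

lemma ptime_concat [ptime_intros]:
  assumes "ptime f" shows "ptime (\<lambda>x. concat (f x))"
proof -
  have "ptime (\<lambda>x. foldl (\<lambda>acc ys. acc @ ys) [] (f x))"
  proof (rule ptime_foldl[where G = "\<lambda>z. sz (snd z)" and f = "\<lambda>_ acc y. acc @ y"])
    show "sz (a @ y) \<le> sz a + sz (snd (c, y))" for a y :: "'b list" and c :: 'a
      using sz_append[of a y] by simp
  qed (intro ptime_intros pbound_intros assms)+
  moreover have "foldl (\<lambda>acc ys. acc @ ys) zs xs = zs @ concat xs" for xs and zs :: "'b list"
    by (induction xs arbitrary: zs) auto
  ultimately show ?thesis by simp
qed

lemma ptime_concat_map:
  assumes f: "ptime (\<lambda>z. f (fst z) (snd z))" and g: "ptime g"
  shows "ptime (\<lambda>x. concat (map (f x) (g x)))"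
proof -
  have f': "ptime (\<lambda>z. f (fst z) (snd (snd z)))"
    by (rule ptime_comp2[OF f]) (intro ptime_intros)+
  have "ptime (\<lambda>x. foldl (\<lambda>acc y. acc @ f x y) [] (g x))"
  proof (rule ptime_foldl[where G = "\<lambda>z. sz (f (fst z) (snd z))" and f = "\<lambda>x acc y. acc @ f x y"])
    show "ptime (\<lambda>z. fst (snd z) @ f (fst z) (snd (snd z)))" by (intro ptime_intros f')
    show "pbound (\<lambda>z. sz (f (fst z) (snd z)))" by (rule ptime_pbound_sz[OF f])
    show "sz (a @ f c y) \<le> sz a + sz (f (fst (c, y)) (snd (c, y)))" for a c y
      using sz_append[of a "f c y"] by simp
  qed (intro ptime_intros g)+
  moreover have "foldl (\<lambda>acc y. acc @ f x y) zs xs = zs @ concat (map (f x) xs)" for x xs zs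
    by (induction xs arbitrary: zs) auto
  ultimately show ?thesis by simp
qed

lemma ptime_map [ptime_intros]:
  assumes f: "ptime (\<lambda>z. f (fst z) (snd z))" and g: "ptime g"
  shows "ptime (\<lambda>x. map (f x) (g x))"
proof -
  have "ptime (\<lambda>x. concat (map (\<lambda>y. [f x y]) (g x)))"
    by (rule ptime_concat_map[OF _ g]) (intro ptime_intros f)
  then show ?thesis by (simp add: concat_map_singleton)
qed

lemma ptime_filter [ptime_intros]:
  assumes f: "ptime (\<lambda>z. f (fst z) (snd z))" and g: "ptime g"
  shows "ptime (\<lambda>x. filter (f x) (g x))"
proof -
  have "ptime (\<lambda>x. concat (map (\<lambda>y. if f x y then [y] else []) (g x)))"
    by (rule ptime_concat_map[OF _ g]) (intro ptime_intros f)
  moreover have "concat (map (\<lambda>y. if f x y then [y] else []) ys) = filter (f x) ys" for x ys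
    by (induction ys) auto
  ultimately show ?thesis by simp
qed

lemma ptime_Bex_Ball [ptime_intros]:
  assumes f: "ptime (\<lambda>z. f (fst z) (snd z))" and g: "ptime g"
  shows "ptime (\<lambda>x. \<exists>y\<in>set (g x). f x y)" "ptime (\<lambda>x. \<forall>y\<in>set (g x). f x y)"
proof -
  show "ptime (\<lambda>x. \<exists>y\<in>set (g x). f x y)"
    by (rule ptime_cong[where f = "\<lambda>x. filter (f x) (g x) \<noteq> []"], intro ptime_intros f g,
        auto simp: filter_empty_conv)
  show "ptime (\<lambda>x. \<forall>y\<in>set (g x). f x y)"
    by (rule ptime_cong[where f = "\<lambda>x. filter (\<lambda>y. \<not> f x y) (g x) = []"], intro ptime_intros f g,
        auto simp: filter_empty_conv)
qed

lemma ptime_sum_list [ptime_intros]: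
  fixes f :: "'a :: encodable \<Rightarrow> int list"
  assumes "ptime f" shows "ptime (\<lambda>x. sum_list (f x))"
proof -
  have "ptime (\<lambda>x. foldl (\<lambda>a y. a + y) 0 (f x))"
    by (rule ptime_foldl[where G = "\<lambda>z. sz (snd z)" and f = "\<lambda>_ a y. a + y"])
      (auto intro!: ptime_intros pbound_intros assms sz_add)
  moreover have "foldl (\<lambda>a y. a + y) k xs = k + sum_list xs" for k and xs :: "int list"
    by (induction xs arbitrary: k) auto
  ultimately show ?thesis by simp
qed

lemma sz_Suc: "sz (Suc k) \<le> sz k + 2"
proof -
  have "sz (Suc k) = sz (int k + 1)" using sz_of_nat[of "Suc k"] by (simp add: add.commute)
  also have "\<dots> \<le> sz (int k) + sz (1 :: int)" by (rule sz_add)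
  finally show ?thesis by (simp add: sz_of_nat) (simp add: sz_int floorlog_def)
qed

lemma ptime_length [ptime_intros]:
  assumes "ptime f" shows "ptime (\<lambda>x. length (f x))"
proof -
  have "ptime (\<lambda>x. foldl (\<lambda>a y. Suc a) 0 (f x))"
    by (rule ptime_foldl[where G = "\<lambda>z. 2" and f = "\<lambda>_ a y. Suc a"])
      (intro ptime_intros pbound_intros assms sz_Suc)+
  moreover have "foldl (\<lambda>a y. Suc a) k xs = k + length xs" for k and xs :: "'b list"
    by (induction xs arbitrary: k) auto
  ultimately show ?thesis by simp
qed

text \<open>
  Only ranges up to the \<^emph>\<open>length\<close> of a list are polynomial: a number is exponential in its binary
  length, while a list serves as a unary number.
\<close>

lemma ptime_indices [ptime_intros]:
  assumes "ptime f" shows "ptime (\<lambda>x. [0..<length (f x)])"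
proof -
  have "ptime (\<lambda>x. foldl (\<lambda>a y. a @ [length a]) [] (f x))"
  proof (rule ptime_foldl_bounded[where G = "\<lambda>z. sz (fst (snd z)) + sz (snd (snd z)) * (sz (fst (snd z)) + sz (snd (snd z)) + 1)" and f = "\<lambda>_ a y. a @ [length a]"])
    have sz_le: "sz k \<le> k + 1" for k :: nat
      using less_exp[of k] by (auto simp: sz_nat intro: floorlog_leI)
    fix c :: 'a and a :: "nat list" and xs :: "'b list"
    have "sz (foldl (\<lambda>a y. a @ [length a]) a xs) \<le> sz a + length xs * (length a + length xs + 1)"
    proof (induction xs arbitrary: a)
      case (Cons x xs)
      have "sz (foldl (\<lambda>a y. a @ [length a]) (a @ [length a]) xs) \<le>
          sz (a @ [length a]) + length xs * (length (a @ [length a]) + length xs + 1)" by (rule Cons)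
      moreover have "sz (a @ [length a]) \<le> sz a + length a + 1"
        using sz_append[of a "[length a]"] sz_le[of "length a"] by simp
      ultimately show ?case by (simp add: algebra_simps)
    qed simp
    also have "length xs * (length a + length xs + 1) \<le> sz xs * (sz a + sz xs + 1)"
      using length_le_sz[of xs] length_le_sz[of a] by (intro mult_le_mono) auto
    finally show "sz (foldl (\<lambda>a y. a @ [length a]) a xs) \<le>
      sz (fst (snd (c, a, xs))) + sz (snd (snd (c, a, xs))) * (sz (fst (snd (c, a, xs))) + sz (snd (snd (c, a, xs))) + 1)"
      by simp
  qed (intro ptime_intros pbound_intros assms)+
  moreover have "foldl (\<lambda>a y. a @ [length a]) [0..<k] xs = [0..<k + length xs]" for k and xs :: "'b list"
  proof (induction xs arbitrary: k)
    case (Cons x xs)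
    then show ?case using Cons[of "Suc k"] by simp
  qed simp
  from this[of 0] have "foldl (\<lambda>a y. a @ [length a]) [] xs = [0..<length xs]" for xs :: "'b list" by simp
  ultimately show ?thesis by simp
qed

text \<open>
  The fold counts positions and keeps the entry at the wanted one. The default value makes indexing
  total, as \<open>ptime\<close> requires.
\<close>

lemma ptime_nth_default [ptime_intros]:
  fixes f :: "'a :: encodable \<Rightarrow> 'b :: encodable list"
  assumes "ptime f" "ptime i" shows "ptime (\<lambda>x. nth_default d (f x) (i x))"
proof -
  let ?F = "\<lambda>j. foldl (\<lambda>(a :: nat \<times> 'b) y. if fst a = j then (Suc (fst a), y) else (Suc (fst a), snd a)) (0, d)"
  have "ptime (\<lambda>x. ?F (i x) (f x))"
  proof (rule ptime_foldl[where G = "\<lambda>z. sz (snd z) + 2"])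
    have "ptime (\<lambda>z :: 'a \<times> (nat \<times> 'b) \<times> 'b. i (fst z))"
      by (rule ptime_comp[OF assms(2)]) (intro ptime_intros)
    then show "ptime (\<lambda>z :: 'a \<times> (nat \<times> 'b) \<times> 'b. if fst (fst (snd z)) = i (fst z)
        then (Suc (fst (fst (snd z))), snd (snd z)) else (Suc (fst (fst (snd z))), snd (fst (snd z))))"
      by (intro ptime_intros)
    show "sz (if fst a = i c then (Suc (fst a), y) else (Suc (fst a), snd a)) \<le> sz a + (sz (snd (c, y)) + 2)"
      for a y c
      using sz_Suc[of "fst a"] by (cases a) auto
  qed (intro ptime_intros pbound_intros assms)+
  then have "ptime (\<lambda>x. snd (?F (i x) (f x)))" by (intro ptime_intros)
  moreover have "snd (?F j xs) = nth_default d xs j" for j xs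
  proof -
    have "foldl (\<lambda>(a :: nat \<times> 'b) y. if fst a = j then (Suc (fst a), y) else (Suc (fst a), snd a)) (k, e) xs
      = (k + length xs, if k \<le> j \<and> j < k + length xs then xs ! (j - k) else e)" for k e
    proof (induction xs arbitrary: k e)
      case (Cons x xs)
      show ?case unfolding foldl_Cons fst_conv snd_conv
        by (auto simp: Cons nth_Cons' Suc_diff_le split: if_splits intro!: arg_cong[of _ _ "nth xs"])
    qed auto
    then show ?thesis by (simp add: nth_default_def)
  qed
  ultimately show ?thesis by simp
qed

text \<open>
  The result has one element if \<open>xs\<close> has any and is empty otherwise, in place of an option
  type.
\<close>

definition argmax :: "('a \<Rightarrow> int) \<Rightarrow> 'a list \<Rightarrow> 'a list" where
  "argmax f xs = foldl (\<lambda>acc y. case acc of [] \<Rightarrow> [y] | z # zs \<Rightarrow> if f z < f y then [y] else [z]) [] xs"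

lemma argmax_snoc:
  "argmax f (xs @ [y]) = (case argmax f xs of [] \<Rightarrow> [y] | z # zs \<Rightarrow> if f z < f y then [y] else [z])"
  by (simp add: argmax_def)

lemma argmax_cases:
  obtains "xs = []" "argmax f xs = []"
  | y where "argmax f xs = [y]" "y \<in> set xs" "\<And>z. z \<in> set xs \<Longrightarrow> f z \<le> f y"
proof -
  have "(xs = [] \<and> argmax f xs = []) \<or>
    (\<exists>y. argmax f xs = [y] \<and> y \<in> set xs \<and> (\<forall>z\<in>set xs. f z \<le> f y))"
  proof (induction xs rule: rev_induct)
    case (snoc y xs)
    then consider "xs = []" | x where "argmax f xs = [x]" "x \<in> set xs" "\<forall>z\<in>set xs. f z \<le> f x" by blast
    then show ?case
    proof cases
      case 1
      then show ?thesis by (simp add: argmax_def)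
    next
      case 2
      then have "argmax f (xs @ [y]) = (if f x < f y then [y] else [x])" by (simp add: argmax_snoc)
      with 2 show ?thesis by (cases "f x < f y") fastforce+
    qed
  qed (simp add: argmax_def)
  then show thesis using that by blast
qed

lemma ptime_argmax [ptime_intros]:
  assumes f: "ptime (\<lambda>z. f (fst z) (snd z))" and g: "ptime g"
  shows "ptime (\<lambda>x. argmax (f x) (g x))"
  unfolding argmax_def
proof (rule ptime_foldl[where G = "\<lambda>z. sz (snd z) + 1"])
  show "ptime (\<lambda>z. case fst (snd z) of [] \<Rightarrow> [snd (snd z)]
     | y # zs \<Rightarrow> if f (fst z) y < f (fst z) (snd (snd z)) then [snd (snd z)] else [y])"
    by (intro ptime_intros ptime_comp2[OF f])
  show "sz (case a of [] \<Rightarrow> [y] | z # zs \<Rightarrow> if f c z < f c y then [y] else [z]) \<le> sz a + (sz (snd (c, y)) + 1)"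
    for a c y
    by (auto split: list.splits simp: sz_pos add.commute[of _ "sz y"] intro: le_SucI trans_le_add2)
qed (intro ptime_intros pbound_intros g)+

section \<open>Integer kernel vectors and conformal order\<close>

text \<open>
  A vector of length \<open>n\<close> is a function that vanishes from \<open>n\<close> on, and the rows in question form a set
  of indices; both make it easy to change the system by a single row.
\<close>

definition kern :: "(nat \<Rightarrow> nat \<Rightarrow> int) \<Rightarrow> nat set \<Rightarrow> nat \<Rightarrow> (nat \<Rightarrow> int) \<Rightarrow> bool" where
  "kern A R n x \<longleftrightarrow> (\<forall>j\<ge>n. x j = 0) \<and> (\<forall>i\<in>R. (\<Sum>j<n. A i j * x j) = 0)"

text \<open>
  This is the conformal order, with the product of signs replaced by linear inequalities so that
  arithmetic decision procedures apply (\<open>cfm_iff\<close>).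
\<close>

definition cfm :: "(nat \<Rightarrow> int) \<Rightarrow> (nat \<Rightarrow> int) \<Rightarrow> bool" where
  "cfm f g \<longleftrightarrow> (\<forall>j. 0 \<le> f j \<and> f j \<le> g j \<or> g j \<le> f j \<and> f j \<le> 0)"

definition minimal_kern :: "(nat \<Rightarrow> nat \<Rightarrow> int) \<Rightarrow> nat set \<Rightarrow> nat \<Rightarrow> (nat \<Rightarrow> int) \<Rightarrow> bool" where
  "minimal_kern A R n g \<longleftrightarrow> kern A R n g \<and> g \<noteq> (\<lambda>j. 0) \<and>
     (\<forall>f. kern A R n f \<and> f \<noteq> (\<lambda>j. 0) \<and> cfm f g \<longrightarrow> f = g)"

definition l1 :: "nat \<Rightarrow> (nat \<Rightarrow> int) \<Rightarrow> int" where
  "l1 n x = (\<Sum>j<n. \<bar>x j\<bar>)"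

lemma cfm_iff: "cfm f g \<longleftrightarrow> (\<forall>j. 0 \<le> f j * g j \<and> \<bar>f j\<bar> \<le> \<bar>g j\<bar>)"
proof -
  have "(0 \<le> a \<and> a \<le> b \<or> b \<le> a \<and> a \<le> 0) = (0 \<le> a * b \<and> \<bar>a\<bar> \<le> \<bar>b\<bar>)" for a b :: int
    by (auto simp: zero_le_mult_iff abs_if split: if_splits)
  then show ?thesis unfolding cfm_def by blast
qed

lemma kern_add: "kern A R n x \<Longrightarrow> kern A R n y \<Longrightarrow> kern A R n (\<lambda>j. x j + y j)"
  by (auto simp: kern_def algebra_simps sum.distrib)

lemma kern_diff: "kern A R n x \<Longrightarrow> kern A R n y \<Longrightarrow> kern A R n (\<lambda>j. x j - y j)"
  by (auto simp: kern_def algebra_simps sum_subtractf)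

lemma kern_scale: "kern A R n x \<Longrightarrow> kern A R n (\<lambda>j. c * x j)"
proof -
  have "(\<Sum>j<n. A i j * (c * x j)) = c * (\<Sum>j<n. A i j * x j)" for i
    by (simp add: sum_distrib_left algebra_simps)
  then show "kern A R n x \<Longrightarrow> kern A R n (\<lambda>j. c * x j)" by (auto simp: kern_def)
qed

lemma kern_zero: "kern A R n (\<lambda>j. 0)"
  by (simp add: kern_def)

lemma kern_sum_list: "(\<And>x. x \<in> set xs \<Longrightarrow> kern A R n (f x)) \<Longrightarrow> kern A R n (\<lambda>j. \<Sum>x\<leftarrow>xs. f x j)"
  by (induction xs) (auto intro: kern_zero kern_add)

lemma cfm_refl: "cfm g g"
  by (auto simp: cfm_def)

lemma cfm_trans:
  assumes "cfm f g" "cfm g h" shows "cfm f h"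
  unfolding cfm_def
proof
  fix j
  show "0 \<le> f j \<and> f j \<le> h j \<or> h j \<le> f j \<and> f j \<le> 0"
    using assms[unfolded cfm_def, THEN spec, of j] by linarith
qed

lemma cfm_diff:
  assumes "cfm f g" shows "cfm (\<lambda>j. g j - f j) g"
  unfolding cfm_def
proof
  fix j
  show "0 \<le> g j - f j \<and> g j - f j \<le> g j \<or> g j \<le> g j - f j \<and> g j - f j \<le> 0"
    using assms[unfolded cfm_def, THEN spec, of j] by linarith
qed

lemma cfm_abs: "cfm f g \<Longrightarrow> \<bar>f j\<bar> \<le> \<bar>g j\<bar>"
  unfolding cfm_def by (drule spec[of _ j]) linarith

lemma cfm_abs_diff: "cfm f g \<Longrightarrow> \<bar>g j\<bar> = \<bar>f j\<bar> + \<bar>g j - f j\<bar>"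
  unfolding cfm_def by (drule spec[of _ j]) linarith

lemma l1_diff: "cfm f g \<Longrightarrow> l1 n g = l1 n f + l1 n (\<lambda>j. g j - f j)"
  unfolding l1_def sum.distrib[symmetric] by (intro sum.cong) (auto dest: cfm_abs_diff)

lemma l1_mono: "cfm f g \<Longrightarrow> l1 n f \<le> l1 n g"
  unfolding l1_def by (intro sum_mono cfm_abs)

lemma l1_nonneg: "0 \<le> l1 n x"
  by (simp add: l1_def sum_nonneg)

lemma l1_pos: "kern A R n x \<Longrightarrow> x \<noteq> (\<lambda>j. 0) \<Longrightarrow> 1 \<le> l1 n x"
proof -
  assume "kern A R n x" "x \<noteq> (\<lambda>j. 0)"
  then obtain j where "x j \<noteq> 0" by auto
  with \<open>kern A R n x\<close> have j: "j < n" "x j \<noteq> 0" unfolding kern_def by (auto simp: not_le[symmetric])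
  then have "1 \<le> \<bar>x j\<bar>" by simp
  also have "\<dots> \<le> l1 n x" unfolding l1_def by (rule member_le_sum) (use j in auto)
  finally show ?thesis .
qed

text \<open>
  A kernel vector that is not minimal splits into two conformal summands, which have smaller norms
  that add up to its norm. As minimal vectors have norm at least \<open>1\<close>, the norm bounds the number of
  summands.
\<close>

lemma minimal_decomposition:
  assumes "kern A R n z"
  shows "\<exists>gs. (\<forall>g\<in>set gs. minimal_kern A R n g \<and> cfm g z) \<and> (\<forall>j. z j = (\<Sum>g\<leftarrow>gs. g j)) \<and>
    int (length gs) \<le> l1 n z"
  using assms
proof (induction "nat (l1 n z)" arbitrary: z rule: less_induct)
  case less
  consider "z = (\<lambda>j. 0)" | "minimal_kern A R n z"
    | f where "kern A R n f" "f \<noteq> (\<lambda>j. 0)" "cfm f z" "f \<noteq> z" "z \<noteq> (\<lambda>j. 0)"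
    using less.prems unfolding minimal_kern_def by blast
  then show ?case
  proof cases
    case 1
    then show ?thesis by (intro exI[of _ "[]"]) (simp add: l1_def)
  next
    case 2
    then have "1 \<le> l1 n z" using l1_pos unfolding minimal_kern_def by blast
    with 2 show ?thesis by (intro exI[of _ "[z]"]) (simp add: cfm_refl)
  next
    case 3
    let ?g = "\<lambda>j. z j - f j"
    have g: "kern A R n ?g" "?g \<noteq> (\<lambda>j. 0)" "cfm ?g z"
    proof -
      show "kern A R n ?g" "cfm ?g z" using 3 less.prems by (auto intro: kern_diff cfm_diff)
      from 3(4) obtain j where "f j \<noteq> z j" by auto
      then have "?g j \<noteq> 0" by simp
      then show "?g \<noteq> (\<lambda>j. 0)" by (rule contrapos_nn) (rule fun_cong)
    qed
    have l: "l1 n z = l1 n f + l1 n ?g" using 3 by (intro l1_diff)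
    have "1 \<le> l1 n f" "1 \<le> l1 n ?g" using l1_pos 3 g by blast+
    with l have "nat (l1 n f) < nat (l1 n z)" "nat (l1 n ?g) < nat (l1 n z)" by linarith+
    from less.hyps[OF this(1) 3(1)] less.hyps[OF this(2) g(1)] obtain gs hs where
      gs: "\<forall>h\<in>set gs. minimal_kern A R n h \<and> cfm h f" "\<forall>j. f j = (\<Sum>g\<leftarrow>gs. g j)" "int (length gs) \<le> l1 n f" and
      hs: "\<forall>h\<in>set hs. minimal_kern A R n h \<and> cfm h ?g" "\<forall>j. ?g j = (\<Sum>g\<leftarrow>hs. g j)" "int (length hs) \<le> l1 n ?g"
      by blast
    show ?thesis
    proof (intro exI[of _ "gs @ hs"] conjI ballI allI)
      fix h assume "h \<in> set (gs @ hs)"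
      then show "minimal_kern A R n h" "cfm h z" using gs(1) hs(1) 3(3) g(3) by (auto intro: cfm_trans)
    next
      fix j
      show "z j = (\<Sum>g\<leftarrow>gs @ hs. g j)" using gs(2)[rule_format, of j] hs(2)[rule_format, of j] by simp
    next
      show "int (length (gs @ hs)) \<le> l1 n z" using gs(3) hs(3) l by simp
    qed
  qed
qed

section \<open>Small kernel vectors from bounded minors\<close>

text \<open>
  Rows and columns are selected by injections in any order, which only affects the sign of the
  determinant but allows a row or column to be appended at the end.
\<close>

definition minors_le :: "(nat \<Rightarrow> nat \<Rightarrow> int) \<Rightarrow> nat \<Rightarrow> nat \<Rightarrow> int \<Rightarrow> bool" where
  "minors_le A m n a \<longleftrightarrow> (\<forall>k \<rho> \<sigma>. 0 < k \<and> inj_on \<rho> {..<k} \<and> inj_on \<sigma> {..<k} \<and>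
     \<rho> ` {..<k} \<subseteq> {..<m} \<and> \<sigma> ` {..<k} \<subseteq> {..<n} \<longrightarrow>
     \<bar>det (mat k k (\<lambda>(p, q). A (\<rho> p) (\<sigma> q)))\<bar> \<le> a)"

lemma inj_on_extend: "inj_on f {..<k} \<Longrightarrow> x \<notin> f ` {..<k} \<Longrightarrow> inj_on (f(k := x)) {..<Suc k}"
  by (auto simp: lessThan_Suc intro: inj_on_fun_updI)

text \<open>
  This is Cramer's rule. Take a maximal nonsingular minor with columns in the support of \<open>z\<close>. The
  support contains a further column, for otherwise \<open>z\<close> would be in the kernel of a nonsingular matrix.
  Border the minor by this column and by a row \<open>i\<close>: the determinant vanishes, by maximality or because
  \<open>i\<close> occurs twice. Its expansion along row \<open>i\<close> says that the vector of cofactors, which does not depend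
  on \<open>i\<close>, is orthogonal to row \<open>i\<close>. Its entries are minors, and the one for the new column is the minor
  taken first.
\<close>

lemma small_kernel_vector:
  assumes minors: "minors_le A m n a" and a: "1 \<le> a"
    and z: "kern A {..<m} n z" and nz: "z \<noteq> (\<lambda>j. 0)"
  obtains y where "kern A {..<m} n y" "y \<noteq> (\<lambda>j. 0)" "\<And>j. y j \<noteq> 0 \<Longrightarrow> z j \<noteq> 0" "\<And>j. \<bar>y j\<bar> \<le> a"
proof -
  define S where "S = {j. z j \<noteq> 0}"
  have S: "S \<subseteq> {..<n}" using z unfolding S_def kern_def by (auto simp: not_le[symmetric])
  then have fS: "finite S" by (rule finite_subset) simp
  have S0: "S \<noteq> {}" using nz by (auto simp: S_def)
  define N where "N k \<rho> \<sigma> \<longleftrightarrow> inj_on \<rho> {..<k} \<and> inj_on \<sigma> {..<k} \<and> \<rho> ` {..<k} \<subseteq> {..<m} \<and>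
    \<sigma> ` {..<k} \<subseteq> S \<and> det (mat k k (\<lambda>(p, q). A (\<rho> p) (\<sigma> q))) \<noteq> 0" for k \<rho> \<sigma>
  have "\<exists>\<rho> \<sigma>. N 0 \<rho> \<sigma>" by (simp add: N_def)
  moreover have "k \<le> card S" if ex: "\<exists>\<rho> \<sigma>. N k \<rho> \<sigma>" for k
  proof -
    from ex obtain \<sigma> where "inj_on \<sigma> {..<k}" "\<sigma> ` {..<k} \<subseteq> S" unfolding N_def by blast
    from card_inj_on_le[OF this fS] show ?thesis by simp
  qed
  ultimately obtain k where k: "\<exists>\<rho> \<sigma>. N k \<rho> \<sigma>" and kmax: "\<And>k'. \<exists>\<rho> \<sigma>. N k' \<rho> \<sigma> \<Longrightarrow> k' \<le> k"
    using GreatestI_nat[of "\<lambda>k. \<exists>\<rho> \<sigma>. N k \<rho> \<sigma>" 0 "card S"]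
      Greatest_le_nat[of "\<lambda>k. \<exists>\<rho> \<sigma>. N k \<rho> \<sigma>" _ "card S"] by blast
  from k obtain \<rho> \<sigma> where N: "N k \<rho> \<sigma>" by blast
  then have inj: "inj_on \<rho> {..<k}" "inj_on \<sigma> {..<k}" and rng: "\<rho> ` {..<k} \<subseteq> {..<m}" "\<sigma> ` {..<k} \<subseteq> S"
    and dnz: "det (mat k k (\<lambda>(p, q). A (\<rho> p) (\<sigma> q))) \<noteq> 0" by (auto simp: N_def)
  \<comment> \<open>Otherwise the support of \<open>z\<close> would consist of independent columns.\<close>
  have "\<sigma> ` {..<k} \<noteq> S"
  proof
    assume eq: "\<sigma> ` {..<k} = S"
    let ?M = "mat k k (\<lambda>(p, q). A (\<rho> p) (\<sigma> q))" and ?v = "vec k (\<lambda>q. z (\<sigma> q))"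
    have "?M *\<^sub>v ?v = 0\<^sub>v k"
    proof (rule eq_vecI)
      fix p assume "p < dim_vec (0\<^sub>v k :: int vec)"
      then have p: "p < k" by simp
      have "(?M *\<^sub>v ?v) $ p = (\<Sum>q<k. A (\<rho> p) (\<sigma> q) * z (\<sigma> q))"
        using p by (simp add: scalar_prod_def atLeast0LessThan)
      also have "\<dots> = (\<Sum>j\<in>S. A (\<rho> p) j * z j)"
        unfolding eq[symmetric] by (simp add: sum.reindex[OF inj(2)])
      also have "\<dots> = (\<Sum>j<n. A (\<rho> p) j * z j)"
        by (rule sum.mono_neutral_left) (use S in \<open>auto simp: S_def\<close>)
      also have "\<dots> = 0" using z rng(1) p unfolding kern_def by blast
      finally show "(?M *\<^sub>v ?v) $ p = 0\<^sub>v k $ p" using p by simp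
    qed simp
    moreover have "?v \<noteq> 0\<^sub>v k"
    proof -
      from S0 eq obtain q where "q < k" by auto
      then have "?v $ q \<noteq> 0" using rng(2) by (auto simp: S_def)
      with \<open>q < k\<close> show ?thesis by (auto dest: arg_cong[of _ _ "\<lambda>v. v $ q"])
    qed
    ultimately have "\<exists>v. v \<in> carrier_vec k \<and> v \<noteq> 0\<^sub>v k \<and> ?M *\<^sub>v v = 0\<^sub>v k"
      by (intro exI[of _ ?v]) simp
    then have "det ?M = 0" by (subst det_0_iff_vec_prod_zero[of _ k]) simp_all
    with dnz show False by simp
  qed
  with rng(2) obtain j where j: "j \<in> S" "j \<notin> \<sigma> ` {..<k}" by blast
  define \<tau> where "\<tau> = \<sigma>(k := j)"
  have inj\<tau>: "inj_on \<tau> {..<Suc k}" unfolding \<tau>_def by (rule inj_on_extend[OF inj(2) j(2)])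
  have rng\<tau>: "\<tau> ` {..<Suc k} \<subseteq> S" using rng(2) j(1) by (auto simp: \<tau>_def lessThan_Suc)
  define c where "c q = (- 1) ^ (k + q) * det (mat k k (\<lambda>(p, q'). A (\<rho> p) (\<tau> (insert_index q q'))))" for q
  \<comment> \<open>Laplace expansion along the bordering row \<open>i\<close>.\<close>
  have lap: "(\<Sum>q<Suc k. A i (\<tau> q) * c q) = 0" if i: "i < m" for i
  proof -
    let ?M = "mat (Suc k) (Suc k) (\<lambda>(p, q). A ((\<rho>(k := i)) p) (\<tau> q))"
    have "det ?M = 0"
    proof (cases "i \<in> \<rho> ` {..<k}")
      case True
      then obtain p where p: "p < k" "\<rho> p = i" by auto
      show ?thesis
        by (rule det_identical_rows[where i = p and j = k and n = "Suc k"]) (use p in auto)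
    next
      case False
      have "inj_on (\<rho>(k := i)) {..<Suc k}" by (rule inj_on_extend[OF inj(1) False])
      moreover have "(\<rho>(k := i)) ` {..<Suc k} \<subseteq> {..<m}" using rng(1) i by (auto simp: lessThan_Suc)
      ultimately have "det ?M \<noteq> 0 \<Longrightarrow> N (Suc k) (\<rho>(k := i)) \<tau>"
        unfolding N_def using inj\<tau> rng\<tau> by blast
      then have "det ?M \<noteq> 0 \<Longrightarrow> Suc k \<le> k" using kmax by blast
      then show ?thesis by (metis Suc_n_not_le_n)
    qed
    then have 0: "(\<Sum>q<Suc k. ?M $$ (k, q) * cofactor ?M k q) = 0"
      by (subst laplace_expansion_row[symmetric]) auto
    have *: "?M $$ (k, q) * cofactor ?M k q = A i (\<tau> q) * c q" if "q < Suc k" for q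
    proof -
      have "mat_delete ?M k q = mat k k (\<lambda>(p, q'). A (\<rho> p) (\<tau> (insert_index q q')))"
        by (rule eq_matI) (use that in \<open>auto simp: mat_delete_def insert_index_def\<close>)
      with that show ?thesis by (simp add: cofactor_def c_def)
    qed
    have "(\<Sum>q<Suc k. ?M $$ (k, q) * cofactor ?M k q) = (\<Sum>q<Suc k. A i (\<tau> q) * c q)"
      by (rule sum.cong[OF refl], rule *) simp
    with 0 show ?thesis by (simp only:)
  qed
  \<comment> \<open>For \<open>k = 0\<close> the cofactor is the empty determinant \<open>1\<close>, which is not among the minors; hence
    \<open>1 \<le> a\<close>.\<close>
  have cle: "\<bar>c q\<bar> \<le> a" if q: "q < Suc k" for q
  proof (cases "k = 0")
    case True
    then show ?thesis using a by (simp add: c_def abs_mult power_abs)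
  next
    case False
    have ins: "insert_index q q' < Suc k" if "q' < k" for q' using that by (simp add: insert_index_def)
    have "inj_on (\<lambda>q'. \<tau> (insert_index q q')) {..<k}"
    proof (rule inj_onI)
      fix q1 q2 assume q: "q1 \<in> {..<k}" "q2 \<in> {..<k}" "\<tau> (insert_index q q1) = \<tau> (insert_index q q2)"
      then have "insert_index q q1 = insert_index q q2"
        using ins by (intro inj_onD[OF inj\<tau> q(3)]) simp_all
      then show "q1 = q2" by (simp add: insert_index_def split: if_splits)
    qed
    moreover have "(\<lambda>q'. \<tau> (insert_index q q')) ` {..<k} \<subseteq> {..<n}"
    proof (rule image_subsetI)
      fix q' assume "q' \<in> {..<k}"
      then have "insert_index q q' \<in> {..<Suc k}" using ins by simp
      then show "\<tau> (insert_index q q') \<in> {..<n}" using rng\<tau> S by blast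
    qed
    ultimately have "\<bar>det (mat k k (\<lambda>(p, q'). A (\<rho> p) (\<tau> (insert_index q q'))))\<bar> \<le> a"
      using minors[unfolded minors_le_def, rule_format, of k \<rho> "\<lambda>q'. \<tau> (insert_index q q')"]
        inj(1) rng(1) False by simp
    then show ?thesis unfolding c_def by (simp add: abs_mult power_abs)
  qed
  define y where "y x = (if x \<in> \<tau> ` {..<Suc k} then c (inv_into {..<Suc k} \<tau> x) else 0)" for x
  have y\<tau>: "y (\<tau> q) = c q" if "q < Suc k" for q
    using that by (simp add: y_def inv_into_f_f[OF inj\<tau>])
  have y0: "y x = 0" if "x \<notin> \<tau> ` {..<Suc k}" for x using that by (simp add: y_def)
  show thesis
  proof (rule that)
    show "kern A {..<m} n y" unfolding kern_def
    proof (intro conjI allI impI ballI)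
      fix x assume "n \<le> x"
      then show "y x = 0" using rng\<tau> S by (intro y0) force
    next
      fix i assume "i \<in> {..<m}"
      have "(\<Sum>x<n. A i x * y x) = (\<Sum>x\<in>\<tau> ` {..<Suc k}. A i x * y x)"
        by (rule sum.mono_neutral_right) (use rng\<tau> S y0 in auto)
      also have "\<dots> = (\<Sum>q<Suc k. A i (\<tau> q) * c q)"
        unfolding sum.reindex[OF inj\<tau>] by (intro sum.cong) (auto simp: y\<tau>)
      finally show "(\<Sum>x<n. A i x * y x) = 0" using lap \<open>i \<in> {..<m}\<close> by simp
    qed
    have "mat k k (\<lambda>(p, q'). A (\<rho> p) (\<tau> (insert_index k q'))) = mat k k (\<lambda>(p, q). A (\<rho> p) (\<sigma> q))"
      by (rule eq_matI) (auto simp: insert_index_def \<tau>_def)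
    then have "y j \<noteq> 0" using y\<tau>[of k] dnz by (simp add: c_def \<tau>_def)
    then show "y \<noteq> (\<lambda>j. 0)" by auto
    show "z x \<noteq> 0" if "y x \<noteq> 0" for x using that y0[of x] rng\<tau> by (auto simp: S_def)
    show "\<bar>y x\<bar> \<le> a" for x
      using cle y\<tau> y0[of x] a by (cases "x \<in> \<tau> ` {..<Suc k}") auto
  qed
qed

section \<open>Kernel vectors as conformal sums of few bounded ones\<close>

lemma finite_has_minimizer:
  fixes f :: "'b \<Rightarrow> 'c :: linorder"
  assumes "finite Q" "Q \<noteq> {}"
  shows "\<exists>i\<in>Q. \<forall>j\<in>Q. f i \<le> f j"
proof -
  have "Min (f ` Q) \<in> f ` Q" using assms by (intro Min_in) auto
  then obtain i where "i \<in> Q" "f i = Min (f ` Q)" by force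
  with assms show ?thesis by (intro bexI[of _ i]) auto
qed

text \<open>
  Subtracting from \<open>z\<close> the multiple of \<open>y\<close> given by the smallest ratio \<open>z j / y j\<close>, over the coordinates
  where the signs agree, cancels the coordinate attaining it and changes no sign elsewhere. The
  difference is scaled to be integral.
\<close>

lemma cancel_coordinate:
  assumes z: "kern A R n z" and y: "kern A R n y"
    and supp: "\<And>j. y j \<noteq> 0 \<Longrightarrow> z j \<noteq> 0" and same: "0 < y p * z p"
  obtains i z' where "0 < y i * z i" "\<And>j. z' j = \<bar>y i\<bar> * z j - \<bar>z i\<bar> * y j" "kern A R n z'"
    "\<And>j. z' j \<noteq> 0 \<Longrightarrow> 0 < z' j * z j" "card {j. z' j \<noteq> 0} < card {j. z j \<noteq> 0}"
proof -
  have fin: "finite {j. z j \<noteq> 0}"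
    by (rule finite_subset[of _ "{..<n}"]) (use z in \<open>auto simp: kern_def not_le[symmetric]\<close>)
  define Q where "Q = {j. 0 < y j * z j}"
  have Q: "finite Q" "Q \<noteq> {}"
    using same by (auto simp: Q_def intro: finite_subset[OF _ fin])
  obtain i where i: "i \<in> Q" "\<And>j. j \<in> Q \<Longrightarrow> of_int \<bar>z i\<bar> / of_int \<bar>y i\<bar> \<le> (of_int \<bar>z j\<bar> / of_int \<bar>y j\<bar> :: rat)"
    using finite_has_minimizer[OF Q, of "\<lambda>j. of_int \<bar>z j\<bar> / of_int \<bar>y j\<bar> :: rat"] by blast
  have yi: "y i \<noteq> 0" and pos: "0 < y i * z i" using i(1) by (auto simp: Q_def)
  have min: "\<bar>z i\<bar> * \<bar>y j\<bar> \<le> \<bar>z j\<bar> * \<bar>y i\<bar>" if "j \<in> Q" for j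
  proof -
    have "y j \<noteq> 0" using that by (auto simp: Q_def)
    then have "of_int (\<bar>z i\<bar> * \<bar>y j\<bar>) \<le> (of_int (\<bar>z j\<bar> * \<bar>y i\<bar>) :: rat)"
      using i(2)[OF that] yi by (simp add: field_simps)
    then show ?thesis by (simp only: of_int_le_iff)
  qed
  define z' where "z' j = \<bar>y i\<bar> * z j - \<bar>z i\<bar> * y j" for j
  have k': "kern A R n z'" unfolding z'_def
    by (intro kern_diff kern_scale z y)
  have sgn: "0 < z' j * z j" if "z' j \<noteq> 0" for j
  proof -
    have zj: "z j \<noteq> 0" using that supp[of j] by (auto simp: z'_def)
    show ?thesis
    proof (cases "j \<in> Q")
      case True
      then have s: "0 < y j * z j" by (simp add: Q_def)
      have "z' j * z j = \<bar>y i\<bar> * (z j * z j) - \<bar>z i\<bar> * (y j * z j)" by (simp add: z'_def algebra_simps)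
      also have "z j * z j = \<bar>z j\<bar> * \<bar>z j\<bar>" by simp
      also have "y j * z j = \<bar>y j\<bar> * \<bar>z j\<bar>" using s by (simp add: abs_mult[symmetric])
      finally have e: "z' j * z j = (\<bar>z j\<bar> * \<bar>y i\<bar> - \<bar>z i\<bar> * \<bar>y j\<bar>) * \<bar>z j\<bar>" by (simp add: algebra_simps)
      have "0 \<le> z' j * z j" unfolding e using min[OF True] by simp
      moreover have "z' j * z j \<noteq> 0" using that zj by simp
      ultimately show ?thesis by linarith
    next
      case False
      then have "y j * z j \<le> 0" by (simp add: Q_def)
      then have "0 \<le> - (\<bar>z i\<bar> * (y j * z j))" by (simp add: mult_nonneg_nonpos)
      moreover have "0 < \<bar>y i\<bar> * (z j * z j)" using yi zj by (simp add: power2_eq_square[symmetric])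
      ultimately show ?thesis by (simp add: z'_def algebra_simps)
    qed
  qed
  have "z' i = 0" using pos by (auto simp: z'_def abs_if zero_less_mult_iff)
  moreover have "z i \<noteq> 0" using pos by auto
  moreover have "z' j \<noteq> 0 \<Longrightarrow> z j \<noteq> 0" for j using sgn[of j] by auto
  ultimately have "{j. z' j \<noteq> 0} \<subset> {j. z j \<noteq> 0}" by blast
  then have "card {j. z' j \<noteq> 0} < card {j. z j \<noteq> 0}" by (rule psubset_card_mono[OF fin])
  with pos k' sgn show thesis by (intro that[of i z']) (auto simp: z'_def)
qed

text \<open>
  A small vector \<open>y\<close> within the support of \<open>z\<close> is conformal in sign to \<open>z\<close> or to \<open>- z\<close>, or it has
  coordinates of both kinds. In the last case \<open>z\<close> is replaced by a vector with smaller support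
  and the same signs.
\<close>

lemma small_conformal_kernel_vector:
  assumes minors: "minors_le A m n a" and a: "1 \<le> a"
    and "kern A {..<m} n z" and "z \<noteq> (\<lambda>j. 0)"
  shows "\<exists>c. kern A {..<m} n c \<and> c \<noteq> (\<lambda>j. 0) \<and> (\<forall>j. c j \<noteq> 0 \<longrightarrow> 0 < c j * z j) \<and> (\<forall>j. \<bar>c j\<bar> \<le> a)"
  using assms(3,4)
proof (induction "card {j. z j \<noteq> 0}" arbitrary: z rule: less_induct)
  case less
  obtain y where y: "kern A {..<m} n y" "y \<noteq> (\<lambda>j. 0)" "\<And>j. y j \<noteq> 0 \<Longrightarrow> z j \<noteq> 0" "\<And>j. \<bar>y j\<bar> \<le> a"
    using small_kernel_vector[OF minors a less.prems] by blast
  consider "\<forall>j. y j \<noteq> 0 \<longrightarrow> 0 < y j * z j" | "\<forall>j. y j \<noteq> 0 \<longrightarrow> y j * z j < 0"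
    | p q where "0 < y p * z p" "y q * z q < 0"
    using y(3) by (metis linorder_neqE_linordered_idom mult_eq_0_iff)
  then show ?case
  proof cases
    case 1
    with y show ?thesis by blast
  next
    case 2
    let ?y = "\<lambda>j. - 1 * y j"
    have "kern A {..<m} n ?y" by (rule kern_scale[OF y(1)])
    moreover from y(2) obtain j where "y j \<noteq> 0" by auto
    then have "?y j \<noteq> 0" by simp
    then have "?y \<noteq> (\<lambda>j. 0)" by (rule contrapos_nn) (rule fun_cong)
    ultimately show ?thesis using 2 y(4) by (intro exI[of _ ?y]) simp
  next
    case 3
    obtain i z' where z': "0 < y i * z i" "\<And>j. z' j = \<bar>y i\<bar> * z j - \<bar>z i\<bar> * y j" "kern A {..<m} n z'"
      "\<And>j. z' j \<noteq> 0 \<Longrightarrow> 0 < z' j * z j" "card {j. z' j \<noteq> 0} < card {j. z j \<noteq> 0}"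
      using cancel_coordinate[OF less.prems(1) y(1,3) 3(1)] by blast
    \<comment> \<open>The entry of \<open>z\<close> at \<open>q\<close> grows in absolute value, so \<open>z'\<close> does not vanish.\<close>
    have "0 \<le> - (\<bar>z i\<bar> * (y q * z q))" using 3(2) by (simp add: mult_nonneg_nonpos)
    moreover have "y i \<noteq> 0" "z q \<noteq> 0" using z'(1) 3(2) by auto
    then have "0 < \<bar>y i\<bar> * (z q * z q)" by (simp add: power2_eq_square[symmetric])
    ultimately have "0 < z' q * z q" by (simp add: z'(2) algebra_simps)
    then have nz': "z' \<noteq> (\<lambda>j. 0)" by auto
    from less.hyps[OF z'(5,3) nz'] obtain c where
      c: "kern A {..<m} n c" "c \<noteq> (\<lambda>j. 0)" "\<forall>j. c j \<noteq> 0 \<longrightarrow> 0 < c j * z' j" "\<forall>j. \<bar>c j\<bar> \<le> a" by blast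
    have "0 < c j * z j" if "c j \<noteq> 0" for j
    proof -
      from c(3) that have 1: "0 < c j * z' j" by blast
      then have "0 < z' j * z j" by (intro z'(4)) auto
      with 1 show ?thesis by (auto simp: zero_less_mult_iff)
    qed
    with c show ?thesis by blast
  qed
qed

text \<open>
  Each small vector is used with the largest coefficient that keeps the signs of \<open>z\<close>, which shrinks
  the support, so that at most \<open>n\<close> vectors are needed. The coefficients are rational with common
  denominator \<open>D\<close>.
\<close>

lemma conic_decomposition:
  assumes minors: "minors_le A m n a" and a: "1 \<le> a" and "kern A {..<m} n z"
  shows "\<exists>D ps. 0 < (D :: int) \<and> length ps \<le> card {j. z j \<noteq> 0} \<and>
    (\<forall>(p, c)\<in>set ps. 0 \<le> p \<and> kern A {..<m} n c \<and> (\<forall>j. c j \<noteq> 0 \<longrightarrow> 0 < c j * z j) \<and> (\<forall>j. \<bar>c j\<bar> \<le> a)) \<and>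
    (\<forall>j. D * z j = (\<Sum>(p, c)\<leftarrow>ps. p * c j))"
  using assms(3)
proof (induction "card {j. z j \<noteq> 0}" arbitrary: z rule: less_induct)
  case less
  show ?case
  proof (cases "z = (\<lambda>j. 0)")
    case True
    then show ?thesis by (intro exI[of _ 1] exI[of _ "[]"]) simp
  next
    case False
    obtain c where c: "kern A {..<m} n c" "c \<noteq> (\<lambda>j. 0)" "\<And>j. c j \<noteq> 0 \<Longrightarrow> 0 < c j * z j" "\<And>j. \<bar>c j\<bar> \<le> a"
      using small_conformal_kernel_vector[OF minors a less.prems False] by blast
    have supp: "z j \<noteq> 0" if "c j \<noteq> 0" for j using c(3)[OF that] by auto
    obtain p where p: "0 < c p * z p" using c(2,3) by auto
    obtain i z' where i: "0 < c i * z i" and z': "\<And>j. z' j = \<bar>c i\<bar> * z j - \<bar>z i\<bar> * c j" and k': "kern A {..<m} n z'"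
      and sgn: "\<And>j. z' j \<noteq> 0 \<Longrightarrow> 0 < z' j * z j" and lt: "card {j. z' j \<noteq> 0} < card {j. z j \<noteq> 0}"
      using cancel_coordinate[OF less.prems c(1) supp p] by blast
    from less.hyps[OF lt k'] obtain D ps where D: "0 < D" "length ps \<le> card {j. z' j \<noteq> 0}"
      and ps: "\<And>p c. (p, c) \<in> set ps \<Longrightarrow> 0 \<le> p \<and> kern A {..<m} n c \<and> (\<forall>j. c j \<noteq> 0 \<longrightarrow> 0 < c j * z' j) \<and> (\<forall>j. \<bar>c j\<bar> \<le> a)"
      and sum: "\<And>j. D * z' j = (\<Sum>(p, c)\<leftarrow>ps. p * c j)" by blast
    show ?thesis
    proof (intro exI conjI)
      have "c i \<noteq> 0" using i by auto
      then show "0 < D * \<bar>c i\<bar>" using D(1) by simp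
      show "length ((D * \<bar>z i\<bar>, c) # ps) \<le> card {j. z j \<noteq> 0}" using D(2) lt by simp
      have "0 < c' j * z j" if "(p, c') \<in> set ps" "c' j \<noteq> 0" for p c' j
      proof -
        from ps[OF that(1)] that(2) have 1: "0 < c' j * z' j" by blast
        then have "0 < z' j * z j" by (intro sgn) auto
        with 1 show ?thesis by (auto simp: zero_less_mult_iff)
      qed
      then show "\<forall>(p, c)\<in>set ((D * \<bar>z i\<bar>, c) # ps). 0 \<le> p \<and> kern A {..<m} n c \<and>
          (\<forall>j. c j \<noteq> 0 \<longrightarrow> 0 < c j * z j) \<and> (\<forall>j. \<bar>c j\<bar> \<le> a)"
        using ps c D(1) by auto
      show "\<forall>j. D * \<bar>c i\<bar> * z j = (\<Sum>(p, c)\<leftarrow>(D * \<bar>z i\<bar>, c) # ps. p * c j)"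
      proof
        fix j
        have "D * \<bar>c i\<bar> * z j = D * \<bar>z i\<bar> * c j + D * z' j" by (simp add: z' algebra_simps)
        then show "D * \<bar>c i\<bar> * z j = (\<Sum>(p, c)\<leftarrow>(D * \<bar>z i\<bar>, c) # ps. p * c j)" by (simp add: sum)
      qed
    qed
  qed
qed

lemma same_sign_summand:
  fixes t :: "'b \<Rightarrow> int"
  assumes "(\<Sum>x\<leftarrow>xs. t x) = z" "\<And>x. x \<in> set xs \<Longrightarrow> 0 \<le> t x" "x \<in> set xs"
  shows "t x \<le> z"
  using assms member_le_sum_list[of "t x" "map t xs"] by auto

lemma sum_list_same_sign:
  fixes t :: "'b \<Rightarrow> int"
  assumes "(\<Sum>x\<leftarrow>xs. t x) = z" "\<And>x. x \<in> set xs \<Longrightarrow> t x \<noteq> 0 \<Longrightarrow> 0 < t x * z" "x \<in> set xs"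
  shows "0 \<le> t x \<and> t x \<le> z \<or> z \<le> t x \<and> t x \<le> 0"
proof -
  consider "z = 0" | "0 < z" | "z < 0" by linarith
  then show ?thesis
  proof cases
    case 1
    with assms(2,3) show ?thesis by fastforce
  next
    case 2
    then have "0 \<le> t y" if "y \<in> set xs" for y
      using assms(2)[OF that] by (cases "t y = 0") (auto simp: zero_less_mult_iff)
    with same_sign_summand[OF assms(1) _ assms(3)] assms(3) show ?thesis by blast
  next
    case 3
    then have nonpos: "0 \<le> - t y" if "y \<in> set xs" for y
      using assms(2)[OF that] by (cases "t y = 0") (auto simp: zero_less_mult_iff)
    have "(\<Sum>x\<leftarrow>xs. - t x) = - z" unfolding assms(1)[symmetric] by (simp add: uminus_sum_list_map comp_def)
    from same_sign_summand[OF this nonpos assms(3)] nonpos[OF assms(3)] show ?thesis by simp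
  qed
qed

text \<open>
  Rounding down the coefficients of the conic combination leaves a remainder \<open>h\<close>, a sum of at most \<open>n\<close>
  small vectors with coefficients in \<open>[0, 1)\<close>. It is integral since everything else is, and it is
  conformal since all parts are; so it can serve as the last term, with coefficient \<open>1\<close>.
\<close>

lemma few_bounded_terms:
  assumes minors: "minors_le A m n a" and a: "1 \<le> a" and z: "kern A {..<m} n z" and n: "0 < n"
  shows "\<exists>ps. length ps \<le> Suc n \<and>
    (\<forall>(\<mu>, h)\<in>set ps. 0 \<le> \<mu> \<and> kern A {..<m} n h \<and> (\<forall>j. \<bar>h j\<bar> \<le> int n * a) \<and> cfm (\<lambda>j. \<mu> * h j) z) \<and>
    (\<forall>j. z j = (\<Sum>(\<mu>, h)\<leftarrow>ps. \<mu> * h j))"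
proof -
  obtain D ps where D: "0 < D" "length ps \<le> card {j. z j \<noteq> 0}"
    and ps: "\<And>p c. (p, c) \<in> set ps \<Longrightarrow> 0 \<le> p \<and> kern A {..<m} n c \<and> (\<forall>j. c j \<noteq> 0 \<longrightarrow> 0 < c j * z j) \<and> (\<forall>j. \<bar>c j\<bar> \<le> a)"
    and sum: "\<And>j. D * z j = (\<Sum>(p, c)\<leftarrow>ps. p * c j)"
    using conic_decomposition[OF minors a z] by blast
  have "{j. z j \<noteq> 0} \<subseteq> {..<n}" using z by (auto simp: kern_def not_le[symmetric])
  then have "card {j. z j \<noteq> 0} \<le> n" using card_mono[of "{..<n}"] by fastforce
  with D(2) have len: "length ps \<le> n" by simp
  define h where "h j = z j - (\<Sum>(p, c)\<leftarrow>ps. (p div D) * c j)" for j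
  define qs where "qs = (1, h) # map (\<lambda>(p, c). (p div D, c)) ps"
  \<comment> \<open>The remainder collects the fractional parts \<open>(p mod D) / D\<close> of the coefficients \<open>p / D\<close>.\<close>
  have Dh: "D * h j = (\<Sum>(p, c)\<leftarrow>ps. (p mod D) * c j)" for j
  proof -
    have "(\<Sum>(p, c)\<leftarrow>ps. p * c j) = D * (\<Sum>(p, c)\<leftarrow>ps. (p div D) * c j) + (\<Sum>(p, c)\<leftarrow>ps. (p mod D) * c j)"
    proof -
      have "(\<Sum>(p, c)\<leftarrow>ps. p * c j) = (\<Sum>(p, c)\<leftarrow>ps. D * ((p div D) * c j) + (p mod D) * c j)"
      proof -
        have "D * ((p div D) * x) + (p mod D) * x = (D * (p div D) + p mod D) * x" for p x
          by (simp only: distrib_right mult.assoc)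
        then have split: "p * x = D * ((p div D) * x) + (p mod D) * x" for p x
          by (simp only: mult_div_mod_eq)
        show ?thesis unfolding case_prod_unfold
          by (rule arg_cong[of _ _ sum_list], rule map_cong[OF refl], rule split)
      qed
      then show ?thesis by (simp add: sum_list_addf sum_list_const_mult case_prod_unfold)
    qed
    then show ?thesis using sum[of j] by (simp add: h_def right_diff_distrib)
  qed
  have hle: "\<bar>h j\<bar> \<le> int n * a" for j
  proof -
    have "\<bar>D * h j\<bar> \<le> (\<Sum>(p, c)\<leftarrow>ps. \<bar>(p mod D) * c j\<bar>)"
      unfolding Dh using sum_list_abs[of "map (\<lambda>(p, c). (p mod D) * c j) ps"] by (simp add: case_prod_unfold comp_def)
    also have "\<dots> \<le> (\<Sum>(p, c)\<leftarrow>ps. D * a)"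
    proof (rule sum_list_mono, clarsimp)
      fix p c assume "(p, c) \<in> set ps"
      then have "\<bar>c j\<bar> \<le> a" using ps by blast
      moreover have "\<bar>p mod D\<bar> \<le> D" using D(1) by (simp add: pos_mod_bound less_imp_le)
      ultimately show "\<bar>p mod D * c j\<bar> \<le> D * a" unfolding abs_mult by (intro mult_mono) (use D in auto)
    qed
    also have "\<dots> = D * (int (length ps) * a)" by (simp add: case_prod_unfold sum_list_triv)
    finally have "\<bar>h j\<bar> \<le> int (length ps) * a" using D(1) by (simp add: abs_mult)
    also have "\<dots> \<le> int n * a" using len a by (intro mult_right_mono) auto
    finally show ?thesis .
  qed
  have sumq: "z j = (\<Sum>(\<mu>, h)\<leftarrow>qs. \<mu> * h j)" for j
    by (simp add: qs_def h_def case_prod_unfold comp_def)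
  have kh: "kern A {..<m} n h" unfolding h_def
    unfolding case_prod_unfold
    by (intro kern_diff z kern_sum_list kern_scale) (use ps in \<open>auto simp: prod_eq_iff\<close>)
  have pos: "0 < t * z j" if t: "(t = h j \<or> (\<exists>p c. (p, c) \<in> set ps \<and> t = (p div D) * c j))" "t \<noteq> 0" for t j
  proof -
    have c: "0 \<le> r * c j * z j" if "(p, c) \<in> set ps" "0 \<le> r" for p c r
    proof (cases "c j = 0")
      case False
      then have "0 < c j * z j" using ps[OF that(1)] by blast
      then have "0 \<le> r * (c j * z j)" using that(2) by simp
      then show ?thesis by (simp add: mult.assoc)
    qed simp
    have zj: "z j \<noteq> 0"
    proof
      assume "z j = 0"
      then have c0: "c j = 0" if "(p, c) \<in> set ps" for p c using ps[OF that] by force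
      have "map (\<lambda>(p, c). (p div D) * c j) ps = map (\<lambda>_. 0) ps"
        by (rule map_cong[OF refl]) (use c0 in auto)
      then have "(\<Sum>(p, c)\<leftarrow>ps. (p div D) * c j) = 0" by (simp only: sum_list_0)
      then have "h j = 0" using \<open>z j = 0\<close> by (simp add: h_def)
      moreover have "(p div D) * c j = 0" if "(p, c) \<in> set ps" for p c using c0[OF that] by simp
      ultimately show False using t by blast
    qed
    from t(1) have "0 \<le> t * z j"
    proof
      assume t: "t = h j"
      have "0 \<le> (\<Sum>(p, c)\<leftarrow>ps. (p mod D) * c j * z j)"
        by (rule sum_list_nonneg) (use c D(1) in \<open>auto simp: pos_mod_sign\<close>)
      also have "\<dots> = D * h j * z j" unfolding Dh by (simp add: sum_list_mult_const case_prod_unfold)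
      finally show ?thesis using D(1) t by (simp add: mult.assoc zero_le_mult_iff)
    next
      assume "\<exists>p c. (p, c) \<in> set ps \<and> t = (p div D) * c j"
      then obtain p c' where "(p, c') \<in> set ps" "t = (p div D) * c' j" by blast
      moreover have "0 \<le> p div D" using ps[OF calculation(1)] D(1) by (simp add: pos_imp_zdiv_nonneg_iff)
      ultimately show ?thesis using c by simp
    qed
    with t(2) zj show ?thesis by (simp add: less_le)
  qed
  have q: "0 \<le> \<mu> \<and> kern A {..<m} n g \<and> (\<forall>j. \<bar>g j\<bar> \<le> int n * a) \<and> cfm (\<lambda>j. \<mu> * g j) z"
    if \<mu>g: "(\<mu>, g) \<in> set qs" for \<mu> g
  proof (intro conjI)
    from \<mu>g consider "\<mu> = 1" "g = h" | p where "(p, g) \<in> set ps" "\<mu> = p div D" by (auto simp: qs_def)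
    then have "0 \<le> \<mu> \<and> kern A {..<m} n g \<and> (\<forall>j. \<bar>g j\<bar> \<le> int n * a)"
    proof cases
      case 1
      then show ?thesis using kh hle by simp
    next
      case 2
      have "a \<le> int n * a" using n a by simp
      then show ?thesis using ps[OF 2(1)] 2(2) D(1)
        by (auto simp: pos_imp_zdiv_nonneg_iff intro: order_trans)
    qed
    then show "0 \<le> \<mu>" "kern A {..<m} n g" "\<forall>j. \<bar>g j\<bar> \<le> int n * a" by auto
    show "cfm (\<lambda>j. \<mu> * g j) z" unfolding cfm_def
    proof
      fix j
      show "0 \<le> \<mu> * g j \<and> \<mu> * g j \<le> z j \<or> z j \<le> \<mu> * g j \<and> \<mu> * g j \<le> 0"
      proof (rule sum_list_same_sign[of "\<lambda>(\<mu>, g). \<mu> * g j" qs "z j" "(\<mu>, g)", simplified])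
        show "(\<Sum>(\<mu>, g)\<leftarrow>qs. \<mu> * g j) = z j" by (rule sumq[symmetric])
        show "(\<mu>, g) \<in> set qs" by (rule \<mu>g)
        fix x assume x: "x \<in> set qs" "(case x of (\<mu>, g) \<Rightarrow> \<mu> * g j) \<noteq> 0"
        obtain \<nu> f where "x = (\<nu>, f)" by (cases x)
        with x show "0 < (case x of (\<mu>, g) \<Rightarrow> \<mu> * g j) * z j"
          using pos[of "\<nu> * f j" j] by (auto simp: qs_def)
      qed
    qed
  qed
  have "length qs \<le> Suc n" using len by (simp add: qs_def)
  with q sumq show ?thesis by (intro exI[of _ qs]) blast
qed

lemma sum_list_pigeonhole:
  fixes g :: "'b \<Rightarrow> int"
  assumes "s \<le> (\<Sum>x\<leftarrow>xs. g x)" "0 < s" "int (length xs) \<le> N"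
  shows "\<exists>x\<in>set xs. s \<le> N * g x"
proof (rule ccontr)
  assume "\<not> ?thesis"
  then have "N * g x \<le> s - 1" if "x \<in> set xs" for x using that by force
  then have "(\<Sum>x\<leftarrow>xs. N * g x) \<le> (\<Sum>x\<leftarrow>xs. s - 1)" by (intro sum_list_mono)
  then have "N * (\<Sum>x\<leftarrow>xs. g x) \<le> int (length xs) * (s - 1)" by (simp add: sum_list_const_mult sum_list_triv)
  also have "\<dots> \<le> N * (s - 1)" using assms by (intro mult_right_mono) auto
  finally have 1: "N * (\<Sum>x\<leftarrow>xs. g x) \<le> N * (s - 1)" .
  have "xs \<noteq> []" using assms by auto
  then have "0 < N" using assms(3) by (cases xs) auto
  then have "N * (s - 1) < N * (\<Sum>x\<leftarrow>xs. g x)" using assms(1) by simp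
  with 1 show False by simp
qed

section \<open>Directions with a large part of the gain\<close>

definition dot :: "nat \<Rightarrow> (nat \<Rightarrow> int) \<Rightarrow> (nat \<Rightarrow> int) \<Rightarrow> int" where
  "dot n w x = (\<Sum>j<n. w j * x j)"

lemma dot_add: "dot n w (\<lambda>j. x j + y j) = dot n w x + dot n w y"
  by (simp add: dot_def algebra_simps sum.distrib)

lemma dot_diff: "dot n w (\<lambda>j. x j - y j) = dot n w x - dot n w y"
  by (simp add: dot_def algebra_simps sum_subtractf)

lemma dot_scale: "dot n w (\<lambda>j. c * x j) = c * dot n w x"
  by (simp add: dot_def sum_distrib_left mult.left_commute)

lemma dot_zero: "dot n w (\<lambda>j. 0) = 0"
  by (simp add: dot_def)

lemma dot_sum_list: "dot n w (\<lambda>j. \<Sum>x\<leftarrow>xs. f x j) = (\<Sum>x\<leftarrow>xs. dot n w (f x))"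
  by (induction xs) (simp_all add: dot_zero dot_add)

lemma kern_dot: "kern A R n x \<longleftrightarrow> (\<forall>j\<ge>n. x j = 0) \<and> (\<forall>i\<in>R. dot n (A i) x = 0)"
  by (simp add: kern_def dot_def)

text \<open>
  One of the at most \<open>n + 1\<close> terms \<open>\<mu> h\<close> of \<open>z\<close> has at least the average gain. As its gain is positive,
  \<open>\<mu>\<close> is not zero.
\<close>

lemma good_bounded_direction:
  assumes "minors_le A m n a" "1 \<le> a" "kern A {..<m} n z" "0 < n" "0 < dot n w z"
  shows "\<exists>\<mu> h. 1 \<le> \<mu> \<and> kern A {..<m} n h \<and> (\<forall>j. \<bar>h j\<bar> \<le> int n * a) \<and> cfm (\<lambda>j. \<mu> * h j) z \<and>
    dot n w z \<le> int (Suc n) * (\<mu> * dot n w h)"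
proof -
  obtain ps where ps: "length ps \<le> Suc n"
    "\<And>\<mu> h. (\<mu>, h) \<in> set ps \<Longrightarrow> 0 \<le> \<mu> \<and> kern A {..<m} n h \<and> (\<forall>j. \<bar>h j\<bar> \<le> int n * a) \<and> cfm (\<lambda>j. \<mu> * h j) z"
    and z: "\<And>j. z j = (\<Sum>(\<mu>, h)\<leftarrow>ps. \<mu> * h j)"
    using few_bounded_terms[OF assms(1-4)] by blast
  have "z = (\<lambda>j. \<Sum>p\<leftarrow>ps. (fst p * snd p j))" using z by (auto simp: case_prod_unfold)
  then have "dot n w z = dot n w (\<lambda>j. \<Sum>p\<leftarrow>ps. (fst p * snd p j))" by (rule arg_cong)
  also have "\<dots> = (\<Sum>p\<leftarrow>ps. fst p * dot n w (snd p))" by (simp add: dot_sum_list dot_scale)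
  finally have "dot n w z = (\<Sum>p\<leftarrow>ps. fst p * dot n w (snd p))" .
  then have "dot n w z \<le> (\<Sum>p\<leftarrow>ps. fst p * dot n w (snd p))" by simp
  from sum_list_pigeonhole[OF this assms(5), of "int (Suc n)"] ps(1) obtain p
    where p: "p \<in> set ps" "dot n w z \<le> int (Suc n) * (fst p * dot n w (snd p))" by auto
  obtain \<mu> h where ph: "p = (\<mu>, h)" by (cases p)
  have "\<mu> \<noteq> 0" using p(2) assms(5) by (auto simp: ph)
  with ps(2)[of \<mu> h] p ph show ?thesis by (intro exI[of _ \<mu>] exI[of _ h]) auto
qed

lemma good_minimal_summand:
  assumes "kern A R n h" "\<And>j. \<bar>h j\<bar> \<le> B" "0 < dot n w h"
  shows "\<exists>f. minimal_kern A R n f \<and> cfm f h \<and> dot n w h \<le> (int n * B) * dot n w f"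
proof -
  obtain gs where gs: "\<And>g. g \<in> set gs \<Longrightarrow> minimal_kern A R n g \<and> cfm g h"
    "\<And>j. h j = (\<Sum>g\<leftarrow>gs. g j)" "int (length gs) \<le> l1 n h"
    using minimal_decomposition[OF assms(1)] by blast
  have "l1 n h \<le> (\<Sum>j<n. B)" unfolding l1_def using assms(2) by (intro sum_mono)
  with gs(3) have len: "int (length gs) \<le> int n * B" by simp
  have "h = (\<lambda>j. \<Sum>g\<leftarrow>gs. g j)" using gs(2) by auto
  then have "dot n w h = (\<Sum>g\<leftarrow>gs. dot n w g)" using dot_sum_list[of n w "\<lambda>g. g" gs] by simp
  then have "dot n w h \<le> (\<Sum>g\<leftarrow>gs. dot n w g)" by simp
  from sum_list_pigeonhole[OF this assms(3) len] gs(1) show ?thesis by blast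
qed

section \<open>Tree-depth decompositions\<close>

text \<open>
  \<open>tdp adj C d\<close> says that \<open>C\<close> admits a rooted forest of height at most \<open>d\<close> that is valid for \<open>adj\<close>:
  forests of non-adjacent sets are put side by side, and a new root is put above a forest. This
  recursion is the form in which tree-depth is used below.
\<close>

inductive tdp :: "('v \<Rightarrow> 'v \<Rightarrow> bool) \<Rightarrow> 'v set \<Rightarrow> nat \<Rightarrow> bool" for adj where
  tdp_empty: "tdp adj {} d"
| tdp_union: "tdp adj C d \<Longrightarrow> tdp adj C' d \<Longrightarrow> C \<inter> C' = {} \<Longrightarrow> (\<forall>i\<in>C. \<forall>j\<in>C'. \<not> adj i j) \<Longrightarrow>
    tdp adj (C \<union> C') d"
| tdp_insert: "tdp adj C d \<Longrightarrow> tdp adj (insert v C) (Suc d)"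

lemma tdp_Suc: "tdp adj C d \<Longrightarrow> tdp adj C (Suc d)"
  by (induction rule: tdp.induct) (auto intro: tdp.intros)

lemma tdp_le: "d \<le> d' \<Longrightarrow> tdp adj C d \<Longrightarrow> tdp adj C d'"
  by (induction rule: dec_induct) (auto intro: tdp_Suc)

lemma tdp_subset: "tdp adj C d \<Longrightarrow> C' \<subseteq> C \<Longrightarrow> tdp adj C' d"
proof (induction arbitrary: C' rule: tdp.induct)
  case (tdp_empty d)
  then show ?case by (simp add: tdp.tdp_empty)
next
  case (tdp_union C1 d C2)
  have "tdp adj ((C' \<inter> C1) \<union> (C' \<inter> C2)) d"
    by (rule tdp.tdp_union) (use tdp_union in auto)
  moreover have "(C' \<inter> C1) \<union> (C' \<inter> C2) = C'" using tdp_union.prems by blast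
  ultimately show ?case by simp
next
  case (tdp_insert C d v)
  have "tdp adj (C' - {v}) d" by (rule tdp_insert.IH) (use tdp_insert.prems in auto)
  then have 1: "tdp adj (insert v (C' - {v})) (Suc d)" "tdp adj (C' - {v}) (Suc d)"
    by (rule tdp.tdp_insert, rule tdp_Suc)
  show ?case
  proof (cases "v \<in> C'")
    case True
    then show ?thesis using 1(1) by (metis insert_Diff)
  next
    case False
    then show ?thesis using 1(2) by simp
  qed
qed

subsection \<open>Bounded norm of minimal kernel vectors for few nested rows\<close>

text \<open>
  This is the Steinitz rearrangement in dimension one: while the partial sum is positive, take a
  negative number, and otherwise a nonnegative one. The start \<open>s\<close> is arbitrary for the sake of the
  induction.
\<close>

lemma balanced_order:
  fixes f :: "'b \<Rightarrow> int"
  assumes "\<And>x. x \<in># Z \<Longrightarrow> \<bar>f x\<bar> \<le> M" "\<bar>s\<bar> \<le> M" "s + (\<Sum>x\<in>#Z. f x) = 0"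
  shows "\<exists>zs. mset zs = Z \<and> (\<forall>t\<le>length zs. \<bar>s + (\<Sum>x\<leftarrow>take t zs. f x)\<bar> \<le> M)"
  using assms
proof (induction "size Z" arbitrary: Z s)
  case 0
  then show ?case by (intro exI[of _ "[]"]) simp
next
  case (Suc k)
  have "\<exists>x. x \<in># Z \<and> \<bar>s + f x\<bar> \<le> M"
  proof (rule ccontr)
    assume no: "\<not> ?thesis"
    from Suc.hyps(2) have "Z \<noteq> {#}" by auto
    show False
    proof (cases "0 < s")
      case True
      have "0 \<le> f x" if "x \<in># Z" for x
      proof (rule ccontr)
        assume "\<not> 0 \<le> f x"
        then have "\<bar>s + f x\<bar> \<le> M" using Suc.prems(1)[OF that] Suc.prems(2) True by linarith
        with no that show False by blast
      qed
      then have "(\<Sum>x\<in>#Z. 0) \<le> (\<Sum>x\<in>#Z. f x)" by (intro sum_mset_mono)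
      with Suc.prems(3) True show False by simp
    next
      case False
      have "f x < 0" if "x \<in># Z" for x
      proof (rule ccontr)
        assume "\<not> f x < 0"
        then have "\<bar>s + f x\<bar> \<le> M" using Suc.prems(1)[OF that] Suc.prems(2) False by linarith
        with no that show False by blast
      qed
      then have neg: "f x \<le> - 1" if "x \<in># Z" for x using that by fastforce
      have "(\<Sum>x\<in>#Z. f x) \<le> (\<Sum>x\<in>#Z. - 1)" by (rule sum_mset_mono) (rule neg)
      also have "\<dots> < 0" using \<open>Z \<noteq> {#}\<close> by (simp add: nonempty_has_size)
      finally show False using Suc.prems(3) False by simp
    qed
  qed
  then obtain x where x: "x \<in># Z" "\<bar>s + f x\<bar> \<le> M" by blast
  define Z' where "Z' = Z - {#x#}"
  have Z: "Z = add_mset x Z'" using x(1) by (simp add: Z'_def)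
  have "\<exists>zs. mset zs = Z' \<and> (\<forall>t\<le>length zs. \<bar>s + f x + (\<Sum>x\<leftarrow>take t zs. f x)\<bar> \<le> M)"
    by (rule Suc.hyps(1)) (use Suc.hyps(2) Suc.prems x Z in auto)
  then obtain zs where zs: "mset zs = Z'" "\<And>t. t \<le> length zs \<Longrightarrow> \<bar>s + f x + (\<Sum>x\<leftarrow>take t zs. f x)\<bar> \<le> M"
    by blast
  show ?case
  proof (intro exI[of _ "x # zs"] conjI allI impI)
    show "mset (x # zs) = Z" using zs Z by simp
    fix t assume "t \<le> length (x # zs)"
    then show "\<bar>s + (\<Sum>x\<leftarrow>take t (x # zs). f x)\<bar> \<le> M"
      using zs(2)[of "t - 1"] Suc.prems(2) by (cases t) (auto simp: add.assoc)
  qed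
qed

text \<open>
  In a balanced order all partial sums lie in \<open>{- M..M}\<close>. If there are more of them than that, two
  coincide, and the numbers between them sum up to zero.
\<close>

lemma zero_sum_sublist:
  fixes f :: "'b \<Rightarrow> int"
  assumes "\<And>x. x \<in> set xs \<Longrightarrow> \<bar>f x\<bar> \<le> M" "(\<Sum>x\<leftarrow>xs. f x) = 0" "2 * M + 1 < int (length xs)" "0 \<le> M"
  shows "\<exists>ys zs. mset (ys @ zs) = mset xs \<and> ys \<noteq> [] \<and> zs \<noteq> [] \<and> (\<Sum>x\<leftarrow>ys. f x) = 0"
proof -
  have "(\<Sum>x\<in>#mset xs. f x) = 0" using assms(2) by (metis mset_map sum_mset_sum_list)
  then obtain vs where vs: "mset vs = mset xs" "\<And>t. t \<le> length vs \<Longrightarrow> \<bar>\<Sum>x\<leftarrow>take t vs. f x\<bar> \<le> M"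
    using balanced_order[of "mset xs" f M 0] assms by auto
  have len: "length vs = length xs" using vs(1) by (rule mset_eq_length)
  define S where "S t = (\<Sum>x\<leftarrow>take t vs. f x)" for t
  have "S ` {..<length vs} \<subseteq> {- M..M}"
  proof (rule image_subsetI)
    fix t assume "t \<in> {..<length vs}"
    then show "S t \<in> {- M..M}" using vs(2)[of t] unfolding S_def by auto
  qed
  then have "card (S ` {..<length vs}) \<le> card {- M..M}" by (intro card_mono) auto
  also have "\<dots> < length vs" using assms(3,4) len by simp
  finally have "\<not> inj_on S {..<length vs}" by (intro pigeonhole) simp
  then obtain t t' where "t < length vs" "t' < length vs" "t \<noteq> t'" "S t = S t'" by (auto simp: inj_on_def)
  then obtain t t' where t: "t < t'" "t' < length vs" "S t = S t'"
    by (cases t t' rule: linorder_cases) metis+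
  have split: "take t' vs = take t vs @ drop t (take t' vs)"
    using t(1) by (metis append_take_drop_id min.strict_order_iff min.commute take_take)
  have "S t' = S t + (\<Sum>x\<leftarrow>drop t (take t' vs). f x)"
    unfolding S_def by (subst split) simp
  then have "(\<Sum>x\<leftarrow>drop t (take t' vs). f x) = 0" using t(3) by simp
  moreover have "mset (drop t (take t' vs) @ (take t vs @ drop t' vs)) = mset vs"
    by (metis append.assoc append_take_drop_id mset_append split union_commute)
  moreover have "drop t (take t' vs) \<noteq> []" "take t vs @ drop t' vs \<noteq> []" using t by auto
  ultimately show ?thesis using vs(1) by metis
qed

lemma sum_list_mset_cong: "mset xs = mset ys \<Longrightarrow> (\<Sum>x\<leftarrow>xs. f x) = (\<Sum>x\<leftarrow>ys. f x :: int)"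
  by (metis mset_map sum_mset_sum_list)

text \<open>
  With one more row, at most \<open>2 a l1_bound a d + 1\<close> vectors of the previous norm are combined.
\<close>

fun l1_bound :: "int \<Rightarrow> nat \<Rightarrow> int" where
  "l1_bound a 0 = 1"
| "l1_bound a (Suc d) = (2 * (a * l1_bound a d) + 1) * l1_bound a d"

lemma l1_bound_pos: "0 \<le> a \<Longrightarrow> 1 \<le> l1_bound a d"
proof (induction d)
  case (Suc d)
  then have "1 * 1 \<le> (2 * (a * l1_bound a d) + 1) * l1_bound a d" by (intro mult_mono) auto
  then show ?case by simp
qed simp

lemma abs_dot_le:
  assumes "\<And>j. j < n \<Longrightarrow> \<bar>w j\<bar> \<le> a"
  shows "\<bar>dot n w x\<bar> \<le> a * l1 n x"
proof -
  have "\<bar>dot n w x\<bar> \<le> (\<Sum>j<n. \<bar>w j * x j\<bar>)" unfolding dot_def by (rule sum_abs)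
  also have "\<dots> \<le> (\<Sum>j<n. a * \<bar>x j\<bar>)"
    unfolding abs_mult using assms by (intro sum_mono mult_right_mono) auto
  finally show ?thesis by (simp add: l1_def sum_distrib_left)
qed

lemma l1_sum_list_le: "(\<And>g. g \<in> set gs \<Longrightarrow> l1 n g \<le> K) \<Longrightarrow> l1 n (\<lambda>j. \<Sum>g\<leftarrow>gs. g j) \<le> int (length gs) * K"
proof (induction gs)
  case Nil
  then show ?case by (simp add: l1_def)
next
  case (Cons g gs)
  have "l1 n (\<lambda>j. \<Sum>g\<leftarrow>g # gs. g j) \<le> l1 n g + l1 n (\<lambda>j. \<Sum>g\<leftarrow>gs. g j)"
    unfolding l1_def sum.distrib[symmetric] by (intro sum_mono) simp
  with Cons show ?case by (fastforce simp: algebra_simps)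
qed

lemma minimal_kern_no_split:
  assumes "minimal_kern A R n z" "kern A R n x" "cfm x z"
  shows "x = (\<lambda>j. 0) \<or> x = z"
  using assms unfolding minimal_kern_def by blast

lemma sum_list_conformal:
  assumes "\<And>g. g \<in> set gs \<Longrightarrow> cfm g z" "\<And>j. z j = (\<Sum>g\<leftarrow>gs. g j)" "mset (ys @ zs) = mset gs"
  shows "cfm (\<lambda>j. \<Sum>g\<leftarrow>ys. g j) z"
  unfolding cfm_def
proof
  fix j
  have set: "set (ys @ zs) = set gs" using assms(3) by (metis set_mset_mset)
  have sum: "z j = (\<Sum>g\<leftarrow>ys. g j) + (\<Sum>g\<leftarrow>zs. g j)"
    using sum_list_mset_cong[OF assms(3), of "\<lambda>g. g j"] assms(2)[of j] by simp
  have c: "0 \<le> g j \<and> g j \<le> z j \<or> z j \<le> g j \<and> g j \<le> 0" if "g \<in> set (ys @ zs)" for g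
    using assms(1) that set unfolding cfm_def by blast
  show "0 \<le> (\<Sum>g\<leftarrow>ys. g j) \<and> (\<Sum>g\<leftarrow>ys. g j) \<le> z j \<or> z j \<le> (\<Sum>g\<leftarrow>ys. g j) \<and> (\<Sum>g\<leftarrow>ys. g j) \<le> 0"
  proof (cases "0 \<le> z j")
    case True
    then have nn: "0 \<le> g j" if "g \<in> set (ys @ zs)" for g using c[OF that] by linarith
    have "0 \<le> (\<Sum>g\<leftarrow>ys. g j)" "0 \<le> (\<Sum>g\<leftarrow>zs. g j)" using nn by (auto intro!: sum_list_nonneg)
    then show ?thesis using sum by linarith
  next
    case False
    then have np: "g j \<le> 0" if "g \<in> set (ys @ zs)" for g using c[OF that] by linarith
    have "(\<Sum>g\<leftarrow>ys. g j) \<le> 0" "(\<Sum>g\<leftarrow>zs. g j) \<le> 0" using np by (auto intro!: sum_list_nonpos)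
    then show ?thesis using sum by linarith
  qed
qed

lemma sum_list_conformal_nonzero:
  assumes "\<And>g. g \<in> set ys \<Longrightarrow> cfm g z \<and> g \<noteq> (\<lambda>j. 0)" "ys \<noteq> []"
  shows "(\<lambda>j. \<Sum>g\<leftarrow>ys. g j) \<noteq> (\<lambda>j. 0)"
proof
  assume zero: "(\<lambda>j. \<Sum>g\<leftarrow>ys. g j) = (\<lambda>j. 0)"
  obtain g where g: "g \<in> set ys" using assms(2) by (meson list.set_sel(1))
  with assms(1) obtain j where j: "g j \<noteq> 0" by blast
  have c: "0 \<le> g j \<and> g j \<le> z j \<or> z j \<le> g j \<and> g j \<le> 0" if "g \<in> set ys" for g
    using assms(1)[OF that] unfolding cfm_def by blast
  have s: "(\<Sum>g\<leftarrow>ys. g j) = 0" using fun_cong[OF zero, of j] .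
  show False
  proof (cases "0 \<le> z j")
    case True
    then have "0 \<le> g j" if "g \<in> set ys" for g using c[OF that] by linarith
    then have "g j \<le> (\<Sum>g\<leftarrow>ys. g j)" using g member_le_sum_list[of "g j" "map (\<lambda>g. g j) ys"] by fastforce
    with s j c[OF g] True show False by linarith
  next
    case False
    then have "0 \<le> - g j" if "g \<in> set ys" for g using c[OF that] by linarith
    then have "- g j \<le> (\<Sum>g\<leftarrow>ys. - g j)" using g member_le_sum_list[of "- g j" "map (\<lambda>g. - g j) ys"] by fastforce
    also have "\<dots> = 0" using s by (simp add: uminus_sum_list_map[symmetric, unfolded comp_def])
    finally show False using j c[OF g] False by linarith
  qed
qed

text \<open>
  Without rows, minimal vectors are signed unit vectors. If the rows fall into two groups that share no
  column, the part of a kernel vector on the columns of one group is again in the kernel, so a minimal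
  vector lives on one side. If a row \<open>v\<close> is added, decompose a vector in the kernel of all rows
  conformally into minimal vectors for the old rows. Their products with row \<open>v\<close> are bounded and
  sum up to zero; if there were many of them, a proper part would have sum zero and so contradict
  minimality.
\<close>

lemma l1_minimal_kern_le:
  assumes "tdp (\<lambda>i i'. \<exists>j<n. A i j \<noteq> 0 \<and> A i' j \<noteq> 0) R d"
    and "\<And>i j. i \<in> R \<Longrightarrow> j < n \<Longrightarrow> \<bar>A i j\<bar> \<le> a" and "0 \<le> a" and "minimal_kern A R n z"
  shows "l1 n z \<le> l1_bound a d"
  using assms
proof (induction arbitrary: z rule: tdp.induct)
  case (tdp_empty d)
  have z: "kern A {} n z" "z \<noteq> (\<lambda>j. 0)" using tdp_empty.prems unfolding minimal_kern_def by auto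
  then obtain j where j: "z j \<noteq> 0" by auto
  then have jn: "j < n" using z(1) unfolding kern_def by (auto simp: not_le[symmetric])
  define f where "f x = (if x = j then sgn (z j) else 0)" for x
  have "kern A {} n f" using jn by (auto simp: kern_def f_def)
  moreover have "cfm f z" unfolding cfm_def f_def by (auto simp: sgn_if)
  moreover have "f \<noteq> (\<lambda>j. 0)"
  proof
    assume "f = (\<lambda>j. 0)"
    then have "f j = 0" by simp
    with j show False by (simp add: f_def sgn_if split: if_splits)
  qed
  ultimately have "f = z" using minimal_kern_no_split tdp_empty.prems by blast
  have "l1 n f = (\<Sum>x<n. if x = j then 1 else 0)" unfolding l1_def f_def using j by (intro sum.cong) (auto simp: sgn_if)
  also have "\<dots> = 1" using jn by simp
  finally show ?case using \<open>f = z\<close> l1_bound_pos[OF tdp_empty.prems(2), of d] by simp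
next
  case (tdp_union C d C')
  have k: "kern A (C \<union> C') n z" "z \<noteq> (\<lambda>j. 0)" using tdp_union.prems unfolding minimal_kern_def by auto
  define T where "T = {j. \<exists>i\<in>C. A i j \<noteq> 0}"
  define x where "x j = (if j \<in> T then z j else 0)" for j
  have CT: "A i j = 0" if "i \<in> C" "j \<notin> T" for i j using that by (auto simp: T_def)
  have C'T: "A i j = 0" if "i \<in> C'" "j \<in> T" "j < n" for i j
    using that tdp_union.hyps(4) by (auto simp: T_def)
  have rowC: "(\<Sum>j<n. A i j * x j) = (\<Sum>j<n. A i j * z j)" if "i \<in> C" for i
    by (rule sum.cong) (use CT that in \<open>auto simp: x_def\<close>)
  have rowC': "(\<Sum>j<n. A i j * x j) = 0" if "i \<in> C'" for i
    by (rule sum.neutral) (use C'T that in \<open>auto simp: x_def\<close>)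
  have kx: "kern A (C \<union> C') n x" unfolding kern_def
    using k(1) rowC rowC' by (auto simp: kern_def x_def)
  have "cfm x z" by (auto simp: cfm_def x_def)
  from minimal_kern_no_split[OF tdp_union.prems(3) kx this] show ?case
  proof
    assume x0: "x = (\<lambda>j. 0)"
    have zT: "z j = 0" if "j \<in> T" for j using fun_cong[OF x0, of j] that by (simp add: x_def)
    have "minimal_kern A C' n z" unfolding minimal_kern_def
    proof (intro conjI allI impI)
      show "kern A C' n z" "z \<noteq> (\<lambda>j. 0)" using k by (auto simp: kern_def)
      fix f assume f: "kern A C' n f \<and> f \<noteq> (\<lambda>j. 0) \<and> cfm f z"
      have "f j = 0" if "j \<in> T" for j using cfm_abs[of f z j] f zT[OF that] by simp
      then have "(\<Sum>j<n. A i j * f j) = 0" if "i \<in> C" for i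
        using CT[OF that] by (intro sum.neutral) (metis mult_eq_0_iff)
      then have "kern A (C \<union> C') n f" using f by (auto simp: kern_def)
      with minimal_kern_no_split[OF tdp_union.prems(3)] f show "f = z" by blast
    qed
    with tdp_union.IH(2) tdp_union.prems show ?case by simp
  next
    assume "x = z"
    have "x j = 0" if "j \<notin> T" for j using that by (simp add: x_def)
    with \<open>x = z\<close> have zT: "z j = 0" if "j \<notin> T" for j using that by simp
    have "minimal_kern A C n z" unfolding minimal_kern_def
    proof (intro conjI allI impI)
      show "kern A C n z" "z \<noteq> (\<lambda>j. 0)" using k by (auto simp: kern_def)
      fix f assume f: "kern A C n f \<and> f \<noteq> (\<lambda>j. 0) \<and> cfm f z"
      have f0: "f j = 0" if "j \<notin> T" for j using cfm_abs[of f z j] f zT[OF that] by simp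
      have "(\<Sum>j<n. A i j * f j) = 0" if "i \<in> C'" for i
      proof (rule sum.neutral, rule ballI)
        fix j assume "j \<in> {..<n}"
        then show "A i j * f j = 0" using C'T[OF that, of j] f0[of j] by (cases "j \<in> T") auto
      qed
      then have "kern A (C \<union> C') n f" using f by (auto simp: kern_def)
      with minimal_kern_no_split[OF tdp_union.prems(3)] f show "f = z" by blast
    qed
    with tdp_union.IH(1) tdp_union.prems show ?case by simp
  qed
next
  case (tdp_insert C d v)
  let ?K = "l1_bound a d"
  have K: "1 \<le> ?K" by (rule l1_bound_pos[OF tdp_insert.prems(2)])
  have kz: "kern A C n z" "dot n (A v) z = 0"
    using tdp_insert.prems(3) unfolding minimal_kern_def kern_dot by auto
  obtain gs where gs: "\<And>g. g \<in> set gs \<Longrightarrow> minimal_kern A C n g \<and> cfm g z"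
    "\<And>j. z j = (\<Sum>g\<leftarrow>gs. g j)"
    using minimal_decomposition[OF kz(1)] by blast
  have z: "z = (\<lambda>j. \<Sum>g\<leftarrow>gs. g j)" using gs(2) by auto
  have gK: "l1 n g \<le> ?K" if "g \<in> set gs" for g
    using tdp_insert.IH tdp_insert.prems gs(1)[OF that] by simp
  have row: "\<bar>dot n (A v) g\<bar> \<le> a * ?K" if "g \<in> set gs" for g
  proof -
    have "\<bar>dot n (A v) g\<bar> \<le> a * l1 n g" using tdp_insert.prems(1) by (intro abs_dot_le) simp
    also have "\<dots> \<le> a * ?K" using gK[OF that] tdp_insert.prems(2) by (rule mult_left_mono)
    finally show ?thesis .
  qed
  have "int (length gs) \<le> 2 * (a * ?K) + 1"
  proof (rule ccontr)
    assume "\<not> ?thesis"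
    then have long: "2 * (a * ?K) + 1 < int (length gs)" by simp
    have "(\<Sum>g\<leftarrow>gs. dot n (A v) g) = dot n (A v) z"
      by (subst z) (rule dot_sum_list[of n "A v" "\<lambda>g. g" gs, symmetric])
    then have zero: "(\<Sum>g\<leftarrow>gs. dot n (A v) g) = 0" using kz(2) by simp
    have "0 \<le> a * ?K" using tdp_insert.prems(2) K by simp
    from zero_sum_sublist[OF row zero long this] obtain ys zs where
      yz: "mset (ys @ zs) = mset gs" "ys \<noteq> []" "zs \<noteq> []" "(\<Sum>g\<leftarrow>ys. dot n (A v) g) = 0" by blast
    have set: "set ys \<subseteq> set gs" "set zs \<subseteq> set gs" using yz(1) by (metis set_append set_mset_mset sup_ge1, metis set_append set_mset_mset sup_ge2)
    define f where "f = (\<lambda>j. \<Sum>g\<leftarrow>ys. g j)"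
    have "kern A C n f" unfolding f_def
      by (rule kern_sum_list[of ys A C n "\<lambda>g. g"]) (use gs(1) set(1) in \<open>auto simp: minimal_kern_def\<close>)
    moreover have "dot n (A v) f = 0" using dot_sum_list[of n "A v" "\<lambda>g. g" ys] yz(4) by (simp add: f_def)
    ultimately have kf: "kern A (insert v C) n f" by (auto simp: kern_dot)
    have cf: "cfm f z" unfolding f_def
      by (rule sum_list_conformal[OF _ gs(2) yz(1)]) (use gs(1) in blast)
    have f0: "f \<noteq> (\<lambda>j. 0)" unfolding f_def
      by (rule sum_list_conformal_nonzero[of _ z]) (use gs(1) set(1) yz(2) in \<open>auto simp: minimal_kern_def\<close>)
    have g0: "(\<lambda>j. \<Sum>g\<leftarrow>zs. g j) \<noteq> (\<lambda>j. 0)"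
      by (rule sum_list_conformal_nonzero[of _ z]) (use gs(1) set(2) yz(3) in \<open>auto simp: minimal_kern_def\<close>)
    have "z j = f j + (\<Sum>g\<leftarrow>zs. g j)" for j
      using sum_list_mset_cong[OF yz(1), of "\<lambda>g. g j"] gs(2)[of j] by (simp add: f_def)
    with g0 have "f \<noteq> z" by fastforce
    with minimal_kern_no_split[OF tdp_insert.prems(3) kf cf] f0 show False by blast
  qed
  then have "int (length gs) * ?K \<le> (2 * (a * ?K) + 1) * ?K" using K by (intro mult_right_mono) auto
  moreover have "l1 n z \<le> int (length gs) * ?K"
    by (subst z) (rule l1_sum_list_le, rule gK)
  ultimately show ?case by simp
qed

subsection \<open>From valid trees to nested decompositions\<close>

lemma tdp_Union:
  assumes "finite I" "\<And>i. i \<in> I \<Longrightarrow> tdp adj (C i) d" "\<And>i j. i \<in> I \<Longrightarrow> j \<in> I \<Longrightarrow> i \<noteq> j \<Longrightarrow> C i \<inter> C j = {}"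
    "\<And>i j x y. i \<in> I \<Longrightarrow> j \<in> I \<Longrightarrow> i \<noteq> j \<Longrightarrow> x \<in> C i \<Longrightarrow> y \<in> C j \<Longrightarrow> \<not> adj x y"
  shows "tdp adj (\<Union>i\<in>I. C i) d"
  using assms
proof (induction I rule: finite_induct)
  case empty
  then show ?case by (simp add: tdp.tdp_empty)
next
  case (insert k I)
  have "tdp adj (C k \<union> (\<Union>i\<in>I. C i)) d"
  proof (rule tdp.tdp_union)
    show "tdp adj (C k) d" using insert.prems(1) by simp
    show "tdp adj (\<Union>i\<in>I. C i) d"
    proof (rule insert.IH)
      show "\<not> adj x y" if "i \<in> I" "j \<in> I" "i \<noteq> j" "x \<in> C i" "y \<in> C j" for i j x y
        by (rule insert.prems(3)[of i j]) (use that in auto)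
    qed (use insert.prems in auto)
    show "C k \<inter> (\<Union>i\<in>I. C i) = {}"
    proof (rule equals0I)
      fix x assume "x \<in> C k \<inter> (\<Union>i\<in>I. C i)"
      then obtain i where i: "i \<in> I" "x \<in> C k" "x \<in> C i" by blast
      then have "k \<noteq> i" using insert.hyps(2) by blast
      with insert.prems(2)[of k i] i show False by blast
    qed
    show "\<forall>x\<in>C k. \<forall>y\<in>\<Union>i\<in>I. C i. \<not> adj x y"
    proof (intro ballI)
      fix x y assume "x \<in> C k" "y \<in> (\<Union>i\<in>I. C i)"
      then obtain i where i: "i \<in> I" "y \<in> C i" by blast
      then have "k \<noteq> i" using insert.hyps(2) by blast
      with insert.prems(3)[of k i x y] i \<open>x \<in> C k\<close> show "\<not> adj x y" by blast
    qed
  qed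
  then show ?case by simp
qed

text \<open>
  For paths from the root of a tree this says that one of their ends is an ancestor of the other.
\<close>

definition comparable :: "'a list \<Rightarrow> 'a list \<Rightarrow> bool" where
  "comparable p q \<longleftrightarrow> (\<exists>r. q = p @ r) \<or> (\<exists>r. p = q @ r)"

lemma comparable_Cons: "comparable (x # p) (y # q) \<longleftrightarrow> x = y \<and> comparable p q"
  by (auto simp: comparable_def)

text \<open>
  A tree enters only through the paths from its root to the vertices, as words of which adjacent
  vertices have comparable ones. Vertices with different first letters are then not adjacent, and
  among those with the same first letter at most one path ends there; it is the root. Removing the
  first letter gives paths of smaller length.
\<close>

lemma tdp_of_paths:
  fixes q :: "'v \<Rightarrow> 'a list"
  assumes "finite C" "inj_on q C" "\<And>v. v \<in> C \<Longrightarrow> q v \<noteq> [] \<and> length (q v) \<le> h"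
    and "\<And>u v. u \<in> C \<Longrightarrow> v \<in> C \<Longrightarrow> u \<noteq> v \<Longrightarrow> adj u v \<Longrightarrow> comparable (q u) (q v)"
  shows "tdp adj C h"
  using assms
proof (induction h arbitrary: C q)
  case 0
  then have "C = {}" by force
  then show ?case by (simp add: tdp.tdp_empty)
next
  case (Suc h)
  have part: "tdp adj {v \<in> C. hd (q v) = a} (Suc h)" for a
  proof -
    let ?D = "{v \<in> C. hd (q v) = a}" and ?E = "{v \<in> C. hd (q v) = a \<and> tl (q v) \<noteq> []}"
    have E: "tdp adj ?E h"
    proof (rule Suc.IH[of _ "\<lambda>v. tl (q v)"])
      show "finite ?E" using Suc.prems(1) by simp
      show "inj_on (\<lambda>v. tl (q v)) ?E"
      proof (rule inj_onI)
        fix u v assume uv: "u \<in> ?E" "v \<in> ?E" "tl (q u) = tl (q v)"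
        then have "q u \<noteq> []" "q v \<noteq> []" "hd (q u) = hd (q v)" using Suc.prems(3) by auto
        with uv(3) have "q u = q v" by (metis list.collapse)
        with uv Suc.prems(2) show "u = v" by (auto dest: inj_onD)
      qed
      show "tl (q v) \<noteq> [] \<and> length (tl (q v)) \<le> h" if "v \<in> ?E" for v
        using that Suc.prems(3)[of v] by auto
      show "comparable (tl (q u)) (tl (q v))" if "u \<in> ?E" "v \<in> ?E" "u \<noteq> v" "adj u v" for u v
      proof -
        have "comparable (q u) (q v)" using that by (intro Suc.prems(4)) auto
        moreover have "q w = a # tl (q w)" if "w \<in> ?E" for w using that by (cases "q w") auto
        then have "q u = a # tl (q u)" "q v = a # tl (q v)" using that by blast+
        ultimately show ?thesis by (metis comparable_Cons)
      qed
    qed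
    show ?thesis
    proof (cases "?D = ?E")
      case True
      with tdp_Suc[OF E] show ?thesis by (simp only:)
    next
      case False
      then obtain v where v: "v \<in> ?D" "tl (q v) = []" by blast
      have "u = v" if "u \<in> ?D" "tl (q u) = []" for u
      proof -
        have single: "q w = [a]" if "w \<in> ?D" "tl (q w) = []" for w
          using that Suc.prems(3)[of w] by (cases "q w") auto
        have "q u = q v" unfolding single[OF that] single[OF v] ..
        then show ?thesis using that v by (intro inj_onD[OF Suc.prems(2)]) auto
      qed
      then have "?D = insert v ?E" using v by blast
      with tdp.tdp_insert[OF E, of v] show ?thesis by (simp only:)
    qed
  qed
  have "tdp adj (\<Union>a\<in>(\<lambda>v. hd (q v)) ` C. {v \<in> C. hd (q v) = a}) (Suc h)"
  proof (rule tdp_Union)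
    show "finite ((\<lambda>v. hd (q v)) ` C)" using Suc.prems(1) by simp
    show "\<not> adj x y" if "i \<noteq> j" "x \<in> {v \<in> C. hd (q v) = i}" "y \<in> {v \<in> C. hd (q v) = j}" for i j x y
    proof
      assume "adj x y"
      moreover have "x \<noteq> y" using that by auto
      ultimately have "comparable (q x) (q y)" using that Suc.prems(4) by blast
      moreover have "q x \<noteq> []" "q y \<noteq> []" using that Suc.prems(3) by auto
      ultimately have "hd (q x) = hd (q y)" by (metis comparable_Cons list.collapse)
      with that show False by auto
    qed
  qed (use part in auto)
  moreover have "(\<Union>a\<in>(\<lambda>v. hd (q v)) ` C. {v \<in> C. hd (q v) = a}) = C" by auto
  ultimately show ?case by simp
qed

lemma dpath_prefix:
  assumes "dpath T r p k" "j \<in> set p"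
  shows "\<exists>p' s. p = p' @ s \<and> dpath T r p' j"
proof -
  from assms(2) obtain xs ys where p: "p = xs @ j # ys" by (meson split_list)
  have "successively (\<lambda>i j. (i, j) \<in> T) ((xs @ [j]) @ ys)" "hd ((xs @ [j]) @ ys) = r"
    using assms(1) unfolding dpath_def p by simp_all
  then have "successively (\<lambda>i j. (i, j) \<in> T) (xs @ [j])" "hd (xs @ [j]) = r"
    unfolding successively_append_iff by (auto simp: hd_append)
  then have "dpath T r (xs @ [j]) j" by (simp add: dpath_def)
  then show ?thesis using p by (intro exI[of _ "xs @ [j]"] exI[of _ ys]) simp
qed

lemma dpath_snoc: "dpath T r p v \<Longrightarrow> (v, c) \<in> T \<Longrightarrow> dpath T r (p @ [c]) c"
  unfolding dpath_def by (auto simp: successively_append_iff)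

text \<open>
  The height of a tree is defined by paths to leaves. Every path from the root extends to one, since an
  extension of maximal length ends in a leaf.
\<close>

lemma tdp_of_valid_tree:
  assumes "valid_tree V E r T" and fin: "finite V"
    and adj: "\<And>u v. u \<in> V \<Longrightarrow> v \<in> V \<Longrightarrow> u \<noteq> v \<Longrightarrow> adj u v \<Longrightarrow> {u, v} \<in> E"
  shows "tdp adj V (tree_height V r T)"
proof -
  have tree: "rooted_tree V r T" and val: "\<And>j k. {j, k} \<in> E \<Longrightarrow>
        (\<exists>p. dpath T r p k \<and> j \<in> set p) \<or> (\<exists>p. dpath T r p j \<and> k \<in> set p)"
    using assms(1) unfolding valid_tree_def by auto
  define q where "q v = (THE p. dpath T r p v)" for v
  have TV: "T \<subseteq> V \<times> V" and uniq: "\<And>v. v \<in> V \<Longrightarrow> \<exists>!p. dpath T r p v"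
    using tree unfolding rooted_tree_def by auto
  have q: "dpath T r (q v) v" if "v \<in> V" for v unfolding q_def by (rule theI'[OF uniq[OF that]])
  have qI: "p = q v" if "v \<in> V" "dpath T r p v" for p v using uniq[OF that(1)] q[OF that(1)] that(2) by blast
  have leaves: "{length p | p v. tree_leaf V T v \<and> dpath T r p v} \<subseteq> (\<lambda>v. length (q v)) ` V"
    using qI by (auto simp: tree_leaf_def)
  then have finl: "finite {length p | p v. tree_leaf V T v \<and> dpath T r p v}"
    by (rule finite_subset) (use fin in simp)
  have short: "length (q v) \<le> tree_height V r T" if v: "v \<in> V" for v
  proof -
    define W where "W = {u \<in> V. \<exists>s. q u = q v @ s}"
    have W: "finite W" "W \<noteq> {}" using fin v by (auto simp: W_def)
    have "\<exists>u\<in>W. \<forall>x\<in>W. length (q x) \<le> length (q u)"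
    proof -
      have "Max ((\<lambda>u. length (q u)) ` W) \<in> (\<lambda>u. length (q u)) ` W" using W by (intro Max_in) auto
      then obtain u where "u \<in> W" "length (q u) = Max ((\<lambda>u. length (q u)) ` W)" by force
      with W show ?thesis by (intro bexI[of _ u]) auto
    qed
    then obtain u where u: "u \<in> W" "\<And>x. x \<in> W \<Longrightarrow> length (q x) \<le> length (q u)" by blast
    have "tree_leaf V T u" unfolding tree_leaf_def
    proof (intro conjI notI)
      show "u \<in> V" using u(1) by (simp add: W_def)
      assume "\<exists>c. (u, c) \<in> T"
      then obtain c where c: "(u, c) \<in> T" by blast
      then have "c \<in> V" using TV by blast
      have "q c = q u @ [c]" using qI[OF \<open>c \<in> V\<close> dpath_snoc[OF q[OF \<open>u \<in> V\<close>] c]] by simp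
      moreover then have "c \<in> W" using u(1) \<open>c \<in> V\<close> by (auto simp: W_def)
      ultimately show False using u(2)[of c] by simp
    qed
    then have "length (q u) \<in> {length p | p v. tree_leaf V T v \<and> dpath T r p v}"
      using q[of u] by (auto simp: tree_leaf_def)
    then have "length (q u) \<le> tree_height V r T" unfolding tree_height_def using finl by (intro Max_ge)
    moreover have "v \<in> W" using v by (auto simp: W_def)
    ultimately show ?thesis using u(2) le_trans by blast
  qed
  show ?thesis
  proof (rule tdp_of_paths[of V q, OF fin])
    show "inj_on q V" by (rule inj_onI) (metis q dpath_def)
    show "q v \<noteq> [] \<and> length (q v) \<le> tree_height V r T" if "v \<in> V" for v
      using q[OF that] short[OF that] by (simp add: dpath_def)
    show "comparable (q u) (q v)" if uv: "u \<in> V" "v \<in> V" "u \<noteq> v" "adj u v" for u v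
    proof -
      have *: "\<exists>s. q y = q x @ s" if "x \<in> V" "y \<in> V" "dpath T r p y" "x \<in> set p" for x y p
        using dpath_prefix[OF that(3,4)] qI[OF that(1)] qI[OF that(2,3)] by metis
      from val[OF adj[OF uv]] show ?thesis
      proof
        assume "\<exists>p. dpath T r p v \<and> u \<in> set p"
        then show ?thesis using *[OF uv(1,2)] by (auto simp: comparable_def)
      next
        assume "\<exists>p. dpath T r p u \<and> v \<in> set p"
        then show ?thesis using *[OF uv(2,1)] by (auto simp: comparable_def)
      qed
    qed
  qed
qed

text \<open>
  Tree-depth is defined as a least number; a path is a valid tree for every graph, so there is
  one.
\<close>

lemma path_valid_tree:
  assumes "0 < n" "dim_col B = n"
  shows "valid_tree {..<n} (mat_graph_edges B) 0 {(i, Suc i) | i. Suc i < n}"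
proof -
  let ?T = "{(i, Suc i) | i. Suc i < n}"
  have up: "dpath ?T 0 [0..<Suc v] v" if "v < n" for v
    using that
  proof (induction v)
    case 0
    then show ?case by (simp add: dpath_def)
  next
    case (Suc v)
    then have "dpath ?T 0 ([0..<Suc v] @ [Suc v]) (Suc v)" by (intro dpath_snoc[of _ _ _ v]) auto
    then show ?case by simp
  qed
  have only: "p = [0..<Suc v]" if "dpath ?T 0 p v" for p v
    using that
  proof (induction p arbitrary: v rule: rev_induct)
    case Nil
    then show ?case by (simp add: dpath_def)
  next
    case (snoc x xs)
    have x: "x = v" using snoc.prems by (simp add: dpath_def)
    show ?case
    proof (cases "xs = []")
      case True
      then show ?thesis using snoc.prems by (simp add: dpath_def)
    next
      case False
      then have d: "dpath ?T 0 xs (last xs)" and "(last xs, x) \<in> ?T"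
        using snoc.prems by (auto simp: dpath_def successively_append_iff)
      then have "x = Suc (last xs)" by auto
      moreover have "xs = [0..<Suc (last xs)]" by (rule snoc.IH[OF d])
      ultimately show ?thesis using x by (metis upt_Suc zero_le)
    qed
  qed
  have tree: "rooted_tree {..<n} 0 ?T"
    unfolding rooted_tree_def using assms up only by (auto simp del: upt_Suc) blast+
  have "(\<exists>p. dpath ?T 0 p k \<and> j \<in> set p) \<or> (\<exists>p. dpath ?T 0 p j \<and> k \<in> set p)"
    if e: "{j, k} \<in> mat_graph_edges B" for j k
  proof -
    from e have jk: "j < n" "k < n" using \<open>dim_col B = n\<close> by (auto simp: mat_graph_edges_def doubleton_eq_iff)
    show ?thesis
    proof (cases "j \<le> k")
      case True
      with up[OF jk(2)] show ?thesis by (auto simp del: upt_Suc intro!: exI[of _ "[0..<Suc k]"])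
    next
      case False
      with up[OF jk(1)] show ?thesis by (auto simp del: upt_Suc intro!: exI[of _ "[0..<Suc j]"])
    qed
  qed
  with tree show ?thesis unfolding valid_tree_def by blast
qed

lemma tdp_mat_treedepth:
  assumes "0 < dim_col B"
  shows "tdp (\<lambda>j k. \<exists>i<dim_row B. B $$ (i, j) \<noteq> 0 \<and> B $$ (i, k) \<noteq> 0) {..<dim_col B} (mat_treedepth B)"
proof -
  let ?P = "\<lambda>h. \<exists>r T. valid_tree {..<dim_col B} (mat_graph_edges B) r T \<and> tree_height {..<dim_col B} r T = h"
  have "\<exists>h. ?P h" using path_valid_tree[OF assms refl] by blast
  then have "?P (mat_treedepth B)" unfolding mat_treedepth_def treedepth_def by (rule LeastI_ex)
  then obtain r T where T: "valid_tree {..<dim_col B} (mat_graph_edges B) r T"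
    "tree_height {..<dim_col B} r T = mat_treedepth B" by blast
  have "tdp (\<lambda>j k. \<exists>i<dim_row B. B $$ (i, j) \<noteq> 0 \<and> B $$ (i, k) \<noteq> 0) {..<dim_col B} (tree_height {..<dim_col B} r T)"
    by (rule tdp_of_valid_tree[OF T(1)]) (auto simp: mat_graph_edges_def)
  then show ?thesis using T(2) by simp
qed

section \<open>Minors as subdeterminants\<close>

lemma pick_bij:
  assumes "finite I" shows "bij_betw (pick I) {..<card I} I"
proof -
  have inj: "inj_on (pick I) {..<card I}"
  proof (rule inj_onI)
    fix x y assume "x \<in> {..<card I}" "y \<in> {..<card I}" "pick I x = pick I y"
    then show "x = y" using pick_mono_le[of y I x] pick_mono_le[of x I y]
      by (metis lessThan_iff linorder_neqE_nat order_less_irrefl)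
  qed
  moreover have "pick I ` {..<card I} \<subseteq> I" using pick_in_set_le by auto
  ultimately show ?thesis
    using card_subset_eq[OF assms] by (metis bij_betw_def card_image card_lessThan)
qed

text \<open>
  Two enumerations of the same set differ by a permutation, which changes only the sign of the
  determinant.
\<close>

lemma det_rows_reordered:
  fixes f :: "nat \<Rightarrow> nat \<Rightarrow> int"
  assumes "bij_betw \<rho> {..<k} I" "bij_betw \<rho>' {..<k} I"
  shows "\<bar>det (mat k k (\<lambda>(p, q). f (\<rho> p) q))\<bar> = \<bar>det (mat k k (\<lambda>(p, q). f (\<rho>' p) q))\<bar>"
proof -
  define \<pi> where "\<pi> p = (if p < k then inv_into {..<k} \<rho>' (\<rho> p) else p)" for p
  have bij: "bij_betw (\<lambda>p. inv_into {..<k} \<rho>' (\<rho> p)) {..<k} {..<k}"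
    using bij_betw_trans[OF assms(1) bij_betw_inv_into[OF assms(2)]] by (simp add: comp_def)
  have "\<pi> permutes {0..<k}"
  proof (rule bij_imp_permutes)
    show "bij_betw \<pi> {0..<k} {0..<k}"
      using bij bij_betw_cong[of "{..<k}" \<pi> "\<lambda>p. inv_into {..<k} \<rho>' (\<rho> p)" "{..<k}"]
      by (simp add: \<pi>_def atLeast0LessThan)
  qed (simp add: \<pi>_def)
  let ?M = "mat k k (\<lambda>(p, q). f (\<rho>' p) q)"
  have "det (mat k k (\<lambda>(i, j). ?M $$ (\<pi> i, j))) = of_int (sign \<pi>) * det ?M"
    by (rule det_permute_rows) (use \<open>\<pi> permutes _\<close> in auto)
  moreover have "mat k k (\<lambda>(i, j). ?M $$ (\<pi> i, j)) = mat k k (\<lambda>(p, q). f (\<rho> p) q)"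
  proof (rule eq_matI)
    fix i j assume "i < dim_row (mat k k (\<lambda>(p, q). f (\<rho> p) q))" "j < dim_col (mat k k (\<lambda>(p, q). f (\<rho> p) q))"
    then have ij: "i < k" "j < k" by auto
    then have "\<pi> i < k" using \<open>\<pi> permutes _\<close> permutes_in_image[of \<pi> "{0..<k}" i] by simp
    moreover have "\<rho>' (\<pi> i) = \<rho> i"
      using ij(1) assms by (auto simp: \<pi>_def bij_betw_def intro!: f_inv_into_f)
    ultimately show "mat k k (\<lambda>(i, j). ?M $$ (\<pi> i, j)) $$ (i, j) = mat k k (\<lambda>(p, q). f (\<rho> p) q) $$ (i, j)"
      using ij by simp
  qed auto
  moreover have "\<bar>of_int (sign \<pi>) :: int\<bar> = 1" by (simp add: sign_def)
  ultimately show ?thesis by (metis abs_mult mult_1)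
qed

text \<open>
  Submatrices are taken with rows and columns in increasing order. An arbitrary order arises from it by
  permuting rows and, after transposition, columns, which leaves the absolute value of the determinant
  unchanged.
\<close>

lemma minors_le_max_subdet:
  assumes "max_subdet B \<le> a" "B \<in> carrier_mat m n"
  shows "minors_le (\<lambda>i j. B $$ (i, j)) m n a"
  unfolding minors_le_def
proof (intro allI impI, elim conjE)
  fix k :: nat and \<rho> \<sigma> :: "nat \<Rightarrow> nat"
  assume k: "0 < k" and inj: "inj_on \<rho> {..<k}" "inj_on \<sigma> {..<k}"
    and rng: "\<rho> ` {..<k} \<subseteq> {..<m}" "\<sigma> ` {..<k} \<subseteq> {..<n}"
  define I J where "I = \<rho> ` {..<k}" and "J = \<sigma> ` {..<k}"
  have fin: "finite I" "finite J" by (auto simp: I_def J_def)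
  have card: "card I = k" "card J = k" using inj by (auto simp: I_def J_def card_image)
  have dims: "dim_row B = m" "dim_col B = n" using assms(2) by auto
  have rc: "{i. i < dim_row B \<and> i \<in> I} = I" "{j. j < dim_col B \<and> j \<in> J} = J"
    using rng dims by (auto simp: I_def J_def)
  have sub: "submatrix B I J = mat k k (\<lambda>(p, q). B $$ (pick I p, pick J q))"
    unfolding submatrix_def rc card by simp
  have bI: "bij_betw \<rho> {..<k} I" "bij_betw (pick I) {..<k} I"
    and bJ: "bij_betw \<sigma> {..<k} J" "bij_betw (pick J) {..<k} J"
    using inj pick_bij[OF fin(1)] pick_bij[OF fin(2)] card by (auto simp: bij_betw_def I_def J_def)
  have tr: "det (mat k k (\<lambda>(p, q). g p q)) = det (mat k k (\<lambda>(p, q). g q p))" for g :: "nat \<Rightarrow> nat \<Rightarrow> int"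
  proof -
    have "transpose_mat (mat k k (\<lambda>(p, q). g p q)) = mat k k (\<lambda>(p, q). g q p)"
      by (rule eq_matI) auto
    then show ?thesis using det_transpose[of "mat k k (\<lambda>(p, q). g p q)" k] by simp
  qed
  have "\<bar>det (mat k k (\<lambda>(p, q). B $$ (\<rho> p, \<sigma> q)))\<bar> = \<bar>det (mat k k (\<lambda>(p, q). B $$ (pick I p, \<sigma> q)))\<bar>"
    by (rule det_rows_reordered[OF bI, of "\<lambda>i q. B $$ (i, \<sigma> q)"])
  also have "\<dots> = \<bar>det (mat k k (\<lambda>(q, p). B $$ (pick I p, \<sigma> q)))\<bar>"
    by (subst tr[of "\<lambda>p q. B $$ (pick I p, \<sigma> q)"]) simp
  also have "\<dots> = \<bar>det (mat k k (\<lambda>(q, p). B $$ (pick I p, pick J q)))\<bar>"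
    by (rule det_rows_reordered[OF bJ, of "\<lambda>j p. B $$ (pick I p, j)"])
  also have "\<dots> = \<bar>det (submatrix B I J)\<bar>"
    unfolding sub by (subst tr[of "\<lambda>p q. B $$ (pick I p, pick J q)"]) simp
  also have "\<dots> \<le> max_subdet B" unfolding max_subdet_def
  proof (rule Max_ge)
    let ?S = "{\<bar>det (submatrix B I J)\<bar> | I J. I \<subseteq> {..<dim_row B} \<and> J \<subseteq> {..<dim_col B} \<and> card I = card J \<and> I \<noteq> {}}"
    have "?S \<subseteq> (\<lambda>(I, J). \<bar>det (submatrix B I J)\<bar>) ` (Pow {..<dim_row B} \<times> Pow {..<dim_col B})" by auto
    then show "finite ?S" by (rule finite_subset) simp
    show "\<bar>det (submatrix B I J)\<bar> \<in> ?S" using rng card k dims by (auto simp: I_def J_def intro!: exI)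
  qed
  also have "\<dots> \<le> a" by (rule assms(1))
  finally show "\<bar>det (mat k k (\<lambda>(p, q). B $$ (\<rho> p, \<sigma> q)))\<bar> \<le> a" .
qed

lemma minors_le_entry:
  assumes "minors_le A m n a" "i < m" "j < n" shows "\<bar>A i j\<bar> \<le> a"
proof -
  have "\<bar>det (mat 1 1 (\<lambda>(p, q). A i j))\<bar> \<le> a"
    using assms(1)[unfolded minors_le_def, rule_format, of 1 "\<lambda>_. i" "\<lambda>_. j"] assms(2,3)
    by (auto simp: inj_on_def)
  moreover have "det (mat 1 1 (\<lambda>(p, q). A i j)) = A i j" by (subst det_single) auto
  ultimately show ?thesis by simp
qed

lemma minors_le_mono: "minors_le A m n a \<Longrightarrow> a \<le> a' \<Longrightarrow> minors_le A m n a'"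
  unfolding minors_le_def by (meson order_trans)

section \<open>Optimization along a decomposition of the columns\<close>

text \<open>
  The algorithm works on lists. Entries beyond the end are zero, so that the empty list is the zero
  vector and every list is a vector in the sense of the previous sections.
\<close>

abbreviation nd :: "int list \<Rightarrow> nat \<Rightarrow> int" where
  "nd \<equiv> nth_default 0"

definition ent :: "int list list \<Rightarrow> nat \<Rightarrow> nat \<Rightarrow> int" where
  "ent A i j = nd (nth_default [] A i) j"

lemma nd_map_upt: "nd (map f [0..<n]) j = (if j < n then f j else 0)"
  by (simp add: nth_default_def)

definition dotl :: "int list \<Rightarrow> int list \<Rightarrow> int" where
  "dotl w x = (\<Sum>j\<leftarrow>[0..<length w]. nd w j * nd x j)"

lemma dotl_dot: "dotl w x = dot (length w) (nd w) (nd x)"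
  by (simp add: dotl_def dot_def interv_sum_list_conv_sum_set_nat atLeast0LessThan)

definition touch :: "int list list \<Rightarrow> nat \<Rightarrow> nat list \<Rightarrow> bool" where
  "touch A i K \<longleftrightarrow> (\<exists>j\<in>set K. ent A i j \<noteq> 0)"

text \<open>
  Connected components are found by merging, row by row, all blocks of columns in which the row has a
  nonzero entry. A row without such entries adds an empty block, to be dropped at the end.
\<close>

definition merge :: "int list list \<Rightarrow> nat list list \<Rightarrow> nat \<Rightarrow> nat list list" where
  "merge A P i = concat (filter (touch A i) P) # filter (\<lambda>K. \<not> touch A i K) P"

definition comps :: "int list list \<Rightarrow> nat list \<Rightarrow> nat list list" where
  "comps A C = filter (\<lambda>K. K \<noteq> []) (foldl (merge A) (map (\<lambda>j. [j]) C) [0..<length A])"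

definition adjc :: "int list list \<Rightarrow> nat \<Rightarrow> nat \<Rightarrow> bool" where
  "adjc A j k \<longleftrightarrow> (\<exists>i<length A. ent A i j \<noteq> 0 \<and> ent A i k \<noteq> 0)"

text \<open>
  This is connectedness, phrased as it is used: no decomposition into non-adjacent parts splits the
  set.
\<close>

definition inseparable :: "('v \<Rightarrow> 'v \<Rightarrow> bool) \<Rightarrow> 'v set \<Rightarrow> bool" where
  "inseparable adj K \<longleftrightarrow> (\<forall>C C'. K \<subseteq> C \<union> C' \<and> C \<inter> C' = {} \<and> (\<forall>i\<in>C. \<forall>j\<in>C'. \<not> adj i j) \<longrightarrow> K \<subseteq> C \<or> K \<subseteq> C')"

text \<open>
  A connected set stays on one side of every disjoint union, so its decomposition comes from one that
  begins with a root. That root may lie outside of \<open>K\<close>; then any element of \<open>K\<close> will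
  do.
\<close>

lemma tdp_inseparable:
  assumes "tdp adj X e" "K \<noteq> {}" "K \<subseteq> X" "inseparable adj K"
  shows "\<exists>d v. e = Suc d \<and> v \<in> K \<and> tdp adj (K - {v}) d"
  using assms
proof (induction rule: tdp.induct)
  case (tdp_union C d C')
  then have "K \<subseteq> C \<or> K \<subseteq> C'" unfolding inseparable_def by blast
  with tdp_union show ?case by blast
next
  case (tdp_insert C d v)
  show ?case
  proof (cases "v \<in> K")
    case True
    have "tdp adj (K - {v}) d" by (rule tdp_subset[OF tdp_insert.hyps]) (use tdp_insert.prems in blast)
    with True show ?thesis by blast
  next
    case False
    obtain v' where v': "v' \<in> K" using tdp_insert.prems by blast
    have "tdp adj (K - {v'}) d" by (rule tdp_subset[OF tdp_insert.hyps]) (use False tdp_insert.prems in blast)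
    with v' show ?thesis by blast
  qed
qed simp

lemma mset_concat_merge: "mset (concat (merge A P i)) = mset (concat P)"
  unfolding merge_def by (induction P) auto

lemma touch_concat: "touch A i (concat Ks) \<longleftrightarrow> (\<exists>K\<in>set Ks. touch A i K)"
  by (auto simp: touch_def)

text \<open>
  The blocks always partition the columns; they are connected, as blocks are merged only along a common
  row; and no row seen so far meets two of them.
\<close>

lemma merge_invariants:
  assumes "set is \<subseteq> {..<length A}" and P: "P = foldl (merge A) (map (\<lambda>j. [j]) C) is"
  shows "mset (concat P) = mset C"
    and "\<forall>K\<in>set P. inseparable (adjc A) (set K)"
    and "\<forall>i\<in>set is. \<forall>K\<in>set P. \<forall>K'\<in>set P. touch A i K \<and> touch A i K' \<longrightarrow> K = K'"
proof -
  have "mset (concat P) = mset C \<and> (\<forall>K\<in>set P. inseparable (adjc A) (set K)) \<and>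
    (\<forall>i\<in>set is. \<forall>K\<in>set P. \<forall>K'\<in>set P. touch A i K \<and> touch A i K' \<longrightarrow> K = K')"
    using assms
  proof (induction "is" arbitrary: P rule: rev_induct)
    case Nil
    then show ?case by (auto simp: inseparable_def)
  next
    case (snoc i "is")
    define Q where "Q = foldl (merge A) (map (\<lambda>j. [j]) C) is"
    have P: "P = merge A Q i" using snoc.prems by (simp add: Q_def)
    have Q: "mset (concat Q) = mset C" "\<And>K. K \<in> set Q \<Longrightarrow> inseparable (adjc A) (set K)"
      "\<And>i K K'. i \<in> set is \<Longrightarrow> K \<in> set Q \<Longrightarrow> K' \<in> set Q \<Longrightarrow> touch A i K \<Longrightarrow> touch A i K' \<Longrightarrow> K = K'"
      using snoc.IH[OF _ Q_def] snoc.prems(1) by auto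
    have i: "i < length A" using snoc.prems(1) by simp
    define K0 where "K0 = concat (filter (touch A i) Q)"
    have setP: "set P = insert K0 {K \<in> set Q. \<not> touch A i K}" by (auto simp: P merge_def K0_def)
    show ?case
    proof (intro conjI)
      show "mset (concat P) = mset C" using Q(1) by (simp add: P mset_concat_merge)
      have "inseparable (adjc A) (set K0)" unfolding inseparable_def
      proof (intro allI impI, elim conjE)
        fix X Y assume XY: "set K0 \<subseteq> X \<union> Y" "X \<inter> Y = {}" "\<forall>i\<in>X. \<forall>j\<in>Y. \<not> adjc A i j"
        have one: "set K \<subseteq> X \<or> set K \<subseteq> Y" if "K \<in> set Q" "touch A i K" for K
        proof -
          have "set K \<subseteq> X \<union> Y" using XY(1) that by (auto simp: K0_def)
          with Q(2)[OF that(1)] XY(2,3) show ?thesis unfolding inseparable_def by blast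
        qed
        show "set K0 \<subseteq> X \<or> set K0 \<subseteq> Y"
        proof (rule ccontr)
          assume no: "\<not> ?thesis"
          obtain K where K: "K \<in> set Q" "touch A i K" "\<not> set K \<subseteq> X" using no by (auto simp: K0_def)
          obtain K' where K': "K' \<in> set Q" "touch A i K'" "\<not> set K' \<subseteq> Y" using no by (auto simp: K0_def)
          have "set K \<subseteq> Y" "set K' \<subseteq> X" using one K K' by blast+
          moreover obtain j j' where "j \<in> set K" "ent A i j \<noteq> 0" "j' \<in> set K'" "ent A i j' \<noteq> 0"
            using K(2) K'(2) by (auto simp: touch_def)
          ultimately have "j' \<in> X" "j \<in> Y" "adjc A j' j" using i by (auto simp: adjc_def)
          with XY(3) show False by blast
        qed
      qed
      then show "\<forall>K\<in>set P. inseparable (adjc A) (set K)" using Q(2) by (auto simp: setP)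
      show "\<forall>i'\<in>set (is @ [i]). \<forall>K\<in>set P. \<forall>K'\<in>set P. touch A i' K \<and> touch A i' K' \<longrightarrow> K = K'"
      proof (intro ballI impI, elim conjE)
        fix i' K K' assume i': "i' \<in> set (is @ [i])" and K: "K \<in> set P" "K' \<in> set P" "touch A i' K" "touch A i' K'"
        have K0touch: "\<exists>L\<in>set Q. touch A i L \<and> touch A i' L" if "touch A i' K0"
          using that by (auto simp: K0_def touch_concat)
        show "K = K'"
        proof (cases "i' = i")
          case True
          then show ?thesis using K by (auto simp: setP)
        next
          case False
          then have i'': "i' \<in> set is" using i' by simp
          have mixed: False if m: "touch A i' K0" "L \<in> set Q" "\<not> touch A i L" "touch A i' L" for L
          proof -
            obtain L' where "L' \<in> set Q" "touch A i L'" "touch A i' L'" using K0touch[OF m(1)] by blast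
            then have "L' = L" using Q(3)[OF i''] m by blast
            with \<open>touch A i L'\<close> m(3) show False by simp
          qed
          from K setP have "K = K0 \<or> K \<in> set Q \<and> \<not> touch A i K" "K' = K0 \<or> K' \<in> set Q \<and> \<not> touch A i K'" by auto
          then show ?thesis using mixed Q(3)[OF i''] K(3,4) by blast
        qed
      qed
    qed
  qed
  then show "mset (concat P) = mset C" "\<forall>K\<in>set P. inseparable (adjc A) (set K)"
    "\<forall>i\<in>set is. \<forall>K\<in>set P. \<forall>K'\<in>set P. touch A i K \<and> touch A i K' \<longrightarrow> K = K'" by auto
qed

lemma comps_props:
  assumes "distinct C"
  shows "distinct (comps A C)" "K \<in> set (comps A C) \<Longrightarrow> K \<noteq> [] \<and> distinct K"
    and "(\<Union>K\<in>set (comps A C). set K) = set C"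
    and "K \<in> set (comps A C) \<Longrightarrow> K' \<in> set (comps A C) \<Longrightarrow> K \<noteq> K' \<Longrightarrow> set K \<inter> set K' = {}"
    and "K \<in> set (comps A C) \<Longrightarrow> inseparable (adjc A) (set K)"
    and "i < length A \<Longrightarrow> K \<in> set (comps A C) \<Longrightarrow> K' \<in> set (comps A C) \<Longrightarrow>
      touch A i K \<Longrightarrow> touch A i K' \<Longrightarrow> K = K'"
proof -
  define P where "P = foldl (merge A) (map (\<lambda>j. [j]) C) [0..<length A]"
  have "set [0..<length A] \<subseteq> {..<length A}" by auto
  note inv = merge_invariants[OF this P_def]
  have P: "mset (concat P) = mset C" "\<forall>K\<in>set P. inseparable (adjc A) (set K)"
    "\<forall>i\<in>set [0..<length A]. \<forall>K\<in>set P. \<forall>K'\<in>set P. touch A i K \<and> touch A i K' \<longrightarrow> K = K'"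
    using inv by auto
  have Ks: "comps A C = filter (\<lambda>K. K \<noteq> []) P" by (simp add: comps_def P_def)
  have "concat (comps A C) = concat P" unfolding Ks by (induction P) auto
  then have mset: "mset (concat (comps A C)) = mset C" using P(1) by simp
  then have dist: "distinct (concat (comps A C))" using assms by (metis mset_eq_imp_distinct_iff)
  have rem: "removeAll [] (comps A C) = comps A C" unfolding Ks by (simp add: filter_id_conv removeAll_id)
  show "distinct (comps A C)" using dist rem by (metis distinct_concat_iff)
  show "K \<in> set (comps A C) \<Longrightarrow> K \<noteq> [] \<and> distinct K"
    using dist by (auto simp: Ks distinct_concat_iff)
  show "(\<Union>K\<in>set (comps A C). set K) = set C" using mset by (metis set_concat set_mset_mset)
  show "K \<in> set (comps A C) \<Longrightarrow> K' \<in> set (comps A C) \<Longrightarrow> K \<noteq> K' \<Longrightarrow> set K \<inter> set K' = {}"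
    using dist by (simp add: distinct_concat_iff)
  show "K \<in> set (comps A C) \<Longrightarrow> inseparable (adjc A) (set K)" using P(2) by (simp add: Ks)
  show "i < length A \<Longrightarrow> K \<in> set (comps A C) \<Longrightarrow> K' \<in> set (comps A C) \<Longrightarrow>
      touch A i K \<Longrightarrow> touch A i K' \<Longrightarrow> K = K'" using P(3) by (auto simp: Ks)
qed

text \<open>
  All ways to fix one column \<open>v\<close> of a component \<open>K\<close> to an allowed value \<open>t\<close>, each completed by an
  answer for the other columns of \<open>K\<close>. The right-hand side \<open>r\<close> is restricted to the rows meeting \<open>K\<close>
  and reduced by the contribution of \<open>v\<close>.
\<close>

definition branch :: "(nat list \<Rightarrow> int list \<Rightarrow> int list list) \<Rightarrow> int list list \<Rightarrow> int list \<Rightarrow> int list \<Rightarrow>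
    int list \<Rightarrow> int list \<Rightarrow> int list \<Rightarrow> nat list \<Rightarrow> int list list" where
  "branch rec A lo hi w vals r K = concat (map (\<lambda>v. concat (map (\<lambda>t.
     map (\<lambda>x. map (\<lambda>j. if j = v then t else nd x j) [0..<length w])
       (rec (filter (\<lambda>j. j \<noteq> v) K)
         (map (\<lambda>i. (if touch A i K then nd r i else 0) - t * ent A i v) [0..<length A])))
     (filter (\<lambda>t. nd lo v \<le> t \<and> t \<le> nd hi v) vals))) K)"

text \<open>
  Solutions of the components live on disjoint columns and are added up. A row that meets no column has
  to have right-hand side zero.
\<close>

definition join :: "int list list \<Rightarrow> int list \<Rightarrow> nat list \<Rightarrow> int list \<Rightarrow> int list list list \<Rightarrow> int list list" where
  "join A w C r S = (if (\<exists>i\<in>set [0..<length A]. nd r i \<noteq> 0 \<and> \<not> touch A i C) \<or> (\<exists>s\<in>set S. s = []) then []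
     else [map (\<lambda>j. \<Sum>y\<leftarrow>concat S. nd y j) [0..<length w]])"

text \<open>
  \<open>solve d A lo hi w vals C r\<close> maximizes \<open>w\<close> over the vectors supported in \<open>C\<close> that have entries in
  \<open>vals\<close> and between \<open>lo\<close> and \<open>hi\<close>, and whose products with the rows of \<open>A\<close> are \<open>r\<close>. The recursion on
  the depth \<open>d\<close> finds a suitable root of each component by trying all of them. For fixed \<open>d\<close> the number
  of recursive calls is polynomial in the numbers of columns and of allowed values. The result is a
  list of at most one vector; it may be empty because there is no solution or because \<open>d\<close> is too
  small.
\<close>

primrec solve :: "nat \<Rightarrow> int list list \<Rightarrow> int list \<Rightarrow> int list \<Rightarrow> int list \<Rightarrow> int list \<Rightarrow>
    nat list \<Rightarrow> int list \<Rightarrow> int list list" where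
  "solve 0 A lo hi w vals C r =
     (if C = [] \<and> (\<forall>i\<in>set [0..<length A]. nd r i = 0) then [map (\<lambda>j. 0) [0..<length w]] else [])"
| "solve (Suc d) A lo hi w vals C r = join A w C r
     (map (\<lambda>K. argmax (dotl w) (branch (solve d A lo hi w vals) A lo hi w vals r K)) (comps A C))"

definition sol :: "int list list \<Rightarrow> int list \<Rightarrow> int list \<Rightarrow> nat \<Rightarrow> int list \<Rightarrow> nat set \<Rightarrow>
    (nat \<Rightarrow> int) \<Rightarrow> (nat \<Rightarrow> int) \<Rightarrow> bool" where
  "sol A lo hi n vals C r y \<longleftrightarrow> (\<forall>j. y j \<noteq> 0 \<longrightarrow> j \<in> C) \<and>
     (\<forall>j\<in>C. nd lo j \<le> y j \<and> y j \<le> nd hi j \<and> y j \<in> set vals) \<and>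
     (\<forall>i<length A. dot n (ent A i) y = r i)"

lemma join_nonempty:
  assumes "join A w C r (map S Ks) \<noteq> []"
  shows "K \<in> set Ks \<Longrightarrow> S K \<noteq> []" "i < length A \<Longrightarrow> \<not> touch A i C \<Longrightarrow> nd r i = 0"
proof -
  have no: "\<not> ((\<exists>i\<in>set [0..<length A]. nd r i \<noteq> 0 \<and> \<not> touch A i C) \<or> (\<exists>s\<in>set (map S Ks). s = []))"
  proof
    assume "(\<exists>i\<in>set [0..<length A]. nd r i \<noteq> 0 \<and> \<not> touch A i C) \<or> (\<exists>s\<in>set (map S Ks). s = [])"
    then have "join A w C r (map S Ks) = []" unfolding join_def by (rule if_P)
    with assms show False by blast
  qed
  show "S K \<noteq> []" if "K \<in> set Ks"
    using no that by (metis image_eqI list.set_map)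
  show "nd r i = 0" if "i < length A" "\<not> touch A i C" using no that by auto
qed

lemma argmax_length: "length (argmax f xs) \<le> 1"
  by (cases rule: argmax_cases[of xs f]) auto

lemma solve_length: "length (solve d A lo hi w vals C r) \<le> 1"
  by (cases d) (auto simp: join_def)

lemma argmax_eq_Nil: "argmax f xs = [] \<longleftrightarrow> xs = []"
  by (cases rule: argmax_cases[of xs f]) auto

lemma argmax_mem: "y \<in> set (argmax f xs) \<Longrightarrow> y \<in> set xs"
  by (cases rule: argmax_cases[of xs f]) auto

text \<open>
  A nonempty answer means that in every component some root was chosen and the rest was answered at
  depth \<open>d - 1\<close>. These choices are a decomposition of depth \<open>d\<close>.
\<close>

lemma solve_nonempty_tdp:
  assumes "solve d A lo hi w vals C r \<noteq> []" "distinct C"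
  shows "tdp (adjc A) (set C) d"
  using assms
proof (induction d arbitrary: C r)
  case 0
  then show ?case by (auto intro: tdp.tdp_empty split: if_splits)
next
  case (Suc d)
  note c = comps_props[OF Suc.prems(2), where A = A]
  have "tdp (adjc A) (set K) (Suc d)" if K: "K \<in> set (comps A C)" for K
  proof -
    have "argmax (dotl w) (branch (solve d A lo hi w vals) A lo hi w vals r K) \<noteq> []"
      using join_nonempty(1)[OF Suc.prems(1)[unfolded solve.simps] K] .
    then have "hd (branch (solve d A lo hi w vals) A lo hi w vals r K) \<in>
      set (branch (solve d A lo hi w vals) A lo hi w vals r K)" by (simp add: argmax_eq_Nil)
    then obtain x where "x \<in> set (branch (solve d A lo hi w vals) A lo hi w vals r K)" by blast
    then obtain v r' x' where v: "v \<in> set K" and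
      "x' \<in> set (solve d A lo hi w vals (filter (\<lambda>j. j \<noteq> v) K) r')"
      unfolding branch_def by auto
    then have ne: "solve d A lo hi w vals (filter (\<lambda>j. j \<noteq> v) K) r' \<noteq> []" by auto
    have "tdp (adjc A) (set (filter (\<lambda>j. j \<noteq> v) K)) d"
      by (rule Suc.IH[OF ne]) (use c(2)[OF K] in simp)
    then have "tdp (adjc A) (insert v (set (filter (\<lambda>j. j \<noteq> v) K))) (Suc d)" by (rule tdp.tdp_insert)
    moreover have "insert v (set (filter (\<lambda>j. j \<noteq> v) K)) = set K" using v by auto
    ultimately show ?thesis by simp
  qed
  then have "tdp (adjc A) (\<Union>K\<in>set (comps A C). set K) (Suc d)"
  proof (intro tdp_Union)
    fix K K' x y assume K: "K \<in> set (comps A C)" "K' \<in> set (comps A C)" "K \<noteq> K'" "x \<in> set K" "y \<in> set K'"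
    show "\<not> adjc A x y"
    proof
      assume "adjc A x y"
      then obtain i where "i < length A" "ent A i x \<noteq> 0" "ent A i y \<noteq> 0" by (auto simp: adjc_def)
      then have "touch A i K" "touch A i K'" using K by (auto simp: touch_def)
      with c(6) K \<open>i < length A\<close> show False by blast
    qed
  qed (use c(4) in auto)
  then show ?case using c(3) by simp
qed

lemma dot_update:
  assumes "v < n" "x v = 0"
  shows "dot n w (\<lambda>j. if j = v then t else x j) = dot n w x + w v * t"
proof -
  have "dot n w (\<lambda>j. if j = v then t else x j) = dot n w (\<lambda>j. x j + (if j = v then t else 0))"
    unfolding dot_def using assms(2) by (intro sum.cong) auto
  also have "\<dots> = dot n w x + dot n w (\<lambda>j. if j = v then t else 0)" by (rule dot_add)
  also have "dot n w (\<lambda>j. if j = v then t else 0) = (\<Sum>j<n. if j = v then w v * t else 0)"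
    unfolding dot_def by (rule sum.cong) auto
  also have "\<dots> = w v * t" using assms(1) by simp
  finally show ?thesis .
qed

lemma dot_cong: "(\<And>j. j < n \<Longrightarrow> w j * x j = w j * y j) \<Longrightarrow> dot n w x = dot n w y"
  unfolding dot_def by (rule sum.cong) auto

lemma untouched: "\<not> touch A i K \<Longrightarrow> (\<And>j. y j \<noteq> 0 \<Longrightarrow> j \<in> set K) \<Longrightarrow> dot n (ent A i) y = 0"
  unfolding dot_def touch_def by (rule sum.neutral) (metis mult_eq_0_iff)

text \<open>
  A row meeting component \<open>K\<close> meets no other one, so \<open>K\<close> alone has to provide its right-hand
  side.
\<close>

definition rhs :: "int list list \<Rightarrow> (nat \<Rightarrow> int) \<Rightarrow> nat list \<Rightarrow> nat \<Rightarrow> int" where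
  "rhs A r K i = (if touch A i K then r i else 0)"

lemma sol_restrict:
  assumes s: "sol A lo hi n vals (set C) r y" and C: "distinct C" and K: "K \<in> set (comps A C)"
  shows "sol A lo hi n vals (set K) (rhs A r K) (\<lambda>j. if j \<in> set K then y j else 0)"
proof -
  note c = comps_props[OF C, where A = A]
  have KC: "set K \<subseteq> set C" using c(3) K by blast
  have "dot n (ent A i) (\<lambda>j. if j \<in> set K then y j else 0) = rhs A r K i" if i: "i < length A" for i
  proof (cases "touch A i K")
    case True
    have "ent A i j * (if j \<in> set K then y j else 0) = ent A i j * y j" for j
    proof (cases "j \<in> set K \<or> y j = 0 \<or> ent A i j = 0")
      case False
      then have "j \<in> set C" using s by (auto simp: sol_def)
      then obtain K' where K': "K' \<in> set (comps A C)" "j \<in> set K'" using c(3) by blast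
      then have "touch A i K'" using False by (auto simp: touch_def)
      then have "K' = K" using c(6)[OF i K'(1) K] True by blast
      with K'(2) False show ?thesis by blast
    qed auto
    then have "dot n (ent A i) (\<lambda>j. if j \<in> set K then y j else 0) = dot n (ent A i) y" by (rule dot_cong)
    then show ?thesis using True s i by (simp add: sol_def rhs_def)
  next
    case False
    have "dot n (ent A i) (\<lambda>j. if j \<in> set K then y j else 0) = 0"
      by (rule untouched[OF False]) (simp split: if_splits)
    then show ?thesis using False by (simp add: rhs_def)
  qed
  with s KC show ?thesis by (auto simp: sol_def)
qed

text \<open>
  Stated for an arbitrary function \<open>rec\<close> that answers soundly, for use in the induction step for
  \<open>solve\<close>.
\<close>

lemma branch_sound:
  assumes IH: "\<And>C r x. distinct C \<Longrightarrow> set C \<subseteq> {..<length w} \<Longrightarrow> x \<in> set (rec C r) \<Longrightarrow>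
      sol A lo hi (length w) vals (set C) (nd r) (nd x)"
    and x: "x \<in> set (branch rec A lo hi w vals r K)" and K: "distinct K" "set K \<subseteq> {..<length w}"
  shows "sol A lo hi (length w) vals (set K) (rhs A (nd r) K) (nd x) \<and> length x = length w"
proof -
  let ?n = "length w"
  from x obtain v t x' where v: "v \<in> set K" and t: "t \<in> set vals" "nd lo v \<le> t" "t \<le> nd hi v"
    and x': "x' \<in> set (rec (filter (\<lambda>j. j \<noteq> v) K)
         (map (\<lambda>i. (if touch A i K then nd r i else 0) - t * ent A i v) [0..<length A]))"
    and x: "x = map (\<lambda>j. if j = v then t else nd x' j) [0..<?n]"
    unfolding branch_def by auto
  have s: "sol A lo hi ?n vals (set (filter (\<lambda>j. j \<noteq> v) K))
    (nd (map (\<lambda>i. (if touch A i K then nd r i else 0) - t * ent A i v) [0..<length A])) (nd x')"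
    by (rule IH[OF _ _ x']) (use K in auto)
  have vn: "v < ?n" using v K by auto
  have out: "nd x' j = 0" if "\<not> j < ?n" for j
  proof (rule ccontr)
    assume "nd x' j \<noteq> 0"
    then have "j \<in> set (filter (\<lambda>j. j \<noteq> v) K)" using s unfolding sol_def by blast
    with K(2) that show False by auto
  qed
  have ndx: "nd x = (\<lambda>j. if j = v then t else nd x' j)"
    unfolding x nd_map_upt using vn out by (intro ext) auto
  have x'v: "nd x' v = 0"
  proof (rule ccontr)
    assume "nd x' v \<noteq> 0"
    then have "v \<in> set (filter (\<lambda>j. j \<noteq> v) K)" using s unfolding sol_def by blast
    then show False by simp
  qed
  have "dot ?n (ent A i) (nd x) = rhs A (nd r) K i" if i: "i < length A" for i
  proof -
    have "dot ?n (ent A i) (nd x') = (if touch A i K then nd r i else 0) - t * ent A i v"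
      using s i by (simp add: sol_def nd_map_upt)
    then show ?thesis unfolding ndx dot_update[of v ?n, OF vn, of "nd x'", OF x'v] by (simp add: rhs_def)
  qed
  moreover have "\<forall>j. nd x j \<noteq> 0 \<longrightarrow> j \<in> set K" using s v unfolding ndx sol_def by auto
  moreover have "\<forall>j\<in>set K. nd lo j \<le> nd x j \<and> nd x j \<le> nd hi j \<and> nd x j \<in> set vals"
    using s t unfolding ndx sol_def by auto
  ultimately show ?thesis using x by (simp add: sol_def)
qed

lemma concat_singletons:
  "(\<And>K. K \<in> set Ks \<Longrightarrow> f K = [y K]) \<Longrightarrow> concat (map f Ks) = map y Ks"
  by (induction Ks) auto

text \<open>
  The supports of the parts are disjoint, so entries and objective values add up. For each row, at most
  one component contributes to the right-hand side.
\<close>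

lemma join_sol:
  assumes C: "distinct C" "set C \<subseteq> {..<length w}"
    and y: "\<And>K. K \<in> set (comps A C) \<Longrightarrow> S K = [y K] \<and> sol A lo hi (length w) vals (set K) (rhs A (nd r) K) (nd (y K))"
    and r: "\<And>i. i < length A \<Longrightarrow> \<not> touch A i C \<Longrightarrow> nd r i = 0"
  obtains x where "join A w C r (map S (comps A C)) = [x]" "length x = length w"
    "sol A lo hi (length w) vals (set C) (nd r) (nd x)"
    "dot (length w) (nd w) (nd x) = (\<Sum>K\<in>set (comps A C). dot (length w) (nd w) (nd (y K)))"
proof -
  let ?n = "length w" and ?Ks = "comps A C"
  note c = comps_props[OF C(1), where A = A]
  define x where "x = map (\<lambda>j. \<Sum>z\<leftarrow>concat (map S ?Ks). nd z j) [0..<?n]"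
  have x_eq: "concat (map S ?Ks) = map y ?Ks" using y by (intro concat_singletons) blast
  have sup: "j \<in> set K" if "K \<in> set ?Ks" "nd (y K) j \<noteq> 0" for K j
    using y[OF that(1)] that(2) by (auto simp: sol_def)
  have KC: "set K \<subseteq> set C" if "K \<in> set ?Ks" for K using c(3) that by blast
  have ndx: "nd x = (\<lambda>j. \<Sum>K\<leftarrow>?Ks. nd (y K) j)"
  proof
    fix j
    show "nd x j = (\<Sum>K\<leftarrow>?Ks. nd (y K) j)"
    proof (cases "j < ?n")
      case True
      then show ?thesis unfolding x_def nd_map_upt x_eq by (simp add: comp_def)
    next
      case False
      then have "nd (y K) j = 0" if "K \<in> set ?Ks" for K using sup[OF that] KC[OF that] C(2) by blast
      then have "map (\<lambda>K. nd (y K) j) ?Ks = map (\<lambda>_. 0) ?Ks" by (intro map_cong) auto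
      then have "(\<Sum>K\<leftarrow>?Ks. nd (y K) j) = 0" by (simp only: sum_list_0)
      then show ?thesis using False unfolding x_def nd_map_upt by simp
    qed
  qed
  then have ndx': "nd x j = (\<Sum>K\<in>set ?Ks. nd (y K) j)" for j
    using c(1) by (simp add: sum_list_distinct_conv_sum_set)
  have dotx: "dot ?n f (nd x) = (\<Sum>K\<in>set ?Ks. dot ?n f (nd (y K)))" for f
    unfolding ndx dot_sum_list using c(1) by (simp add: sum_list_distinct_conv_sum_set)
  have at: "nd x j = nd (y K) j" if "K \<in> set ?Ks" "j \<in> set K" for K j
  proof -
    have "nd (y K') j = 0" if "K' \<in> set ?Ks - {K}" for K'
      using sup[of K' j] c(4)[of K K'] that \<open>K \<in> set ?Ks\<close> \<open>j \<in> set K\<close> by blast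
    then have "(\<Sum>K\<in>set ?Ks. nd (y K) j) = nd (y K) j"
      using that(1) by (simp add: sum.remove)
    then show ?thesis by (simp add: ndx')
  qed
  have "sol A lo hi ?n vals (set C) (nd r) (nd x)" unfolding sol_def
  proof (intro conjI allI impI ballI)
    fix j assume "nd x j \<noteq> 0"
    then obtain K where "K \<in> set ?Ks" "nd (y K) j \<noteq> 0" unfolding ndx' by (meson sum.neutral)
    then show "j \<in> set C" using sup KC by blast
  next
    fix j assume "j \<in> set C"
    then obtain K where K: "K \<in> set ?Ks" "j \<in> set K" using c(3) by blast
    then show "nd lo j \<le> nd x j" "nd x j \<le> nd hi j" "nd x j \<in> set vals"
      using y[OF K(1)] by (auto simp: sol_def at[OF K])
  next
    fix i assume i: "i < length A"
    have "dot ?n (ent A i) (nd x) = (\<Sum>K\<in>set ?Ks. rhs A (nd r) K i)"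
      unfolding dotx using y i by (intro sum.cong) (auto simp: sol_def)
    also have "\<dots> = nd r i"
    proof (cases "touch A i C")
      case True
      then obtain K where K: "K \<in> set ?Ks" "touch A i K" using c(3) by (auto simp: touch_def)
      then have "rhs A (nd r) K' i = 0" if "K' \<in> set ?Ks - {K}" for K'
        using c(6)[OF i K(1), of K'] that by (auto simp: rhs_def)
      then show ?thesis using K by (simp add: sum.remove[of _ K] rhs_def)
    next
      case False
      then have "rhs A (nd r) K i = 0" if "K \<in> set ?Ks" for K
        using KC[OF that] by (auto simp: rhs_def touch_def)
      then show ?thesis using r[OF i False] by simp
    qed
    finally show "dot ?n (ent A i) (nd x) = nd r i" .
  qed
  moreover have "join A w C r (map S ?Ks) = [x]"
  proof -
    have "\<not> (\<exists>s\<in>set (map S ?Ks). s = [])" using y by auto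
    moreover have "\<not> (\<exists>i\<in>set [0..<length A]. nd r i \<noteq> 0 \<and> \<not> touch A i C)" using r by auto
    ultimately show ?thesis unfolding join_def x_def by simp
  qed
  moreover have "length x = ?n" by (simp add: x_def)
  ultimately show thesis using that dotx by blast
qed

lemma solve_sound:
  assumes "distinct C" "set C \<subseteq> {..<length w}" "x \<in> set (solve d A lo hi w vals C r)"
  shows "sol A lo hi (length w) vals (set C) (nd r) (nd x) \<and> length x = length w"
  using assms
proof (induction d arbitrary: C r x)
  case 0
  then have "C = []" "\<forall>i<length A. nd r i = 0" "x = map (\<lambda>j. 0) [0..<length w]" by (auto split: if_splits)
  moreover have "nd (map (\<lambda>j. 0) [0..<length w]) = (\<lambda>j. 0)" by (rule ext) (simp add: nd_map_upt)
  ultimately show ?case by (simp add: sol_def dot_zero)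
next
  case (Suc d)
  let ?S = "\<lambda>K. argmax (dotl w) (branch (solve d A lo hi w vals) A lo hi w vals r K)"
  note c = comps_props[OF Suc.prems(1), where A = A]
  have x: "x \<in> set (join A w C r (map ?S (comps A C)))" using Suc.prems(3) by simp
  then have "join A w C r (map ?S (comps A C)) \<noteq> []" by (metis list.set_cases list.distinct(1))
  note ne = join_nonempty(1)[OF this] and r = join_nonempty(2)[OF this]
  have S: "?S K = [hd (?S K)] \<and> sol A lo hi (length w) vals (set K) (rhs A (nd r) K) (nd (hd (?S K)))"
    if K: "K \<in> set (comps A C)" for K
  proof -
    have 1: "?S K = [hd (?S K)]" using ne[OF K] argmax_length[of "dotl w" "branch (solve d A lo hi w vals) A lo hi w vals r K"]
      by (cases "?S K") auto
    have "hd (?S K) \<in> set (?S K)" using ne[OF K] by simp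
    then have "hd (?S K) \<in> set (branch (solve d A lo hi w vals) A lo hi w vals r K)" by (rule argmax_mem)
    then have "sol A lo hi (length w) vals (set K) (rhs A (nd r) K) (nd (hd (?S K)))"
      using branch_sound[of w "solve d A lo hi w vals" A lo hi vals "hd (?S K)" r K] Suc.IH c(2)[OF K] c(3) K Suc.prems(2)
      by blast
    with 1 show ?thesis by blast
  qed
  obtain x' where "join A w C r (map ?S (comps A C)) = [x']" "length x' = length w"
    "sol A lo hi (length w) vals (set C) (nd r) (nd x')"
    using join_sol[OF Suc.prems(1,2) S r] by blast
  with x show ?case by simp
qed

text \<open>
  The competitor \<open>y\<close> is split along the components. In each of them, a root \<open>v\<close> of the decomposition
  together with the value \<open>y v\<close> is among the branches, and the induction hypothesis applies to the
  remaining columns.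
\<close>

lemma solve_complete:
  assumes "tdp (adjc A) (set C) d" "distinct C" "set C \<subseteq> {..<length w}"
    and "sol A lo hi (length w) vals (set C) (nd r) y"
  shows "\<exists>x\<in>set (solve d A lo hi w vals C r). dot (length w) (nd w) y \<le> dot (length w) (nd w) (nd x)"
  using assms
proof (induction d arbitrary: C r y rule: nat_induct)
  case 0
  have C: "C = []"
  proof (rule ccontr)
    assume "C \<noteq> []"
    obtain v where v: "v \<in> set C" using \<open>C \<noteq> []\<close> by (cases C) auto
    have "tdp (adjc A) {v} 0" by (rule tdp_subset[OF 0(1)]) (use v in simp)
    moreover have "inseparable (adjc A) {v}" by (auto simp: inseparable_def)
    ultimately show False using tdp_inseparable[of "adjc A" "{v}" 0 "{v}"] by blast
  qed
  have y0: "y = (\<lambda>j. 0)" using 0(4) C by (auto simp: sol_def)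
  have "nd r i = 0" if "i < length A" for i using 0(4) that by (simp add: sol_def y0 dot_zero)
  moreover have "nd (map (\<lambda>j. 0) [0..<length w]) = (\<lambda>j. 0)" by (rule ext) (simp add: nd_map_upt)
  ultimately show ?case using C by (simp add: y0)
next
  case (Suc d)
  let ?n = "length w"
  let ?B = "\<lambda>K. branch (solve d A lo hi w vals) A lo hi w vals r K"
  let ?S = "\<lambda>K. argmax (dotl w) (?B K)"
  let ?y = "\<lambda>K j. if j \<in> set K then y j else 0"
  note c = comps_props[OF Suc.prems(2), where A = A]
  have best: "\<exists>x. ?S K = [x] \<and> sol A lo hi ?n vals (set K) (rhs A (nd r) K) (nd x) \<and>
      dot ?n (nd w) (?y K) \<le> dot ?n (nd w) (nd x)" if K: "K \<in> set (comps A C)" for K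
  proof -
    have KC: "set K \<subseteq> set C" using c(3) K by blast
    have sK: "sol A lo hi ?n vals (set K) (rhs A (nd r) K) (?y K)" by (rule sol_restrict[OF Suc.prems(4,2) K])
    obtain v where v: "v \<in> set K" "tdp (adjc A) (set K - {v}) d"
      using tdp_inseparable[OF Suc.prems(1) _ KC c(5)[OF K]] c(2)[OF K] by auto
    let ?K = "filter (\<lambda>j. j \<noteq> v) K" and ?t = "y v"
    let ?r = "map (\<lambda>i. (if touch A i K then nd r i else 0) - ?t * ent A i v) [0..<length A]"
    let ?z = "\<lambda>j. if j \<in> set ?K then y j else 0"
    have vn: "v < ?n" using v(1) KC Suc.prems(3) by auto
    have yz: "?y K = (\<lambda>j. if j = v then ?t else ?z j)" using v(1) by auto
    have "sol A lo hi ?n vals (set ?K) (nd ?r) ?z" unfolding sol_def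
    proof (intro conjI allI impI ballI)
      fix j assume "j \<in> set ?K"
      then show "nd lo j \<le> ?z j" "?z j \<le> nd hi j" "?z j \<in> set vals"
        using sK by (auto simp: sol_def)
    next
      fix i assume i: "i < length A"
      have "dot ?n (ent A i) (?y K) = rhs A (nd r) K i" using sK i by (simp add: sol_def)
      moreover have "dot ?n (ent A i) (?y K) = dot ?n (ent A i) ?z + ent A i v * ?t"
        unfolding yz by (rule dot_update[OF vn]) simp
      ultimately show "dot ?n (ent A i) ?z = nd ?r i" using i
        by (cases "touch A i K") (simp_all add: nd_map_upt rhs_def mult.commute)
    qed (simp split: if_splits)
    moreover have "tdp (adjc A) (set ?K) d" using v(2) by (simp add: set_diff_eq Int_def set_filter[symmetric] conj_commute Diff_eq)
    ultimately obtain x' where x': "x' \<in> set (solve d A lo hi w vals ?K ?r)"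
      "dot ?n (nd w) ?z \<le> dot ?n (nd w) (nd x')"
      using Suc.IH[of ?K ?r ?z] c(2)[OF K] KC Suc.prems(3) by auto
    have s': "sol A lo hi ?n vals (set ?K) (nd ?r) (nd x')" "length x' = ?n"
      using solve_sound[OF _ _ x'(1)] c(2)[OF K] KC Suc.prems(3) by auto
    let ?x = "map (\<lambda>j. if j = v then ?t else nd x' j) [0..<?n]"
    have x'v: "nd x' v = 0"
    proof (rule ccontr)
      assume "nd x' v \<noteq> 0"
      then have "v \<in> set ?K" using s'(1) unfolding sol_def by blast
      then show False by simp
    qed
    have t: "?t \<in> set vals" "nd lo v \<le> ?t" "?t \<le> nd hi v" using sK v(1) by (auto simp: sol_def)
    then have xB: "?x \<in> set (?B K)" unfolding branch_def using v(1) x'(1) by auto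
    have ndx: "nd ?x = (\<lambda>j. if j = v then ?t else nd x' j)"
      unfolding nd_map_upt using vn s'(2) by (intro ext) (auto simp: nth_default_def)
    have le: "dot ?n (nd w) (?y K) \<le> dotl w ?x"
    proof -
      have "dot ?n (nd w) (?y K) = dot ?n (nd w) ?z + nd w v * ?t"
        unfolding yz by (rule dot_update[OF vn]) simp
      also have "\<dots> \<le> dot ?n (nd w) (nd x') + nd w v * ?t" using x'(2) by simp
      also have "\<dots> = dotl w ?x" unfolding dotl_dot ndx by (rule dot_update[of v ?n "nd x'", OF vn x'v, symmetric])
      finally show ?thesis .
    qed
    show ?thesis
    proof (cases rule: argmax_cases[of "?B K" "dotl w"])
      case 1
      with xB show ?thesis by simp
    next
      case (2 x)
      have "sol A lo hi ?n vals (set K) (rhs A (nd r) K) (nd x)"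
        using branch_sound[of w "solve d A lo hi w vals" A lo hi vals x r K] solve_sound 2(2) c(2)[OF K] KC Suc.prems(3)
        by blast
      moreover have "dot ?n (nd w) (?y K) \<le> dot ?n (nd w) (nd x)"
        using le 2(3)[OF xB] by (simp add: dotl_dot)
      ultimately show ?thesis using 2(1) by blast
    qed
  qed
  then have "\<forall>K\<in>set (comps A C). \<exists>x. ?S K = [x] \<and>
      sol A lo hi ?n vals (set K) (rhs A (nd r) K) (nd x) \<and>
      dot ?n (nd w) (?y K) \<le> dot ?n (nd w) (nd x)" by (rule ballI)
  from bchoice[OF this] obtain f where f: "\<And>K. K \<in> set (comps A C) \<Longrightarrow> ?S K = [f K] \<and>
      sol A lo hi ?n vals (set K) (rhs A (nd r) K) (nd (f K)) \<and>
      dot ?n (nd w) (?y K) \<le> dot ?n (nd w) (nd (f K))" by blast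
  have r0: "nd r i = 0" if "i < length A" "\<not> touch A i C" for i
  proof -
    have "dot ?n (ent A i) y = 0" by (rule untouched[OF that(2)]) (use Suc.prems(4) in \<open>auto simp: sol_def\<close>)
    then show ?thesis using Suc.prems(4) that(1) by (simp add: sol_def)
  qed
  obtain x where x: "join A w C r (map ?S (comps A C)) = [x]"
    "dot ?n (nd w) (nd x) = (\<Sum>K\<in>set (comps A C). dot ?n (nd w) (nd (f K)))"
    using join_sol[OF Suc.prems(2,3), of A ?S f lo hi vals r] f r0 by blast
  have "y = (\<lambda>j. \<Sum>K\<leftarrow>comps A C. ?y K j)"
  proof
    fix j
    have "(\<Sum>K\<leftarrow>comps A C. ?y K j) = (\<Sum>K\<in>set (comps A C). ?y K j)"
      using c(1) by (simp add: sum_list_distinct_conv_sum_set)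
    also have "\<dots> = y j"
    proof (cases "y j = 0")
      case True
      show ?thesis unfolding True if_cancel by (rule sum.neutral_const)
    next
      case False
      then have "j \<in> set C" using Suc.prems(4) by (auto simp: sol_def)
      then obtain K where K: "K \<in> set (comps A C)" "j \<in> set K" using c(3) by blast
      have "?y K' j = 0" if "K' \<in> set (comps A C) - {K}" for K' using c(4)[of K K'] K that by auto
      then have "(\<Sum>K'\<in>set (comps A C) - {K}. ?y K' j) = 0" by (intro sum.neutral) blast
      then show ?thesis using K by (subst sum.remove[of _ K]) auto
    qed
    finally show "y j = (\<Sum>K\<leftarrow>comps A C. ?y K j)" by (rule sym)
  qed
  then have "dot ?n (nd w) y = dot ?n (nd w) (\<lambda>j. \<Sum>K\<leftarrow>comps A C. ?y K j)"
    by (rule arg_cong[where f = "dot ?n (nd w)"])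
  also have "\<dots> = (\<Sum>K\<in>set (comps A C). dot ?n (nd w) (?y K))"
    unfolding dot_sum_list by (rule sum_list_distinct_conv_sum_set[OF c(1)])
  also have "\<dots> \<le> dot ?n (nd w) (nd x)" unfolding x(2) using f by (intro sum_mono) blast
  finally show ?case using x(1) by simp
qed

text \<open>
  Depth need not be assumed for an optimum that was found: it follows from the existence of the
  answer.
\<close>

lemma solve_optimal:
  assumes "solve d A lo hi w vals C r = [x]" "distinct C" "set C \<subseteq> {..<length w}"
    and "sol A lo hi (length w) vals (set C) (nd r) y"
  shows "dot (length w) (nd w) y \<le> dot (length w) (nd w) (nd x)"
  using solve_complete[OF solve_nonempty_tdp[of d A lo hi w vals C r, OF _ assms(2)] assms(2-4)] assms(1)
  by simp

section \<open>The augmentation algorithm on lists of integers\<close>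

text \<open>
  Lists are used as unary numbers: \<open>pad k w\<close> has length \<open>k \<cdot> length w\<close>. Ranges and numbers of
  iterations are polynomial if they come from such lists.
\<close>

definition pad :: "nat \<Rightarrow> int list \<Rightarrow> int list" where
  "pad k w = concat (map (\<lambda>_. replicate k 0) w)"

text \<open>
  The integers of absolute value at most \<open>k \<cdot> length w\<close>; the additional list element makes the bound
  inclusive.
\<close>

definition range_vals :: "nat \<Rightarrow> int list \<Rightarrow> int list" where
  "range_vals k w = map int [0..<length (0 # pad k w)] @ map (\<lambda>i. - int i) [0..<length (0 # pad k w)]"

text \<open>
  Searches for a nonzero vector conformal to \<open>g\<close> that is as short as possible. On vectors conformal to
  \<open>g\<close>, the objective \<open>- sgn (g k)\<close> is minus the \<open>l1\<close>-norm. Zero has to be excluded by linear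
  constraints, so the box forces the entry at \<open>j\<close> to have the sign of that of \<open>g\<close>.
\<close>

definition below :: "nat \<Rightarrow> int list list \<Rightarrow> int list \<Rightarrow> int list \<Rightarrow> nat \<Rightarrow> int list list" where
  "below d A vals g j = solve d A
     (map (\<lambda>k. if k = j \<and> 0 < nd g k then 1 else if nd g k < 0 then nd g k else 0) [0..<length g])
     (map (\<lambda>k. if k = j \<and> nd g k < 0 then -1 else if 0 < nd g k then nd g k else 0) [0..<length g])
     (map (\<lambda>k. - sgn (nd g k)) [0..<length g]) vals [0..<length g] []"

definition remainder :: "int list \<Rightarrow> int list list \<Rightarrow> int list" where
  "remainder g fs = map (\<lambda>j. nd g j - (\<Sum>f\<leftarrow>fs. nd f j)) [0..<length g]"

text \<open>
  Splits one Graver element off what is left of \<open>g\<close>, at its first nonzero coordinate. The test on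
  absolute values always succeeds when \<open>g\<close> is a kernel vector of bounded entries; it makes the growth
  of \<open>fs\<close> bounded for arbitrary arguments.
\<close>

definition peel :: "nat \<Rightarrow> int list list \<Rightarrow> int list \<Rightarrow> int list \<Rightarrow> int list list \<Rightarrow> int list list" where
  "peel d A vals g fs = (case filter (\<lambda>j. nd (remainder g fs) j \<noteq> 0) [0..<length g] of [] \<Rightarrow> fs
     | j # js \<Rightarrow> (case below d A vals (remainder g fs) j of [] \<Rightarrow> fs
        | f # _ \<Rightarrow> if \<forall>k\<in>set [0..<length g]. \<bar>nd f k\<bar> \<le> \<bar>nd g k\<bar>
             then map (nd f) [0..<length g] # fs else fs))"

text \<open>
  If \<open>n\<close> is the length of \<open>g\<close> and its entries are at most \<open>n k\<close>, then its \<open>l1\<close>-norm is at most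
  \<open>n \<cdot> n k\<close>, the number of iterations.
\<close>

definition pieces :: "nat \<Rightarrow> nat \<Rightarrow> int list list \<Rightarrow> int list \<Rightarrow> int list list" where
  "pieces d k A g = foldl (\<lambda>fs _. peel d A (range_vals k g) g fs) [] (concat (map (\<lambda>_. pad k g) g))"

text \<open>
  Halving \<open>M\<close> until it vanishes gives both a list of scales that approximate every number up to \<open>M\<close>
  within a factor \<open>3\<close> (\<open>halves_approx\<close>) and a unary logarithm of \<open>M\<close> (\<open>halves_length\<close>).
\<close>

function halves :: "int \<Rightarrow> int list" where
  "halves M = (if M \<le> 0 then [] else M # halves (M div 2))"
  by auto
termination by (relation "measure nat") auto

declare halves.simps [simp del]

text \<open>
  An upper bound for the difference of the objective \<open>w\<close> between two points of the box from \<open>l\<close> to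
  \<open>u\<close>. With weights \<open>1\<close> it bounds the length of a step.
\<close>

definition spread :: "int list \<Rightarrow> int list \<Rightarrow> int list \<Rightarrow> int" where
  "spread w l u = (\<Sum>j\<leftarrow>[0..<length w]. \<bar>nd w j\<bar> * \<bar>nd u j - nd l j\<bar>)"

text \<open>
  For each scale \<open>\<mu>\<close>, the box contains the \<open>h\<close> for which \<open>x + \<mu> h\<close> lies between \<open>l\<close> and \<open>u\<close>: the
  upper bound is \<open>(u - x) / \<mu>\<close> rounded down, and the lower bound \<open>- (x - l) / \<mu>\<close> rounded up.
\<close>

definition primal_dirs :: "nat \<Rightarrow> nat \<Rightarrow> int list list \<Rightarrow> int list \<Rightarrow> int list \<Rightarrow> int list \<Rightarrow> int list \<Rightarrow> int list list" where
  "primal_dirs d k A l u w x = concat (map (\<lambda>\<mu>. concat (map (pieces d k A)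
     (solve d A (map (\<lambda>j. - ((nd x j - nd l j) div \<mu>)) [0..<length w])
        (map (\<lambda>j. (nd u j - nd x j) div \<mu>) [0..<length w]) w (range_vals k w) [0..<length w] [])))
     (halves (spread (map (\<lambda>_. 1) w) l u)))"

definition bump :: "int list \<Rightarrow> nat \<Rightarrow> int \<Rightarrow> int list" where
  "bump v j t = map (\<lambda>k. if k = j then nd v k + t else nd v k) [0..<length v]"

text \<open>
  All vectors of \<open>l1\<close>-norm at most \<open>K\<close>, with repetitions; for fixed \<open>K\<close> their number is polynomial in
  the dimension. The list \<open>w\<close> only provides the dimension.
\<close>

primrec short_vecs :: "nat \<Rightarrow> int list \<Rightarrow> int list list" where
  "short_vecs 0 w = [map (\<lambda>j. 0) [0..<length w]]"
| "short_vecs (Suc K) w = short_vecs K w @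
     concat (map (\<lambda>v. concat (map (\<lambda>j. [bump v j 1, bump v j (- 1)]) [0..<length w])) (short_vecs K w))"

definition short_kern :: "nat \<Rightarrow> int list list \<Rightarrow> int list \<Rightarrow> int list list" where
  "short_kern K A w = filter (\<lambda>v.
     (\<forall>i\<in>set [0..<length A]. (\<Sum>j\<leftarrow>[0..<length w]. ent A i j * nd v j) = 0) \<and>
     (\<exists>j\<in>set [0..<length w]. nd v j \<noteq> 0)) (short_vecs K w)"

text \<open>
  A short kernel vector is a Graver element if no \<^emph>\<open>short\<close> kernel vector is properly conformal to it,
  since conformal vectors are at most as long.
\<close>

definition dual_dirs :: "nat \<Rightarrow> int list list \<Rightarrow> int list \<Rightarrow> int list list" where
  "dual_dirs K A w = filter (\<lambda>g. \<forall>f\<in>set (short_kern K A w).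
     (\<forall>j\<in>set [0..<length w]. 0 \<le> nd f j * nd g j \<and> \<bar>nd f j\<bar> \<le> \<bar>nd g j\<bar>) \<longrightarrow>
     (\<forall>j\<in>set [0..<length w]. nd f j = nd g j)) (short_kern K A w)"

text \<open>
  The minimum over all coordinates of the number of times that \<open>f\<close> can be added before leaving the
  box. The minimum is computed as a maximizer of the negative; the value \<open>0\<close> is for \<open>f = 0\<close>.
\<close>

definition step_length :: "int list \<Rightarrow> int list \<Rightarrow> int list \<Rightarrow> int list \<Rightarrow> int" where
  "step_length l u x f = (case argmax uminus (concat (map (\<lambda>j.
       if 0 < nd f j then [(nd u j - nd x j) div nd f j]
       else if nd f j < 0 then [(nd x j - nd l j) div (- nd f j)] else []) [0..<length x])) of
     [] \<Rightarrow> 0 | c # cs \<Rightarrow> c)"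

definition gain :: "int list \<Rightarrow> int list \<Rightarrow> int list \<Rightarrow> int list \<Rightarrow> int list \<Rightarrow> int" where
  "gain l u w x f = step_length l u x f * dotl w f"

definition move :: "int list \<Rightarrow> int list \<Rightarrow> int list \<Rightarrow> int list \<Rightarrow> int list" where
  "move l u x f = map (\<lambda>j. nd x j + step_length l u x f * nd f j) [0..<length x]"

text \<open>
  A candidate with the best gain of a maximal step. If the best gain is not positive, the point
  is optimal. The test of the box always succeeds from a feasible point; it
  bounds the size of the new point for arbitrary arguments.
\<close>

definition next_point :: "nat \<Rightarrow> nat \<Rightarrow> nat \<Rightarrow> int list list \<Rightarrow> int list \<Rightarrow> int list \<Rightarrow> int list \<Rightarrow> int list \<Rightarrow> int list list" where
  "next_point d k K A l u w x =
     (case argmax (gain l u w x) (primal_dirs d k A l u w x @ dual_dirs K A w) of [] \<Rightarrow> []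
      | f # fs \<Rightarrow> if 0 < gain l u w x f \<and> length x = length w \<and>
            (\<forall>j\<in>set [0..<length w]. nd l j \<le> nd (move l u x f) j \<and> nd (move l u x f) j \<le> nd u j)
          then [move l u x f] else [])"

text \<open>
  For \<open>n\<close> variables, the length of this list is \<open>length (halves (spread w l u))\<close> times
  \<open>3 (n + 1) n (n k)\<close>, the number of steps that suffices.
\<close>

definition ticks :: "nat \<Rightarrow> int list \<Rightarrow> int list \<Rightarrow> int list \<Rightarrow> int list" where
  "ticks k l u w = concat (map (\<lambda>_. concat (map (\<lambda>_. concat (map (\<lambda>_. concat (map (\<lambda>_. pad k w) w)) (0 # w)))
     [0 :: int, 0, 0])) (halves (spread w l u)))"

text \<open>
  The walk is kept with its current point first. Once it is optimal, further rounds change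
  nothing.
\<close>

definition extend_walk :: "nat \<Rightarrow> nat \<Rightarrow> nat \<Rightarrow> int list list \<Rightarrow> int list \<Rightarrow> int list \<Rightarrow> int list \<Rightarrow> int list list \<Rightarrow> int list list" where
  "extend_walk d k K A l u w xs = (case xs of [] \<Rightarrow> [] | x # ys \<Rightarrow> next_point d k K A l u w x @ xs)"

definition compute_walk :: "nat \<Rightarrow> nat \<Rightarrow> nat \<Rightarrow> int list list \<Rightarrow> int list \<Rightarrow> int list \<Rightarrow> int list \<Rightarrow> int list \<Rightarrow> int list list" where
  "compute_walk d k K A l u w x0 =
     rev (foldl (\<lambda>xs _. extend_walk d k K A l u w xs) [x0] (ticks k l u w))"

section \<open>Correctness of the augmentation algorithm\<close>

lemma length_pad: "length (pad k w) = length w * k"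
  by (induction w) (auto simp: pad_def)

lemma set_range_vals: "t \<in> set (range_vals k w) \<longleftrightarrow> \<bar>t\<bar> \<le> int (length w * k)"
proof -
  have "set [0..<length (0 # pad k w)] = {..length w * k}" by (auto simp: length_pad)
  then have "set (range_vals k w) = int ` {..length w * k} \<union> (\<lambda>i. - int i) ` {..length w * k}"
    unfolding range_vals_def set_append set_map by (simp only:)
  moreover have "t \<in> int ` {..N} \<union> (\<lambda>i. - int i) ` {..N} \<longleftrightarrow> \<bar>t\<bar> \<le> int N" for N
  proof
    assume t: "\<bar>t\<bar> \<le> int N"
    show "t \<in> int ` {..N} \<union> (\<lambda>i. - int i) ` {..N}"
    proof (cases "0 \<le> t")
      case True
      have "t \<in> int ` {..N}" by (rule image_eqI[of _ _ "nat t"]) (use t True in auto)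
      then show ?thesis by (rule UnI1)
    next
      case False
      have "t \<in> (\<lambda>i. - int i) ` {..N}" by (rule image_eqI[of _ _ "nat (- t)"]) (use t False in auto)
      then show ?thesis by (rule UnI2)
    qed
  qed auto
  ultimately show ?thesis by (simp only:)
qed

lemma le_div_iff: "0 < b \<Longrightarrow> k \<le> a div b \<longleftrightarrow> k * b \<le> (a :: int)"
proof
  assume b: "0 < b" and "k \<le> a div b"
  then have "k * b \<le> a div b * b" by (intro mult_right_mono) auto
  also have "\<dots> \<le> a" using b div_mult_mod_eq[of a b] pos_mod_sign[of b a] by linarith
  finally show "k * b \<le> a" .
next
  assume b: "0 < b" and "k * b \<le> a"
  then have "k * b div b \<le> a div b" by (intro zdiv_mono1)
  then show "k \<le> a div b" using b by simp
qed

lemma set_halves: "0 < M \<Longrightarrow> set (halves M) = insert M (set (halves (M div 2)))"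
  by (subst halves.simps) simp

lemma halves_approx:
  assumes "1 \<le> \<mu>" "\<mu> \<le> M"
  shows "\<exists>s\<in>set (halves M). 1 \<le> s \<and> s \<le> \<mu> \<and> \<mu> \<le> 3 * s"
  using assms
proof (induction M rule: halves.induct)
  case (1 M)
  have M: "0 < M" using 1(2,3) by linarith
  show ?case
  proof (cases "\<mu> \<le> M div 2")
    case True
    have "\<not> M \<le> 0" using M by linarith
    from 1(1)[OF this 1(2) True] show ?thesis unfolding set_halves[OF M] by (rule bexE) (rule bexI[OF _ insertI2])
  next
    case big: False
    show ?thesis
    proof (cases "\<mu> = M")
      case True
      show ?thesis unfolding set_halves[OF M] by (rule bexI[OF _ insertI1]) (use True 1(2) in auto)
    next
      case False
      then have "1 \<le> M div 2" "M div 2 < \<mu>" "\<mu> \<le> 3 * (M div 2)" using big 1(2,3) by linarith+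
      moreover have "M div 2 \<in> set (halves M)"
        unfolding set_halves[OF M] using set_halves[of "M div 2"] calculation(1) by (intro insertI2) simp
      ultimately show ?thesis by (intro bexI[of _ "M div 2"]) auto
    qed
  qed
qed

lemma halves_length: "M < 2 ^ length (halves M)"
proof (induction M rule: halves.induct)
  case (1 M)
  show ?case
  proof (cases "M \<le> 0")
    case True
    then show ?thesis by (subst halves.simps) simp
  next
    case False
    then have "M div 2 < 2 ^ length (halves (M div 2))" by (rule 1)
    then have "M < 2 * 2 ^ length (halves (M div 2))" by linarith
    then show ?thesis using False by (subst halves.simps) simp
  qed
qed

lemma length_ticks: "length (ticks k l u w) =
   length (halves (spread w l u)) * (3 * (Suc (length w) * (length w * (length w * k))))"
  by (simp add: ticks_def length_concat comp_def sum_list_triv length_pad algebra_simps)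

text \<open>
  Here \<open>k\<close> bounds the minors, \<open>d\<close> the depth of a decomposition of the columns and \<open>K\<close> the norm of
  Graver elements. One of the last two bounds is available: the first if \<open>A\<close>, the second if its
  transpose has small tree-depth.
\<close>

locale ip =
  fixes A :: "int list list" and l u w :: "int list" and b :: "nat \<Rightarrow> int" and n k d K :: nat
  assumes dims: "length l = n" "length u = n" "length w = n" and n: "0 < n" and k: "0 < k"
    and minors: "minors_le (ent A) (length A) n (int k)"
    and depth: "tdp (adjc A) {..<n} d \<or>
      (\<forall>g. minimal_kern (ent A) {..<length A} n g \<longrightarrow> l1 n g \<le> int K)"
begin

abbreviation "R \<equiv> {..<length A}"
abbreviation "B \<equiv> int (n * k)"

definition feasible :: "(nat \<Rightarrow> int) \<Rightarrow> bool" where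
  "feasible x \<longleftrightarrow> (\<forall>j\<ge>n. x j = 0) \<and> (\<forall>j<n. nd l j \<le> x j \<and> x j \<le> nd u j) \<and> (\<forall>i\<in>R. dot n (ent A i) x = b i)"

lemma sol_kern: "sol A lo hi n vals {..<n} (\<lambda>i. 0) y \<longleftrightarrow>
    kern (ent A) R n y \<and> (\<forall>j<n. nd lo j \<le> y j \<and> y j \<le> nd hi j \<and> y j \<in> set vals)"
proof -
  have "(\<forall>j. y j \<noteq> 0 \<longrightarrow> j < n) \<longleftrightarrow> (\<forall>j\<ge>n. y j = 0)" by (metis not_le)
  then show ?thesis by (auto simp: sol_def kern_dot)
qed

lemma nd_Nil: "nd [] = (\<lambda>i. 0)"
  by (rule ext) (simp add: nth_default_def)

lemma set_upt0: "set [0..<n] = {..<n}"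
  by auto

text \<open>
  Optimization over the kernel is the case in which all columns are free and the right-hand side is
  zero, represented by the empty list. Every answer is optimal.
\<close>

lemma kernel_solve:
  assumes "length c = n" "x \<in> set (solve d A lo hi c vals [0..<n] [])"
  shows "length x = n" "kern (ent A) R n (nd x)" "tdp (adjc A) {..<n} d"
    and "\<And>j. j < n \<Longrightarrow> nd lo j \<le> nd x j \<and> nd x j \<le> nd hi j \<and> nd x j \<in> set vals"
    and "\<And>y. kern (ent A) R n y \<Longrightarrow> (\<And>j. j < n \<Longrightarrow> nd lo j \<le> y j \<and> y j \<le> nd hi j \<and> y j \<in> set vals) \<Longrightarrow>
      dot n (nd c) y \<le> dot n (nd c) (nd x)"
proof -
  have C: "distinct [0..<n]" "set [0..<n] \<subseteq> {..<length c}" using assms(1) by auto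
  have "sol A lo hi n vals {..<n} (\<lambda>i. 0) (nd x) \<and> length x = n"
    using solve_sound[OF C assms(2)] by (simp only: nd_Nil set_upt0 assms(1))
  then show "length x = n" "kern (ent A) R n (nd x)"
    "\<And>j. j < n \<Longrightarrow> nd lo j \<le> nd x j \<and> nd x j \<le> nd hi j \<and> nd x j \<in> set vals"
    unfolding sol_kern by blast+
  from assms(2) have ne: "solve d A lo hi c vals [0..<n] [] \<noteq> []" by auto
  show "tdp (adjc A) {..<n} d" using solve_nonempty_tdp[OF ne C(1)] by (simp only: set_upt0)
  have one: "solve d A lo hi c vals [0..<n] [] = [x]"
    using assms(2) solve_length[of d A lo hi c vals "[0..<n]" "[]"]
    by (cases "solve d A lo hi c vals [0..<n] []") auto
  show "dot n (nd c) y \<le> dot n (nd c) (nd x)"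
    if "kern (ent A) R n y" "\<And>j. j < n \<Longrightarrow> nd lo j \<le> y j \<and> y j \<le> nd hi j \<and> y j \<in> set vals" for y
  proof -
    have "sol A lo hi n vals {..<n} (\<lambda>i. 0) y" unfolding sol_kern using that by blast
    then show ?thesis using solve_optimal[OF one C, of y] by (simp only: nd_Nil set_upt0 assms(1))
  qed
qed

lemma kernel_solve_nonempty:
  assumes "length c = n" "tdp (adjc A) {..<n} d" "kern (ent A) R n y"
    "\<And>j. j < n \<Longrightarrow> nd lo j \<le> y j \<and> y j \<le> nd hi j \<and> y j \<in> set vals"
  shows "solve d A lo hi c vals [0..<n] [] \<noteq> []"
proof -
  have C: "distinct [0..<n]" "set [0..<n] \<subseteq> {..<length c}" using assms(1) by auto
  have "sol A lo hi n vals {..<n} (\<lambda>i. 0) y" unfolding sol_kern using assms by blast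
  then have "sol A lo hi (length c) vals (set [0..<n]) (nd []) y" by (simp only: nd_Nil set_upt0 assms(1))
  moreover have "tdp (adjc A) (set [0..<n]) d" using assms(2) by (simp only: set_upt0)
  ultimately obtain x where "x \<in> set (solve d A lo hi c vals [0..<n] [])"
    using solve_complete[OF _ C] by blast
  then show ?thesis by auto
qed

lemma sgn_dot: "cfm h g \<Longrightarrow> dot n (\<lambda>j. - sgn (g j)) h = - l1 n h"
proof -
  assume c: "cfm h g"
  have "- sgn (g j) * h j = - \<bar>h j\<bar>" for j
    using c[unfolded cfm_def, THEN spec, of j] by (auto simp: sgn_if abs_if)
  then show ?thesis by (simp add: dot_def l1_def sum_negf)
qed

lemma below_box:
  assumes "length g = n" "\<And>j. n \<le> j \<Longrightarrow> y j = 0" "j < n" "nd g j \<noteq> 0"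
  defines "lo \<equiv> map (\<lambda>k. if k = j \<and> 0 < nd g k then 1 else if nd g k < 0 then nd g k else 0) [0..<length g]"
    and "hi \<equiv> map (\<lambda>k. if k = j \<and> nd g k < 0 then -1 else if 0 < nd g k then nd g k else 0) [0..<length g]"
  shows "(\<forall>i<n. nd lo i \<le> y i \<and> y i \<le> nd hi i) \<longleftrightarrow> cfm y (nd g) \<and> y j \<noteq> 0"
proof -
  have gout: "nd g i = 0" if "n \<le> i" for i using that assms(1) by (simp add: nth_default_def)
  have "cfm y (nd g) \<longleftrightarrow> (\<forall>i<n. 0 \<le> y i \<and> y i \<le> nd g i \<or> nd g i \<le> y i \<and> y i \<le> 0)"
    unfolding cfm_def using gout assms(2) by (metis eq_iff not_le)
  moreover have "(\<forall>i<n. nd lo i \<le> y i \<and> y i \<le> nd hi i) \<longleftrightarrow>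
     (\<forall>i<n. (0 \<le> y i \<and> y i \<le> nd g i \<or> nd g i \<le> y i \<and> y i \<le> 0) \<and> (i = j \<longrightarrow> y i \<noteq> 0))"
    unfolding lo_def hi_def nd_map_upt assms(1) using assms(4)
    by (intro all_cong) auto
  ultimately show ?thesis using assms(3) by blast
qed

text \<open>
  If \<open>f\<close> were not minimal, it would be the sum of two nonzero conformal kernel vectors. At least one of
  them does not vanish at \<open>j\<close>, is conformal to \<open>g\<close> and is shorter than \<open>f\<close>.
\<close>

lemma below_minimal:
  assumes g: "length g = n" "kern (ent A) R n (nd g)" "\<And>i. \<bar>nd g i\<bar> \<le> B" and j: "j < n" "nd g j \<noteq> 0"
    and f: "f \<in> set (below d A (range_vals k g') g j)" and g': "length g' = n"
  shows "minimal_kern (ent A) R n (nd f)" "cfm (nd f) (nd g)" "length f = n"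
proof -
  have len: "length (map (\<lambda>k. - sgn (nd g k)) [0..<length g]) = n" using g(1) by simp
  note s = kernel_solve[OF len[unfolded g(1)] f[unfolded below_def, unfolded g(1)]]
  show lenf: "length f = n" by (rule s(1))
  have out: "y i = 0" if "kern (ent A) R n y" "n \<le> i" for y i using that by (simp add: kern_def)
  note box = below_box[OF g(1) _ j, unfolded g(1)]
  have cf: "cfm (nd f) (nd g) \<and> nd f j \<noteq> 0"
    using box[of "nd f"] out[OF s(2)] s(4) by blast
  then show "cfm (nd f) (nd g)" ..
  have obj: "dot n (nd (map (\<lambda>k. - sgn (nd g k)) [0..<n])) h = - l1 n h" if "cfm h (nd g)" for h
  proof -
    have "dot n (nd (map (\<lambda>k. - sgn (nd g k)) [0..<n])) h = dot n (\<lambda>j. - sgn (nd g j)) h"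
      by (rule dot_def[THEN trans]) (simp add: dot_def nd_map_upt)
    then show ?thesis using sgn_dot[OF that] by simp
  qed
  have short: "l1 n (nd f) \<le> l1 n h" if h: "kern (ent A) R n h" "cfm h (nd g)" "h j \<noteq> 0" for h
  proof -
    have "h i \<in> set (range_vals k g')" for i
      using cfm_abs[OF h(2), of i] g(3)[of i] g' by (simp add: set_range_vals)
    moreover have "\<forall>i<n. nd (map (\<lambda>k. if k = j \<and> 0 < nd g k then 1 else if nd g k < 0 then nd g k else 0) [0..<n]) i \<le> h i \<and>
        h i \<le> nd (map (\<lambda>k. if k = j \<and> nd g k < 0 then -1 else if 0 < nd g k then nd g k else 0) [0..<n]) i"
      using box[of h] out[OF h(1)] h(2,3) by blast
    ultimately have "dot n (nd (map (\<lambda>k. - sgn (nd g k)) [0..<n])) h \<le> dot n (nd (map (\<lambda>k. - sgn (nd g k)) [0..<n])) (nd f)"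
      using s(5)[OF h(1)] g(1) by simp
    then show ?thesis using obj[OF h(2)] obj[of "nd f"] cf by simp
  qed
  show "minimal_kern (ent A) R n (nd f)" unfolding minimal_kern_def
  proof (intro conjI allI impI)
    show "kern (ent A) R n (nd f)" by (rule s(2))
    show "nd f \<noteq> (\<lambda>j. 0)" using cf by auto
    fix h assume h: "kern (ent A) R n h \<and> h \<noteq> (\<lambda>j. 0) \<and> cfm h (nd f)"
    show "h = nd f"
    proof (rule ccontr)
      assume ne: "h \<noteq> nd f"
      let ?h = "\<lambda>i. nd f i - h i"
      have h': "kern (ent A) R n ?h" "cfm ?h (nd f)" using h s(2) by (auto intro: kern_diff cfm_diff)
      from ne obtain i where "h i \<noteq> nd f i" by auto
      then have "?h i \<noteq> 0" by simp
      then have "?h \<noteq> (\<lambda>i. 0)" by (rule contrapos_nn) (rule fun_cong)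
      then have pos: "1 \<le> l1 n h" "1 \<le> l1 n ?h" using h h' l1_pos by blast+
      have sum: "l1 n (nd f) = l1 n h + l1 n ?h" using h by (intro l1_diff) simp
      have "h j \<noteq> 0 \<or> ?h j \<noteq> 0" using cf by auto
      then show False
      proof
        assume "h j \<noteq> 0"
        then have "l1 n (nd f) \<le> l1 n h" using h cf by (intro short) (auto intro: cfm_trans)
        then show False using sum pos by simp
      next
        assume "?h j \<noteq> 0"
        then have "l1 n (nd f) \<le> l1 n ?h" using h' cf by (intro short) (auto intro: cfm_trans)
        then show False using sum pos by simp
      qed
    qed
  qed
qed

lemma below_nonempty:
  assumes g: "length g = n" "kern (ent A) R n (nd g)" "\<And>i. \<bar>nd g i\<bar> \<le> B" and j: "j < n" "nd g j \<noteq> 0"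
    and "tdp (adjc A) {..<n} d" and g': "length g' = n"
  shows "below d A (range_vals k g') g j \<noteq> []"
  unfolding below_def g(1)
proof (rule kernel_solve_nonempty[OF _ assms(6) g(2)])
  fix i assume "i < n"
  moreover have "nd g i \<in> set (range_vals k g')" using g(3)[of i] g' by (simp add: set_range_vals)
  ultimately show "nd (map (\<lambda>k. if k = j \<and> 0 < nd g k then 1 else if nd g k < 0 then nd g k else 0) [0..<n]) i \<le> nd g i \<and>
    nd g i \<le> nd (map (\<lambda>k. if k = j \<and> nd g k < 0 then - 1 else if 0 < nd g k then nd g k else 0) [0..<n]) i \<and>
    nd g i \<in> set (range_vals k g')"
    by (auto simp: nd_map_upt)
qed simp

end

subsection \<open>Peeling off Graver elements\<close>

context ip begin

lemma out: "length g = n \<Longrightarrow> n \<le> j \<Longrightarrow> nd g j = 0"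
  by (simp add: nth_default_def)

lemma nd_renormalize: "length g = n \<Longrightarrow> nd (map (nd g) [0..<n]) = nd g"
  unfolding nd_map_upt using out[of g] by (intro ext) auto

lemma remainder_nd:
  assumes "length g = n" "\<And>f. f \<in> set fs \<Longrightarrow> length f = n"
  shows "nd (remainder g fs) = (\<lambda>j. nd g j - (\<Sum>f\<leftarrow>fs. nd f j))"
proof
  fix j
  show "nd (remainder g fs) j = nd g j - (\<Sum>f\<leftarrow>fs. nd f j)"
  proof (cases "j < n")
    case False
    have "map (\<lambda>f. nd f j) fs = map (\<lambda>_. 0) fs" using assms(2) False out by (intro map_cong) auto
    then have "(\<Sum>f\<leftarrow>fs. nd f j) = 0" by (simp only: sum_list_0)
    then show ?thesis using False out[OF assms(1)] assms(1) by (simp add: remainder_def nd_map_upt)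
  qed (simp add: remainder_def nd_map_upt assms(1))
qed

text \<open>
  The invariant of the iteration. Its last part says that the summands have used up at least their
  number of the norm of \<open>g\<close>: this limits their number and ensures that enough rounds leave
  nothing.
\<close>

definition peeled :: "int list \<Rightarrow> int list list \<Rightarrow> bool" where
  "peeled g fs \<longleftrightarrow> (\<forall>f\<in>set fs. length f = n \<and> minimal_kern (ent A) R n (nd f) \<and> cfm (nd f) (nd g)) \<and>
     cfm (nd (remainder g fs)) (nd g) \<and> int (length fs) + l1 n (nd (remainder g fs)) \<le> l1 n (nd g)"

lemma remainder_kern:
  assumes "length g = n" "kern (ent A) R n (nd g)" "peeled g fs"
  shows "kern (ent A) R n (nd (remainder g fs))"
proof -
  have "kern (ent A) R n (\<lambda>j. \<Sum>f\<leftarrow>fs. nd f j)"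
    by (rule kern_sum_list) (use assms(3) in \<open>auto simp: peeled_def minimal_kern_def\<close>)
  moreover have "nd (remainder g fs) = (\<lambda>j. nd g j - (\<Sum>f\<leftarrow>fs. nd f j))"
    by (rule remainder_nd) (use assms in \<open>auto simp: peeled_def\<close>)
  ultimately show ?thesis using kern_diff[OF assms(2)] by simp
qed

lemma peel_step:
  assumes g: "length g = n" "kern (ent A) R n (nd g)" "\<And>i. \<bar>nd g i\<bar> \<le> B" and fs: "peeled g fs"
  shows "peeled g (peel d A (range_vals k g) g fs)"
    and "tdp (adjc A) {..<n} d \<Longrightarrow> nd (remainder g fs) \<noteq> (\<lambda>j. 0) \<Longrightarrow>
      length (peel d A (range_vals k g) g fs) = Suc (length fs)"
    and "nd (remainder g fs) = (\<lambda>j. 0) \<Longrightarrow> peel d A (range_vals k g) g fs = fs"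
proof -
  let ?r = "remainder g fs"
  have lr: "length ?r = n" by (simp add: remainder_def g(1))
  have kr: "kern (ent A) R n (nd ?r)" by (rule remainder_kern[OF g(1,2) fs])
  have cr: "cfm (nd ?r) (nd g)" using fs by (simp add: peeled_def)
  have rB: "\<bar>nd ?r i\<bar> \<le> B" for i using cfm_abs[OF cr, of i] g(3)[of i] by linarith
  have lfs: "\<And>f. f \<in> set fs \<Longrightarrow> length f = n" using fs by (simp add: peeled_def)
  show zero: "peel d A (range_vals k g) g fs = fs" if "nd ?r = (\<lambda>j. 0)"
    using that by (simp add: peel_def)
  have step: "peeled g (peel d A (range_vals k g) g fs) \<and> (tdp (adjc A) {..<n} d \<longrightarrow>
      length (peel d A (range_vals k g) g fs) = Suc (length fs))" if nz: "nd ?r \<noteq> (\<lambda>j. 0)"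
  proof -
    obtain j0 where "nd ?r j0 \<noteq> 0" using nz by auto
    then have "j0 \<in> set (filter (\<lambda>j. nd ?r j \<noteq> 0) [0..<length g])" using out[OF lr, of j0] g(1) by (auto simp: not_less[symmetric])
    then obtain j js where js: "filter (\<lambda>j. nd ?r j \<noteq> 0) [0..<length g] = j # js"
      by (cases "filter (\<lambda>j. nd ?r j \<noteq> 0) [0..<length g]") auto
    have "j \<in> set (filter (\<lambda>j. nd ?r j \<noteq> 0) [0..<length g])" unfolding js by simp
    then have j: "j < n" "nd ?r j \<noteq> 0" using g(1) by auto
    show ?thesis
    proof (cases "below d A (range_vals k g) ?r j")
      case Nil
      then have "\<not> tdp (adjc A) {..<n} d" using below_nonempty[OF lr kr rB j _ g(1)] by blast
      moreover have "peel d A (range_vals k g) g fs = fs" by (simp add: peel_def js Nil)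
      ultimately show ?thesis using fs by simp
    next
      case (Cons f rest)
      then have fb: "f \<in> set (below d A (range_vals k g) ?r j)" by simp
      note f = below_minimal[OF lr kr rB j fb g(1)]
      have cg: "cfm (nd f) (nd g)" by (rule cfm_trans[OF f(2) cr])
      then have "\<forall>k\<in>set [0..<length g]. \<bar>nd f k\<bar> \<le> \<bar>nd g k\<bar>" using cfm_abs by blast
      then have pe: "peel d A (range_vals k g) g fs = map (nd f) [0..<length g] # fs"
        by (simp add: peel_def js Cons)
      let ?f = "map (nd f) [0..<length g]"
      have ndf: "nd ?f = nd f" unfolding g(1) by (rule nd_renormalize[OF f(3)])
      have lf: "length ?f = n" using g(1) by simp
      have "nd (remainder g (?f # fs)) = (\<lambda>j. nd g j - (\<Sum>f\<leftarrow>?f # fs. nd f j))"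
        by (rule remainder_nd[OF g(1)]) (use lf lfs in auto)
      also have "\<dots> = (\<lambda>j. nd ?r j - nd f j)"
        by (rule ext) (simp add: ndf fun_cong[OF remainder_nd[OF g(1) lfs]])
      finally have r': "nd (remainder g (?f # fs)) = (\<lambda>j. nd ?r j - nd f j)" .
      have "l1 n (nd ?r) = l1 n (nd f) + l1 n (\<lambda>j. nd ?r j - nd f j)" by (rule l1_diff[OF f(2)])
      moreover have "1 \<le> l1 n (nd f)" using f(1) by (auto simp: minimal_kern_def intro: l1_pos)
      moreover have "cfm (\<lambda>j. nd ?r j - nd f j) (nd g)" by (rule cfm_trans[OF cfm_diff[OF f(2)] cr])
      ultimately have "peeled g (?f # fs)" unfolding peeled_def r'
        using fs f(1) cg lf unfolding peeled_def by (auto simp: ndf)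
      then show ?thesis unfolding pe by simp
    qed
  qed
  show "peeled g (peel d A (range_vals k g) g fs)" using step zero fs by (cases "nd ?r = (\<lambda>j. 0)") auto
  show "length (peel d A (range_vals k g) g fs) = Suc (length fs)"
    if "tdp (adjc A) {..<n} d" "nd ?r \<noteq> (\<lambda>j. 0)" using step that by blast
qed

text \<open>
  In a column decomposition of depth \<open>d\<close> every round adds a summand until nothing is left. As many
  summands as rounds would exhaust the largest possible norm.
\<close>

lemma pieces_props:
  assumes g: "length g = n" "kern (ent A) R n (nd g)" "\<And>i. \<bar>nd g i\<bar> \<le> B"
  shows "peeled g (pieces d k A g)"
    and "tdp (adjc A) {..<n} d \<Longrightarrow> nd (remainder g (pieces d k A g)) = (\<lambda>j. 0)"
proof -
  let ?F = "foldl (\<lambda>fs _. peel d A (range_vals k g) g fs) []"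
  have r0: "nd (remainder g []) = nd g" using remainder_nd[OF g(1), of "[]"] by simp
  have inv: "peeled g (?F ts) \<and> (tdp (adjc A) {..<n} d \<longrightarrow>
      nd (remainder g (?F ts)) = (\<lambda>j. 0) \<or> length (?F ts) = length ts)" for ts :: "int list"
  proof (induction ts rule: rev_induct)
    case Nil
    show ?case by (simp add: peeled_def r0 cfm_refl)
  next
    case (snoc t ts)
    let ?fs = "?F ts"
    have F: "?F (ts @ [t]) = peel d A (range_vals k g) g ?fs" by simp
    have p: "peeled g ?fs" using snoc by simp
    show ?case
    proof (cases "nd (remainder g ?fs) = (\<lambda>j. 0)")
      case True
      then show ?thesis unfolding F peel_step(3)[OF g p True] using p by simp
    next
      case False
      then show ?thesis unfolding F using peel_step(1)[OF g p] peel_step(2)[OF g p _ False] snoc by auto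
    qed
  qed
  let ?ts = "concat (map (\<lambda>_. pad k g) g)"
  show pe: "peeled g (pieces d k A g)" using inv[of ?ts] by (simp add: pieces_def)
  show "nd (remainder g (pieces d k A g)) = (\<lambda>j. 0)" if t: "tdp (adjc A) {..<n} d"
  proof (rule ccontr)
    assume nz: "nd (remainder g (pieces d k A g)) \<noteq> (\<lambda>j. 0)"
    then have "length (pieces d k A g) = length ?ts" using inv[of ?ts] t by (auto simp: pieces_def)
    also have "\<dots> = n * (n * k)" by (simp add: length_concat comp_def length_pad g(1) sum_list_triv)
    finally have len: "int (length (pieces d k A g)) = int n * B" by simp
    have "l1 n (nd g) \<le> (\<Sum>j<n. B)" unfolding l1_def using g(3) by (intro sum_mono)
    moreover have "1 \<le> l1 n (nd (remainder g (pieces d k A g)))"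
      by (rule l1_pos[OF remainder_kern[OF g(1,2) pe] nz])
    ultimately show False using pe len unfolding peeled_def by simp
  qed
qed

lemma pieces_good:
  assumes g: "length g = n" "kern (ent A) R n (nd g)" "\<And>i. \<bar>nd g i\<bar> \<le> B"
    and t: "tdp (adjc A) {..<n} d" and pos: "0 < dot n c (nd g)"
  shows "\<exists>f\<in>set (pieces d k A g). dot n c (nd g) \<le> (int n * B) * dot n c (nd f)"
proof -
  note p = pieces_props[OF g]
  have "nd g j = (\<Sum>f\<leftarrow>pieces d k A g. nd f j)" for j
  proof -
    have "nd (remainder g (pieces d k A g)) = (\<lambda>j. nd g j - (\<Sum>f\<leftarrow>pieces d k A g. nd f j))"
      by (rule remainder_nd[OF g(1)]) (use p(1) in \<open>auto simp: peeled_def\<close>)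
    then have "(\<lambda>j. nd g j - (\<Sum>f\<leftarrow>pieces d k A g. nd f j)) j = 0" using p(2)[OF t] by metis
    then show ?thesis by simp
  qed
  then have "nd g = (\<lambda>j. \<Sum>f\<leftarrow>pieces d k A g. nd f j)" by (rule ext)
  then have "dot n c (nd g) = dot n c (\<lambda>j. \<Sum>f\<leftarrow>pieces d k A g. nd f j)" by (rule arg_cong[where f = "dot n c"])
  then have "dot n c (nd g) \<le> (\<Sum>f\<leftarrow>pieces d k A g. dot n c (nd f))" by (simp only: dot_sum_list order.refl)
  moreover have "int (length (pieces d k A g)) \<le> int n * B"
  proof -
    have "l1 n (nd g) \<le> (\<Sum>j<n. B)" unfolding l1_def using g(3) by (intro sum_mono)
    then show ?thesis using p(1) l1_nonneg[of n "nd (remainder g (pieces d k A g))"] unfolding peeled_def by simp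
  qed
  ultimately show ?thesis using sum_list_pigeonhole[OF _ pos] by blast
qed

subsection \<open>Short kernel vectors\<close>

lemma nd_bump: "length v = n \<Longrightarrow> j < n \<Longrightarrow> nd (bump v j t) = (nd v)(j := nd v j + t)"
  unfolding bump_def nd_map_upt using out[of v] by (intro ext) auto

lemma l1_update: "j < n \<Longrightarrow> l1 n (x(j := y)) = l1 n x - \<bar>x j\<bar> + \<bar>y\<bar>"
proof -
  assume j: "j < n"
  have "l1 n (x(j := y)) = \<bar>y\<bar> + (\<Sum>i\<in>{..<n} - {j}. \<bar>x i\<bar>)"
    unfolding l1_def using j by (subst sum.remove[of _ j]) auto
  moreover have "l1 n x = \<bar>x j\<bar> + (\<Sum>i\<in>{..<n} - {j}. \<bar>x i\<bar>)"
    unfolding l1_def using j by (subst sum.remove[of _ j]) auto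
  ultimately show ?thesis by simp
qed

lemma short_vecs_sound: "v \<in> set (short_vecs m w) \<Longrightarrow> length v = n \<and> l1 n (nd v) \<le> int m"
proof (induction m arbitrary: v)
  case 0
  then have "v = map (\<lambda>j. 0) [0..<n]" using dims by simp
  then show ?case by (simp add: l1_def nd_map_upt)
next
  case (Suc m)
  from Suc.prems consider "v \<in> set (short_vecs m w)"
    | v' j t where "v' \<in> set (short_vecs m w)" "j < n" "v = bump v' j t" "\<bar>t\<bar> = 1"
    using dims by force
  then show ?case
  proof cases
    case 1
    then show ?thesis using Suc.IH by force
  next
    case 2
    have v': "length v' = n" "l1 n (nd v') \<le> int m" using Suc.IH[OF 2(1)] by auto
    have "l1 n (nd v) = l1 n (nd v') - \<bar>nd v' j\<bar> + \<bar>nd v' j + t\<bar>"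
      unfolding 2(3) nd_bump[OF v'(1) 2(2)] by (rule l1_update[OF 2(2)])
    moreover have "\<bar>nd v' j + t\<bar> \<le> \<bar>nd v' j\<bar> + 1" using 2(4) by linarith
    ultimately show ?thesis using v' 2(3) by (simp add: bump_def)
  qed
qed

text \<open>
  Moving a nonzero entry by one towards zero gives a vector of smaller norm.
\<close>

lemma short_vecs_complete:
  "(\<And>j. n \<le> j \<Longrightarrow> g j = 0) \<Longrightarrow> l1 n g \<le> int m \<Longrightarrow> \<exists>v\<in>set (short_vecs m w). nd v = g"
proof (induction m arbitrary: g)
  case 0
  have "g j = 0" for j
  proof (cases "j < n")
    case True
    have "\<bar>g j\<bar> \<le> l1 n g" unfolding l1_def by (rule member_le_sum) (use True in auto)
    then show ?thesis using 0 by simp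
  qed (use 0 in simp)
  then show ?case using dims by (simp add: nd_map_upt fun_eq_iff)
next
  case (Suc m)
  show ?case
  proof (cases "l1 n g \<le> int m")
    case True
    then show ?thesis using Suc.IH[of g] Suc.prems(1) by auto
  next
    case False
    have "\<exists>j<n. g j \<noteq> 0"
    proof (rule ccontr)
      assume "\<not> ?thesis"
      then have "l1 n g = 0" by (simp add: l1_def)
      with False show False by simp
    qed
    then obtain j where j: "j < n" "g j \<noteq> 0" by blast
    define g' where "g' = g(j := g j - sgn (g j))"
    have "l1 n g' = l1 n g - \<bar>g j\<bar> + \<bar>g j - sgn (g j)\<bar>" unfolding g'_def by (rule l1_update[OF j(1)])
    moreover have "\<bar>g j - sgn (g j)\<bar> = \<bar>g j\<bar> - 1" using j(2) by (auto simp: sgn_if abs_if)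
    ultimately have "l1 n g' \<le> int m" using Suc.prems(2) by simp
    moreover have "g' i = 0" if "n \<le> i" for i using that j Suc.prems(1) by (simp add: g'_def)
    ultimately obtain v where v: "v \<in> set (short_vecs m w)" "nd v = g'" using Suc.IH[of g'] by blast
    have lv: "length v = n" using short_vecs_sound[OF v(1)] by simp
    have "nd (bump v j (sgn (g j))) = g"
      unfolding nd_bump[OF lv j(1)] v(2) by (rule ext) (simp add: g'_def)
    moreover have "bump v j (sgn (g j)) \<in> set (short_vecs (Suc m) w)"
    proof -
      have "sgn (g j) = 1 \<or> sgn (g j) = - 1" using j(2) by (simp add: sgn_if)
      moreover have "t = 1 \<or> t = - 1 \<Longrightarrow> bump v j t \<in> set (short_vecs (Suc m) w)" for t
        using v(1) j(1) dims by (auto intro!: bexI[of _ v] bexI[of _ j])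
      ultimately show ?thesis by blast
    qed
    ultimately show ?thesis by blast
  qed
qed

lemma short_kern_iff: "v \<in> set (short_kern K A w) \<longleftrightarrow>
    v \<in> set (short_vecs K w) \<and> kern (ent A) R n (nd v) \<and> nd v \<noteq> (\<lambda>j. 0)"
proof -
  have "(\<Sum>j\<leftarrow>[0..<length w]. ent A i j * nd v j) = dot n (ent A i) (nd v)" for i
    using dims by (simp add: dot_def interv_sum_list_conv_sum_set_nat atLeast0LessThan)
  moreover have "(\<exists>j\<in>set [0..<length w]. nd v j \<noteq> 0) \<longleftrightarrow> nd v \<noteq> (\<lambda>j. 0)" if "v \<in> set (short_vecs K w)"
  proof -
    have "length v = n" using short_vecs_sound[OF that] by simp
    then have "nd v j \<noteq> 0 \<Longrightarrow> j < n" for j using out[of v j] by (auto simp: not_less[symmetric])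
    then show ?thesis using dims by (auto simp: fun_eq_iff)
  qed
  moreover have "\<forall>j\<ge>n. nd v j = 0" if "v \<in> set (short_vecs K w)"
    using short_vecs_sound[OF that] out by blast
  ultimately show ?thesis by (auto simp: short_kern_def kern_dot)
qed

lemma conformal_lists:
  assumes "length f = n" "length g = n"
  shows "(\<forall>j\<in>set [0..<length w]. 0 \<le> nd f j * nd g j \<and> \<bar>nd f j\<bar> \<le> \<bar>nd g j\<bar>) \<longleftrightarrow> cfm (nd f) (nd g)"
    and "(\<forall>j\<in>set [0..<length w]. nd f j = nd g j) \<longleftrightarrow> nd f = nd g"
proof -
  have all: "(\<forall>j\<in>set [0..<length w]. P j) \<longleftrightarrow> (\<forall>j. P j)" if "\<And>j. n \<le> j \<Longrightarrow> P j" for P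
    using that dims by (auto simp: not_less[symmetric])
  show "(\<forall>j\<in>set [0..<length w]. 0 \<le> nd f j * nd g j \<and> \<bar>nd f j\<bar> \<le> \<bar>nd g j\<bar>) \<longleftrightarrow> cfm (nd f) (nd g)"
    unfolding cfm_iff by (rule all) (simp add: out[OF assms(1)] out[OF assms(2)])
  show "(\<forall>j\<in>set [0..<length w]. nd f j = nd g j) \<longleftrightarrow> nd f = nd g"
    unfolding fun_eq_iff by (rule all) (simp add: out[OF assms(1)] out[OF assms(2)])
qed

lemma dual_dirs_sound:
  assumes "g \<in> set (dual_dirs K A w)"
  shows "minimal_kern (ent A) R n (nd g)" "length g = n"
proof -
  have g: "g \<in> set (short_kern K A w)" using assms by (simp add: dual_dirs_def)
  then have gs: "g \<in> set (short_vecs K w)" "kern (ent A) R n (nd g)" "nd g \<noteq> (\<lambda>j. 0)"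
    by (auto simp: short_kern_iff)
  show lg: "length g = n" using short_vecs_sound[OF gs(1)] by simp
  have "f = nd g" if f: "kern (ent A) R n f" "f \<noteq> (\<lambda>j. 0)" "cfm f (nd g)" for f
  proof -
    have "l1 n f \<le> int K" using l1_mono[OF f(3), of n] short_vecs_sound[OF gs(1)] by linarith
    then obtain v where v: "v \<in> set (short_vecs K w)" "nd v = f"
      using short_vecs_complete[of f K] f(1) by (auto simp: kern_def)
    have lv: "length v = n" using short_vecs_sound[OF v(1)] by simp
    have "v \<in> set (short_kern K A w)" using v f by (simp add: short_kern_iff)
    moreover have cv: "cfm (nd v) (nd g)" unfolding v(2) by (rule f(3))
    moreover have "\<forall>f\<in>set (short_kern K A w).
       (\<forall>j\<in>set [0..<length w]. 0 \<le> nd f j * nd g j \<and> \<bar>nd f j\<bar> \<le> \<bar>nd g j\<bar>) \<longrightarrow>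
       (\<forall>j\<in>set [0..<length w]. nd f j = nd g j)"
      using assms unfolding dual_dirs_def set_filter mem_Collect_eq by (rule conjunct2)
    ultimately have "\<forall>j\<in>set [0..<length w]. nd v j = nd g j"
      using conformal_lists(1)[OF lv lg] by blast
    then have "nd v = nd g" using conformal_lists(2)[OF lv lg] by blast
    then show ?thesis unfolding v(2) .
  qed
  then show "minimal_kern (ent A) R n (nd g)" using gs unfolding minimal_kern_def by blast
qed

lemma dual_dirs_complete:
  assumes "minimal_kern (ent A) R n g" "l1 n g \<le> int K"
  shows "\<exists>f\<in>set (dual_dirs K A w). nd f = g"
proof -
  have g: "kern (ent A) R n g" "g \<noteq> (\<lambda>j. 0)" using assms(1) by (auto simp: minimal_kern_def)
  then obtain v where v: "v \<in> set (short_vecs K w)" "nd v = g"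
    using short_vecs_complete[of g K] assms(2) by (auto simp: kern_def)
  have lv: "length v = n" using short_vecs_sound[OF v(1)] by simp
  have "v \<in> set (short_kern K A w)" using v g by (simp add: short_kern_iff)
  moreover have "(\<forall>j\<in>set [0..<length w]. nd f j = nd v j)"
    if "f \<in> set (short_kern K A w)"
      "\<forall>j\<in>set [0..<length w]. 0 \<le> nd f j * nd v j \<and> \<bar>nd f j\<bar> \<le> \<bar>nd v j\<bar>" for f
  proof -
    have f: "f \<in> set (short_vecs K w)" "kern (ent A) R n (nd f)" "nd f \<noteq> (\<lambda>j. 0)"
      using that(1) by (auto simp: short_kern_iff)
    have lf: "length f = n" using short_vecs_sound[OF f(1)] by simp
    have "cfm (nd f) (nd v)" using that(2) conformal_lists(1)[OF lf lv] by blast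
    then have "nd f = nd v" using assms(1) f(2,3) v(2) unfolding minimal_kern_def by blast
    then show ?thesis by simp
  qed
  ultimately have "v \<in> set (dual_dirs K A w)"
    unfolding dual_dirs_def set_filter mem_Collect_eq by blast
  with v show ?thesis by blast
qed

end

subsection \<open>Improving steps\<close>

text \<open>
  From \<open>1 - 1 / M \<le> exp (- 1 / M)\<close> and \<open>exp 1 \<ge> 2\<close>.
\<close>

lemma halving_power:
  assumes "1 \<le> M" "real t = real s * M"
  shows "(1 - 1 / M) ^ t \<le> inverse (2 ^ s)"
proof -
  have "(1 - 1 / M) ^ t \<le> exp (- 1 / M) ^ t"
  proof (rule power_mono)
    show "1 - 1 / M \<le> exp (- 1 / M)" using exp_ge_add_one_self[of "- 1 / M"] by simp
  qed (use assms(1) in simp)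
  also have "\<dots> = exp (real t * (- 1 / M))" by (rule exp_of_nat_mult[symmetric])
  also have "real t * (- 1 / M) = real s * (- 1)" using assms by simp
  also have "exp (real s * (- 1)) = exp (- 1) ^ s" by (rule exp_of_nat_mult)
  also have "\<dots> \<le> (inverse 2) ^ s"
  proof (rule power_mono)
    have "2 \<le> exp (1 :: real)" using exp_ge_add_one_self[of "1::real"] by simp
    then show "exp (- 1) \<le> inverse (2 :: real)" unfolding exp_minus by (intro le_imp_inverse_le) auto
  qed simp
  finally show ?thesis unfolding power_inverse .
qed

context ip begin

text \<open>
  The best step closes at least the fraction \<open>1 / N\<close> of the gap. The factors are the number of terms of
  \<open>y - x\<close>, the loss from rounding the scale, and the number of Graver elements in a term.
\<close>

abbreviation "N \<equiv> int (Suc n) * 3 * (int n * B)"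

lemma N_pos: "1 \<le> N"
proof -
  have "0 < N" using n k by simp
  then show ?thesis by linarith
qed

lemma feasible_move:
  assumes "feasible x" "kern (ent A) R n f" "\<And>j. j < n \<Longrightarrow> nd l j \<le> x j + \<mu> * f j \<and> x j + \<mu> * f j \<le> nd u j"
  shows "feasible (\<lambda>j. x j + \<mu> * f j)"
  unfolding feasible_def
proof (intro conjI ballI)
  show "\<forall>j\<ge>n. x j + \<mu> * f j = 0" using assms(1,2) by (simp add: feasible_def kern_def)
  show "\<forall>j<n. nd l j \<le> x j + \<mu> * f j \<and> x j + \<mu> * f j \<le> nd u j" using assms(3) by blast
  fix i assume "i \<in> R"
  then show "dot n (ent A i) (\<lambda>j. x j + \<mu> * f j) = b i"
    using assms(1,2) unfolding dot_add dot_scale feasible_def kern_dot by simp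
qed

lemma feasible_diff_kern: "feasible x \<Longrightarrow> feasible y \<Longrightarrow> kern (ent A) R n (\<lambda>j. y j - x j)"
  by (simp add: feasible_def kern_dot dot_diff)

lemma between_box:
  assumes "feasible x" "feasible y" "cfm g (\<lambda>j. y j - x j)" "j < n"
  shows "nd l j \<le> x j + g j \<and> x j + g j \<le> nd u j"
proof -
  have "nd l j \<le> x j \<and> x j \<le> nd u j" "nd l j \<le> y j \<and> y j \<le> nd u j"
    using assms(1,2,4) by (auto simp: feasible_def)
  moreover have "0 \<le> g j \<and> g j \<le> y j - x j \<or> y j - x j \<le> g j \<and> g j \<le> 0"
    using assms(3) unfolding cfm_def by blast
  ultimately show ?thesis by linarith
qed

lemma range_bounded:
  assumes "length g = n" "\<And>j. j < n \<Longrightarrow> nd g j \<in> set (range_vals k w)"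
  shows "\<bar>nd g i\<bar> \<le> B"
  using assms(2)[of i] out[OF assms(1), of i] dims by (cases "i < n") (auto simp: set_range_vals)

lemma primal_dirs_sound:
  assumes "f \<in> set (primal_dirs d k A l u w x)"
  shows "minimal_kern (ent A) R n (nd f)" "length f = n"
proof -
  from assms obtain s g where
    g: "g \<in> set (solve d A (map (\<lambda>j. - ((nd x j - nd l j) div s)) [0..<length w])
        (map (\<lambda>j. (nd u j - nd x j) div s) [0..<length w]) w (range_vals k w) [0..<length w] [])"
    and f: "f \<in> set (pieces d k A g)"
    unfolding primal_dirs_def by auto
  note s = kernel_solve[OF dims(3) g[unfolded dims(3)]]
  have "\<bar>nd g i\<bar> \<le> B" for i by (rule range_bounded[OF s(1)]) (use s(4) in blast)
  from pieces_props(1)[OF s(1,2) this] f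
  show "minimal_kern (ent A) R n (nd f)" "length f = n" unfolding peeled_def by blast+
qed

lemma good_step:
  assumes x: "feasible x" and y: "feasible y" and gap: "0 < dot n (nd w) y - dot n (nd w) x"
  shows "\<exists>\<mu> h. 1 \<le> \<mu> \<and> kern (ent A) R n h \<and> (\<forall>j. \<bar>h j\<bar> \<le> B) \<and> cfm (\<lambda>j. \<mu> * h j) (\<lambda>j. y j - x j) \<and>
    dot n (nd w) y - dot n (nd w) x \<le> int (Suc n) * (\<mu> * dot n (nd w) h) \<and> 0 < dot n (nd w) h"
proof -
  have "0 < dot n (nd w) (\<lambda>j. y j - x j)" using gap by (simp add: dot_diff)
  from good_bounded_direction[OF minors _ feasible_diff_kern[OF x y] n this] k obtain \<mu> h where
    \<mu>: "1 \<le> \<mu>" "kern (ent A) R n h" "\<forall>j. \<bar>h j\<bar> \<le> B" "cfm (\<lambda>j. \<mu> * h j) (\<lambda>j. y j - x j)"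
    "dot n (nd w) y - dot n (nd w) x \<le> int (Suc n) * (\<mu> * dot n (nd w) h)"
    by (auto simp: dot_diff)
  have "0 < dot n (nd w) h"
  proof (rule ccontr)
    assume "\<not> ?thesis"
    then have "\<mu> * dot n (nd w) h \<le> 0" using \<mu>(1) by (simp add: mult_nonneg_nonpos)
    then have "int (Suc n) * (\<mu> * dot n (nd w) h) \<le> 0" by (rule mult_nonneg_nonpos[OF of_nat_0_le_iff])
    with \<mu>(5) gap show False by linarith
  qed
  with \<mu> show ?thesis by blast
qed

text \<open>
  A good term \<open>\<mu> h\<close> of \<open>y - x\<close> stays feasible when \<open>\<mu>\<close> is decreased to a scale \<open>s\<close> from the list. So
  \<open>h\<close> competes in the optimization for \<open>s\<close>, and one of the pieces of the optimum has a large part of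
  its gain. As a conformal part of the optimum, this piece stays within the box as well.
\<close>

lemma primal_dirs_good:
  assumes x: "length x = n" "feasible (nd x)" and y: "feasible y"
    and gap: "0 < dot n (nd w) y - dot n (nd w) (nd x)" and t: "tdp (adjc A) {..<n} d"
  shows "\<exists>f\<in>set (primal_dirs d k A l u w x). \<exists>\<mu>\<ge>1. (\<forall>j<n. nd l j \<le> nd x j + \<mu> * nd f j \<and> nd x j + \<mu> * nd f j \<le> nd u j) \<and>
    dot n (nd w) y - dot n (nd w) (nd x) \<le> N * (\<mu> * dot n (nd w) (nd f))"
proof -
  obtain \<mu> h where \<mu>: "1 \<le> \<mu>" and h: "kern (ent A) R n h" "\<And>j. \<bar>h j\<bar> \<le> B"
    "cfm (\<lambda>j. \<mu> * h j) (\<lambda>j. y j - nd x j)"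
    and le: "dot n (nd w) y - dot n (nd w) (nd x) \<le> int (Suc n) * (\<mu> * dot n (nd w) h)"
    and pos: "0 < dot n (nd w) h"
    using good_step[OF x(2) y gap] by blast
  have "h \<noteq> (\<lambda>j. 0)" using pos by (auto simp: dot_zero)
  then obtain j where "h j \<noteq> 0" by auto
  then have j: "j < n" "h j \<noteq> 0" using h(1) by (auto simp: kern_def not_le[symmetric])
  have lu: "nd l i \<le> nd u i" if "i < n" for i using x(2) that unfolding feasible_def by force
  have "\<mu> \<le> spread (map (\<lambda>_. 1) w) l u"
  proof -
    have "\<mu> * 1 \<le> \<mu> * \<bar>h j\<bar>" using j \<mu> by (intro mult_left_mono) auto
    also have "\<dots> = \<bar>\<mu> * h j\<bar>" using \<mu> by (simp add: abs_mult)
    also have "\<dots> \<le> \<bar>y j - nd x j\<bar>" using cfm_abs[OF h(3), of j] .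
    also have "\<dots> \<le> \<bar>nd u j - nd l j\<bar>"
    proof -
      have "nd l j \<le> nd x j \<and> nd x j \<le> nd u j" "nd l j \<le> y j \<and> y j \<le> nd u j"
        using x(2) y j(1) by (auto simp: feasible_def)
      then show ?thesis by linarith
    qed
    also have "\<dots> \<le> (\<Sum>i<n. \<bar>nd u i - nd l i\<bar>)" by (rule member_le_sum) (use j in auto)
    also have "\<dots> = spread (map (\<lambda>_. 1) w) l u"
    proof -
      have "nd (map (\<lambda>_. 1) w) i = 1" if "i < n" for i using that dims by (simp add: nth_default_def)
      then show ?thesis
        using dims by (simp add: spread_def interv_sum_list_conv_sum_set_nat atLeast0LessThan)
    qed
    finally show ?thesis by simp
  qed
  from halves_approx[OF \<mu> this] obtain s where
    s: "s \<in> set (halves (spread (map (\<lambda>_. 1) w) l u))" "1 \<le> s" "s \<le> \<mu>" "\<mu> \<le> 3 * s" by blast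
  let ?lo = "map (\<lambda>j. - ((nd x j - nd l j) div s)) [0..<n]"
  let ?hi = "map (\<lambda>j. (nd u j - nd x j) div s) [0..<n]"
  have box: "nd ?lo i \<le> v \<and> v \<le> nd ?hi i \<longleftrightarrow> nd l i \<le> nd x i + s * v \<and> nd x i + s * v \<le> nd u i" if "i < n" for i v
  proof -
    have "nd ?lo i \<le> v \<longleftrightarrow> - v \<le> (nd x i - nd l i) div s" using that by (simp add: nd_map_upt, linarith)
    also have "\<dots> \<longleftrightarrow> - v * s \<le> nd x i - nd l i" using s(2) by (intro le_div_iff) simp
    also have "\<dots> \<longleftrightarrow> nd l i \<le> nd x i + s * v" by (simp add: mult.commute[of s], linarith)
    finally have 1: "nd ?lo i \<le> v \<longleftrightarrow> nd l i \<le> nd x i + s * v" .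
    have "v \<le> nd ?hi i \<longleftrightarrow> v * s \<le> nd u i - nd x i" using that s(2) by (simp add: nd_map_upt le_div_iff)
    also have "\<dots> \<longleftrightarrow> nd x i + s * v \<le> nd u i" by (simp add: mult.commute[of s], linarith)
    finally show ?thesis using 1 by blast
  qed
  have sh: "cfm (\<lambda>j. s * h j) (\<lambda>j. y j - nd x j)"
  proof (rule cfm_trans[OF _ h(3)])
    show "cfm (\<lambda>j. s * h j) (\<lambda>j. \<mu> * h j)" unfolding cfm_def
    proof
      fix j
      show "0 \<le> s * h j \<and> s * h j \<le> \<mu> * h j \<or> \<mu> * h j \<le> s * h j \<and> s * h j \<le> 0"
      proof (cases "0 \<le> h j")
        case True
        then show ?thesis using s(2,3) by (intro disjI1) (auto intro: mult_right_mono)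
      next
        case False
        then show ?thesis using s(2,3) by (intro disjI2) (auto intro: mult_right_mono_neg simp: mult_nonneg_nonpos)
      qed
    qed
  qed
  have hbox: "nd ?lo i \<le> h i \<and> h i \<le> nd ?hi i \<and> h i \<in> set (range_vals k w)" if "i < n" for i
    using box[OF that, of "h i"] between_box[OF x(2) y sh that] h(2)[of i] dims by (simp add: set_range_vals)
  have "solve d A ?lo ?hi w (range_vals k w) [0..<n] [] \<noteq> []"
    by (rule kernel_solve_nonempty[OF dims(3) t h(1) hbox])
  then obtain g where g: "g \<in> set (solve d A ?lo ?hi w (range_vals k w) [0..<n] [])" by (meson list.set_sel(1))
  note sg = kernel_solve[OF dims(3) g]
  have hg: "dot n (nd w) h \<le> dot n (nd w) (nd g)" by (rule sg(5)[OF h(1) hbox])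
  have gB: "\<bar>nd g i\<bar> \<le> B" for i by (rule range_bounded[OF sg(1)]) (use sg(4) in blast)
  have "0 < dot n (nd w) (nd g)" using pos hg by linarith
  from pieces_good[OF sg(1,2) gB t this] obtain f where
    f: "f \<in> set (pieces d k A g)" "dot n (nd w) (nd g) \<le> (int n * B) * dot n (nd w) (nd f)" by blast
  have cf: "cfm (nd f) (nd g)" using pieces_props(1)[OF sg(1,2) gB] f(1) unfolding peeled_def by blast
  have fbox: "nd l i \<le> nd x i + s * nd f i \<and> nd x i + s * nd f i \<le> nd u i" if i: "i < n" for i
  proof -
    have z: "nd ?lo i \<le> 0 \<and> 0 \<le> nd ?hi i" unfolding box[OF i, of 0] using x(2) i by (simp add: feasible_def)
    have gb: "nd ?lo i \<le> nd g i \<and> nd g i \<le> nd ?hi i" using sg(4)[OF i] by blast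
    have "0 \<le> nd f i \<and> nd f i \<le> nd g i \<or> nd g i \<le> nd f i \<and> nd f i \<le> 0" using cf unfolding cfm_def by blast
    then have "nd ?lo i \<le> nd f i \<and> nd f i \<le> nd ?hi i" using z gb by linarith
    then show ?thesis unfolding box[OF i] .
  qed
  have fd: "f \<in> set (primal_dirs d k A l u w x)"
  proof -
    have "pieces d k A g \<in> set (map (pieces d k A) (solve d A ?lo ?hi w (range_vals k w) [0..<n] []))" using g by simp
    then have "f \<in> set (concat (map (pieces d k A) (solve d A ?lo ?hi w (range_vals k w) [0..<n] [])))"
      using f(1) by (auto simp only: set_concat)
    then show ?thesis unfolding primal_dirs_def dims(3) using s(1) by auto
  qed
  have "dot n (nd w) y - dot n (nd w) (nd x) \<le> int (Suc n) * (\<mu> * dot n (nd w) h)" by (rule le)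
  also have "\<dots> \<le> int (Suc n) * (3 * s * dot n (nd w) h)"
    using s(4) pos by (intro mult_left_mono mult_right_mono) auto
  also have "\<dots> \<le> int (Suc n) * (3 * s * ((int n * B) * dot n (nd w) (nd f)))"
    using hg f(2) s(2) by (intro mult_left_mono) auto
  also have "\<dots> = N * (s * dot n (nd w) (nd f))" by (simp only: mult_ac)
  finally show ?thesis using fd fbox s(2) by blast
qed

text \<open>
  A Graver element in a good term \<open>\<mu> h\<close> of \<open>y - x\<close> can be taken \<open>\<mu>\<close> times. The factor \<open>3\<close> in \<open>N\<close> is
  not lost here, but a common bound is simpler.
\<close>

lemma dual_dirs_good:
  assumes x: "feasible x" and y: "feasible y" and gap: "0 < dot n (nd w) y - dot n (nd w) x"
    and bound: "\<forall>g. minimal_kern (ent A) R n g \<longrightarrow> l1 n g \<le> int K"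
  shows "\<exists>f\<in>set (dual_dirs K A w). \<exists>\<mu>\<ge>1. (\<forall>j<n. nd l j \<le> x j + \<mu> * nd f j \<and> x j + \<mu> * nd f j \<le> nd u j) \<and>
    dot n (nd w) y - dot n (nd w) x \<le> N * (\<mu> * dot n (nd w) (nd f))"
proof -
  obtain \<mu> h where \<mu>: "1 \<le> \<mu>" and h: "kern (ent A) R n h" "\<And>j. \<bar>h j\<bar> \<le> B"
    "cfm (\<lambda>j. \<mu> * h j) (\<lambda>j. y j - x j)"
    and le: "dot n (nd w) y - dot n (nd w) x \<le> int (Suc n) * (\<mu> * dot n (nd w) h)"
    and pos: "0 < dot n (nd w) h"
    using good_step[OF x y gap] by blast
  obtain g where g: "minimal_kern (ent A) R n g" "cfm g h" "dot n (nd w) h \<le> (int n * B) * dot n (nd w) g"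
    using good_minimal_summand[OF h(1,2) pos] by blast
  obtain f where f: "f \<in> set (dual_dirs K A w)" "nd f = g" using dual_dirs_complete[OF g(1)] bound g(1) by blast
  have "cfm (\<lambda>j. \<mu> * g j) (\<lambda>j. \<mu> * h j)" unfolding cfm_def
  proof
    fix j
    have "0 \<le> g j \<and> g j \<le> h j \<or> h j \<le> g j \<and> g j \<le> 0" using g(2) unfolding cfm_def by blast
    then show "0 \<le> \<mu> * g j \<and> \<mu> * g j \<le> \<mu> * h j \<or> \<mu> * h j \<le> \<mu> * g j \<and> \<mu> * g j \<le> 0"
      using \<mu> by (auto simp: mult_nonneg_nonpos intro: mult_left_mono)
  qed
  then have cg: "cfm (\<lambda>j. \<mu> * g j) (\<lambda>j. y j - x j)" using h(3) by (rule cfm_trans)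
  have "0 < (int n * B) * dot n (nd w) g" using g(3) pos by linarith
  then have pg: "0 < dot n (nd w) g" by (rule zero_less_mult_pos) (use n k in simp)
  have "dot n (nd w) y - dot n (nd w) x \<le> int (Suc n) * (\<mu> * dot n (nd w) h)" by (rule le)
  also have "\<dots> \<le> int (Suc n) * (\<mu> * ((int n * B) * dot n (nd w) g))"
    using g(3) \<mu> by (intro mult_left_mono) auto
  also have "\<dots> \<le> int (Suc n) * ((3 * \<mu>) * ((int n * B) * dot n (nd w) g))"
    using pg \<mu> by (intro mult_left_mono mult_right_mono) auto
  also have "\<dots> = N * (\<mu> * dot n (nd w) g)" by (simp only: mult_ac)
  finally have "dot n (nd w) y - dot n (nd w) x \<le> N * (\<mu> * dot n (nd w) (nd f))" unfolding f(2) .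
  moreover have "\<forall>j<n. nd l j \<le> x j + \<mu> * nd f j \<and> x j + \<mu> * nd f j \<le> nd u j"
    using between_box[OF x y cg] f(2) by blast
  ultimately show ?thesis using f(1) \<mu> by blast
qed

text \<open>
  Since \<open>x\<close> lies in the box, only the upper bounds on increasing coordinates and the lower bounds on
  decreasing ones restrict \<open>\<mu>\<close>; for integers, each of them is a bound by a quotient rounded
  down.
\<close>

lemma step_length_iff:
  assumes x: "length x = n" "feasible (nd x)" and f: "length f = n" "nd f \<noteq> (\<lambda>j. 0)" and \<mu>: "0 \<le> \<mu>"
  shows "(\<forall>j<n. nd l j \<le> nd x j + \<mu> * nd f j \<and> nd x j + \<mu> * nd f j \<le> nd u j) \<longleftrightarrow> \<mu> \<le> step_length l u x f"
proof -
  define L where "L = concat (map (\<lambda>j. if 0 < nd f j then [(nd u j - nd x j) div nd f j]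
       else if nd f j < 0 then [(nd x j - nd l j) div (- nd f j)] else []) [0..<length x])"
  obtain j where "nd f j \<noteq> 0" using f(2) by auto
  then have j: "j < n" "nd f j \<noteq> 0" using out[OF f(1), of j] by (auto simp: not_le[symmetric])
  have memL: "z \<in> set L \<longleftrightarrow> (\<exists>j<n. 0 < nd f j \<and> z = (nd u j - nd x j) div nd f j \<or>
      nd f j < 0 \<and> z = (nd x j - nd l j) div (- nd f j))" for z
    unfolding L_def using x(1) by (auto split: if_splits)
  have "\<exists>z. z \<in> set L"
  proof (cases "0 < nd f j")
    case True
    then show ?thesis unfolding memL using j(1) by blast
  next
    case False
    then have "nd f j < 0" using j(2) by simp
    then show ?thesis unfolding memL using j(1) by blast
  qed
  then have ne: "L \<noteq> []" by auto
  obtain c where c: "argmax uminus L = [c]" "c \<in> set L" "\<And>z. z \<in> set L \<Longrightarrow> c \<le> z"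
  proof (cases rule: argmax_cases[of L uminus])
    case 1
    with ne show thesis by blast
  next
    case (2 c)
    show thesis by (rule that[OF 2(1,2)]) (use 2(3) in fastforce)
  qed
  have sl: "step_length l u x f = c" unfolding step_length_def L_def[symmetric] c(1) by simp
  have "\<mu> \<le> c \<longleftrightarrow> (\<forall>z\<in>set L. \<mu> \<le> z)"
    using bspec[of "set L" "\<lambda>z. \<mu> \<le> z", OF _ c(2)] order.trans[OF _ c(3), of \<mu>] by blast
  also have "\<dots> \<longleftrightarrow> (\<forall>j<n. (0 < nd f j \<longrightarrow> \<mu> \<le> (nd u j - nd x j) div nd f j) \<and>
      (nd f j < 0 \<longrightarrow> \<mu> \<le> (nd x j - nd l j) div (- nd f j)))"
  proof
    assume all: "\<forall>z\<in>set L. \<mu> \<le> z"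
    show "\<forall>j<n. (0 < nd f j \<longrightarrow> \<mu> \<le> (nd u j - nd x j) div nd f j) \<and>
      (nd f j < 0 \<longrightarrow> \<mu> \<le> (nd x j - nd l j) div (- nd f j))"
      by (intro allI impI conjI; rule bspec[OF all]; unfold memL) blast+
  next
    assume r: "\<forall>j<n. (0 < nd f j \<longrightarrow> \<mu> \<le> (nd u j - nd x j) div nd f j) \<and>
      (nd f j < 0 \<longrightarrow> \<mu> \<le> (nd x j - nd l j) div (- nd f j))"
    show "\<forall>z\<in>set L. \<mu> \<le> z"
    proof
      fix z assume "z \<in> set L"
      then obtain j where "j < n" "0 < nd f j \<and> z = (nd u j - nd x j) div nd f j \<or>
        nd f j < 0 \<and> z = (nd x j - nd l j) div (- nd f j)" unfolding memL by blast
      with r show "\<mu> \<le> z" by blast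
    qed
  qed
  also have "\<dots> \<longleftrightarrow> (\<forall>j<n. nd l j \<le> nd x j + \<mu> * nd f j \<and> nd x j + \<mu> * nd f j \<le> nd u j)"
  proof (intro all_cong)
    fix j assume j: "j < n"
    have xj: "nd l j \<le> nd x j" "nd x j \<le> nd u j" using x(2) j by (auto simp: feasible_def)
    consider "nd f j = 0" | "0 < nd f j" | "nd f j < 0" by linarith
    then show "((0 < nd f j \<longrightarrow> \<mu> \<le> (nd u j - nd x j) div nd f j) \<and>
      (nd f j < 0 \<longrightarrow> \<mu> \<le> (nd x j - nd l j) div (- nd f j))) \<longleftrightarrow>
      (nd l j \<le> nd x j + \<mu> * nd f j \<and> nd x j + \<mu> * nd f j \<le> nd u j)"
    proof cases
      case 1
      then show ?thesis using xj by simp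
    next
      case 2
      then have "0 \<le> \<mu> * nd f j" using \<mu> by simp
      moreover have "\<mu> \<le> (nd u j - nd x j) div nd f j \<longleftrightarrow> \<mu> * nd f j \<le> nd u j - nd x j"
        by (rule le_div_iff[OF 2])
      ultimately show ?thesis using 2 xj by auto
    next
      case 3
      then have "\<mu> * nd f j \<le> 0" using \<mu> by (simp add: mult_nonneg_nonpos)
      moreover have "\<mu> \<le> (nd x j - nd l j) div (- nd f j) \<longleftrightarrow> \<mu> * (- nd f j) \<le> nd x j - nd l j"
        by (rule le_div_iff) (use 3 in simp)
      ultimately show ?thesis using 3 xj by auto
    qed
  qed
  finally show ?thesis unfolding sl by blast
qed

text \<open>
  Maximal among integer multiples; see \<open>no_longer_step\<close> for real ones.
\<close>

definition maximal_step :: "int list \<Rightarrow> int list \<Rightarrow> bool" where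
  "maximal_step x x' \<longleftrightarrow> (\<exists>f c. minimal_kern (ent A) R n f \<and> 0 < c \<and> nd x' = (\<lambda>j. nd x j + c * f j) \<and>
     (\<forall>\<mu>>c. \<not> feasible (\<lambda>j. nd x j + \<mu> * f j)) \<and> dot n (nd w) (nd x) < dot n (nd w) (nd x'))"

text \<open>
  The bound on the gap holds for the maximal step in the best direction because it holds for some
  feasible step in some direction of the list.
\<close>

lemma next_point_cases:
  assumes x: "length x = n" "feasible (nd x)"
  obtains "next_point d k K A l u w x = []" "\<And>y. feasible y \<Longrightarrow> dot n (nd w) y \<le> dot n (nd w) (nd x)"
  | x' where "next_point d k K A l u w x = [x']" "length x' = n" "feasible (nd x')" "maximal_step x x'"
      "\<And>y. feasible y \<Longrightarrow> dot n (nd w) y - dot n (nd w) (nd x) \<le> N * (dot n (nd w) (nd x') - dot n (nd w) (nd x))"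
proof -
  let ?F = "primal_dirs d k A l u w x @ dual_dirs K A w"
  have F: "minimal_kern (ent A) R n (nd f)" "length f = n" if "f \<in> set ?F" for f
    using that primal_dirs_sound dual_dirs_sound by auto
  have gain_eq: "gain l u w x f = step_length l u x f * dot n (nd w) (nd f)" for f
    by (simp add: gain_def dotl_dot dims)
  have good: "\<exists>f\<in>set ?F. dot n (nd w) y - dot n (nd w) (nd x) \<le> N * gain l u w x f"
    if y: "feasible y" and gap: "0 < dot n (nd w) y - dot n (nd w) (nd x)" for y
  proof -
    have "\<exists>f\<in>set ?F. \<exists>\<mu>\<ge>1. (\<forall>j<n. nd l j \<le> nd x j + \<mu> * nd f j \<and> nd x j + \<mu> * nd f j \<le> nd u j) \<and>
      dot n (nd w) y - dot n (nd w) (nd x) \<le> N * (\<mu> * dot n (nd w) (nd f))"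
      using depth
    proof
      assume "tdp (adjc A) {..<n} d"
      from primal_dirs_good[OF x y gap this] show ?thesis unfolding set_append by (rule bexE) (rule bexI[OF _ UnI1])
    next
      assume "\<forall>g. minimal_kern (ent A) R n g \<longrightarrow> l1 n g \<le> int K"
      from dual_dirs_good[OF x(2) y gap this] show ?thesis unfolding set_append by (rule bexE) (rule bexI[OF _ UnI2])
    qed
    then obtain f \<mu> where f: "f \<in> set ?F" "1 \<le> \<mu>"
      "\<forall>j<n. nd l j \<le> nd x j + \<mu> * nd f j \<and> nd x j + \<mu> * nd f j \<le> nd u j"
      "dot n (nd w) y - dot n (nd w) (nd x) \<le> N * (\<mu> * dot n (nd w) (nd f))" by blast
    have nz: "nd f \<noteq> (\<lambda>j. 0)" using F(1)[OF f(1)] by (simp add: minimal_kern_def)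
    have "\<mu> \<le> step_length l u x f" using step_length_iff[OF x F(2)[OF f(1)] nz, of \<mu>] f(2,3) by simp
    moreover have "0 \<le> dot n (nd w) (nd f)"
    proof (rule ccontr)
      assume "\<not> ?thesis"
      then have "\<mu> * dot n (nd w) (nd f) \<le> 0" using f(2) by (simp add: mult_nonneg_nonpos)
      then have "N * (\<mu> * dot n (nd w) (nd f)) \<le> 0"
        by (rule mult_nonneg_nonpos[rotated]) (use N_pos in linarith)
      then show False using f(4) gap by linarith
    qed
    ultimately have "\<mu> * dot n (nd w) (nd f) \<le> gain l u w x f" unfolding gain_eq by (rule mult_right_mono)
    then have "N * (\<mu> * dot n (nd w) (nd f)) \<le> N * gain l u w x f" using N_pos by (intro mult_left_mono) auto
    with f(1,4) show ?thesis by (intro bexI[of _ f]) linarith+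
  qed
  show thesis
  proof (cases rule: argmax_cases[of ?F "gain l u w x"])
    case 1
    have "next_point d k K A l u w x = []" unfolding next_point_def 1(2) by simp
    moreover have "dot n (nd w) y \<le> dot n (nd w) (nd x)" if "feasible y" for y
      using good[OF that] unfolding 1(1) by fastforce
    ultimately show thesis by (rule that(1))
  next
    case (2 f)
    have nz: "nd f \<noteq> (\<lambda>j. 0)" using F(1)[OF 2(2)] by (simp add: minimal_kern_def)
    have kf: "kern (ent A) R n (nd f)" using F(1)[OF 2(2)] by (simp add: minimal_kern_def)
    note sl = step_length_iff[OF x F(2)[OF 2(2)] nz]
    have c0: "0 \<le> step_length l u x f" using sl[of 0] x(2) by (simp add: feasible_def)
    have better: "dot n (nd w) y - dot n (nd w) (nd x) \<le> N * gain l u w x f"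
      if y: "feasible y" "0 < dot n (nd w) y - dot n (nd w) (nd x)" for y
    proof -
      obtain f' where f': "f' \<in> set ?F" "dot n (nd w) y - dot n (nd w) (nd x) \<le> N * gain l u w x f'"
        using good[OF y] by blast
      have "N * gain l u w x f' \<le> N * gain l u w x f" using 2(3)[OF f'(1)] N_pos by (intro mult_left_mono) auto
      with f'(2) show ?thesis by linarith
    qed
    have mv: "nd (move l u x f) = (\<lambda>j. nd x j + step_length l u x f * nd f j)"
      unfolding move_def nd_map_upt x(1) using out[OF x(1)] out[OF F(2)[OF 2(2)]] by (intro ext) auto
    have fe: "feasible (nd (move l u x f))"
      unfolding mv using sl[OF c0] by (intro feasible_move[OF x(2) kf]) auto
    show thesis
    proof (cases "0 < gain l u w x f")
      case False
      have "next_point d k K A l u w x = []" unfolding next_point_def 2(1) using False by simp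
      moreover have "dot n (nd w) y \<le> dot n (nd w) (nd x)" if y: "feasible y" for y
      proof (rule ccontr)
        assume "\<not> ?thesis"
        then have gap: "0 < dot n (nd w) y - dot n (nd w) (nd x)" by simp
        have "N * gain l u w x f \<le> 0" using False N_pos by (intro mult_nonneg_nonpos) auto
        with better[OF y gap] gap show False by linarith
      qed
      ultimately show thesis by (rule that(1))
    next
      case True
      have wx: "dot n (nd w) (nd (move l u x f)) = dot n (nd w) (nd x) + gain l u w x f"
        unfolding mv dot_add dot_scale gain_eq ..
      have "\<forall>j\<in>set [0..<length w]. nd l j \<le> nd (move l u x f) j \<and> nd (move l u x f) j \<le> nd u j"
        using fe unfolding feasible_def dims set_upt0 by blast
      then have nx: "next_point d k K A l u w x = [move l u x f]"
        unfolding next_point_def 2(1) using True x(1) dims(3) by simp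
      have "step_length l u x f \<noteq> 0" using True unfolding gain_eq by auto
      then have cpos: "0 < step_length l u x f" using c0 by simp
      have "\<not> feasible (\<lambda>j. nd x j + \<mu> * nd f j)" if "step_length l u x f < \<mu>" for \<mu>
      proof
        assume "feasible (\<lambda>j. nd x j + \<mu> * nd f j)"
        then have "\<mu> \<le> step_length l u x f" using sl[of \<mu>] c0 that by (simp add: feasible_def)
        with that show False by simp
      qed
      then have "maximal_step x (move l u x f)" unfolding maximal_step_def
        using F(1)[OF 2(2)] cpos mv wx True by (intro exI[of _ "nd f"] exI[of _ "step_length l u x f"]) simp
      moreover have "dot n (nd w) y - dot n (nd w) (nd x) \<le> N * (dot n (nd w) (nd (move l u x f)) - dot n (nd w) (nd x))"
        if "feasible y" for y
      proof (cases "0 < dot n (nd w) y - dot n (nd w) (nd x)")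
        case False
        have "0 \<le> N * gain l u w x f" using True N_pos by simp
        then show ?thesis using False unfolding wx by simp
      qed (use better[OF that] wx in simp)
      moreover have "length (move l u x f) = n" using x(1) by (simp add: move_def)
      ultimately show thesis using that(2)[OF nx _ fe] by blast
    qed
  qed
qed

subsection \<open>Geometric convergence\<close>

lemma spread_bound:
  assumes "feasible x" "feasible y"
  shows "dot n (nd w) y - dot n (nd w) x \<le> spread w l u"
proof -
  have "dot n (nd w) y - dot n (nd w) x = (\<Sum>j<n. nd w j * (y j - x j))"
    by (rule dot_diff[symmetric, THEN trans]) (rule dot_def)
  also have "\<dots> \<le> (\<Sum>j<n. \<bar>nd w j\<bar> * \<bar>nd u j - nd l j\<bar>)"
  proof (rule sum_mono)
    fix j assume "j \<in> {..<n}"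
    then have "nd l j \<le> x j \<and> x j \<le> nd u j" "nd l j \<le> y j \<and> y j \<le> nd u j"
      using assms by (auto simp: feasible_def)
    then have "\<bar>y j - x j\<bar> \<le> \<bar>nd u j - nd l j\<bar>" by linarith
    then have "\<bar>nd w j\<bar> * \<bar>y j - x j\<bar> \<le> \<bar>nd w j\<bar> * \<bar>nd u j - nd l j\<bar>" by (intro mult_left_mono) auto
    moreover have "nd w j * (y j - x j) \<le> \<bar>nd w j\<bar> * \<bar>y j - x j\<bar>" by (simp only: abs_mult[symmetric] abs_ge_self)
    ultimately show "nd w j * (y j - x j) \<le> \<bar>nd w j\<bar> * \<bar>nd u j - nd l j\<bar>" by linarith
  qed
  also have "\<dots> = spread w l u"
    using dims by (simp add: spread_def interv_sum_list_conv_sum_set_nat atLeast0LessThan)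
  finally show ?thesis .
qed

text \<open>
  By induction on the number of rounds, the gap to any feasible point shrinks by the factor \<open>1 - 1 / N\<close>
  in each round. Once the walk has stopped, the gap is not positive and the bound remains
  true.
\<close>

lemma partial_walk:
  assumes x0: "length x0 = n" "feasible (nd x0)"
  defines "walk \<equiv> \<lambda>ts :: int list. foldl (\<lambda>xs _. extend_walk d k K A l u w xs) [x0] ts"
  shows "walk ts \<noteq> [] \<and> last (walk ts) = x0 \<and> (\<forall>x\<in>set (walk ts). length x = n \<and> feasible (nd x)) \<and>
    successively (\<lambda>x' x. maximal_step x x') (walk ts) \<and>
    (\<forall>y. feasible y \<longrightarrow> real_of_int (dot n (nd w) y - dot n (nd w) (nd (hd (walk ts)))) \<le>
       (1 - 1 / real_of_int N) ^ length ts * real_of_int (spread w l u))"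
proof (induction ts rule: rev_induct)
  case Nil
  have "real_of_int (dot n (nd w) y - dot n (nd w) (nd x0)) \<le> real_of_int (spread w l u)" if "feasible y" for y
    using spread_bound[OF x0(2) that] by (simp only: of_int_le_iff)
  then show ?case unfolding walk_def using x0 by simp
next
  case (snoc t ts)
  let ?q = "1 - 1 / real_of_int N" and ?S = "real_of_int (spread w l u)"
  have N1: "1 \<le> real_of_int N" using N_pos by (simp only: of_int_1_le_iff)
  have q: "0 \<le> ?q" using N1 by simp
  obtain x xs where xs: "walk ts = x # xs" using snoc by (cases "walk ts") auto
  have x: "length x = n" "feasible (nd x)" using snoc xs by auto
  have S0: "0 \<le> ?S" using spread_bound[OF x(2) x(2)] by simp
  have gap: "real_of_int (dot n (nd w) y - dot n (nd w) (nd x)) \<le> ?q ^ length ts * ?S" if "feasible y" for y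
    using snoc that xs by simp
  have step: "walk (ts @ [t]) = next_point d k K A l u w x @ x # xs"
    using xs by (simp add: walk_def extend_walk_def)
  show ?case
  proof (cases rule: next_point_cases[OF x])
    case 1
    have "real_of_int (dot n (nd w) y - dot n (nd w) (nd x)) \<le> ?q ^ length (ts @ [t]) * ?S" if "feasible y" for y
    proof -
      have "real_of_int (dot n (nd w) y - dot n (nd w) (nd x)) \<le> 0" using 1(2)[OF that] by simp
      also have "0 \<le> ?q ^ length (ts @ [t]) * ?S" using q S0 by (intro mult_nonneg_nonneg zero_le_power)
      finally show ?thesis .
    qed
    moreover have "walk (ts @ [t]) = walk ts" using step 1(1) xs by simp
    ultimately show ?thesis using snoc xs by simp
  next
    case (2 x')
    have w': "walk (ts @ [t]) = x' # walk ts" using step 2(1) xs by simp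
    have "real_of_int (dot n (nd w) y - dot n (nd w) (nd x')) \<le> ?q ^ length (ts @ [t]) * ?S" if y: "feasible y" for y
    proof -
      let ?g = "real_of_int (dot n (nd w) y - dot n (nd w) (nd x))"
      let ?h = "real_of_int (dot n (nd w) (nd x') - dot n (nd w) (nd x))"
      have "?g \<le> real_of_int N * ?h" using 2(5)[OF y] by (simp only: of_int_le_iff of_int_mult[symmetric])
      then have "?g / real_of_int N \<le> ?h" using N1 by (simp add: divide_le_eq mult.commute)
      then have "real_of_int (dot n (nd w) y - dot n (nd w) (nd x')) \<le> ?g - ?g / real_of_int N" by simp
      also have "\<dots> = ?q * ?g" by (simp add: left_diff_distrib)
      also have "\<dots> \<le> ?q * (?q ^ length ts * ?S)" using gap[OF y] q by (rule mult_left_mono)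
      finally show ?thesis by simp
    qed
    then show ?thesis unfolding w' using snoc 2(2-4) xs by (simp add: successively_Cons)
  qed
qed

text \<open>
  With \<open>L = length (halves (spread w l u))\<close>, the spread is less than \<open>2 ^ L\<close>, and \<open>L N\<close> rounds reduce
  the gap by the factor \<open>2 ^ L\<close>. A gap less than \<open>1\<close> is not positive as it is an integer.
\<close>

lemma compute_walk_correct:
  assumes x0: "length x0 = n" "feasible (nd x0)"
  defines "xs \<equiv> compute_walk d k K A l u w x0"
  shows "xs \<noteq> []" "hd xs = x0" "\<And>x. x \<in> set xs \<Longrightarrow> length x = n \<and> feasible (nd x)"
    "successively maximal_step xs" "\<And>y. feasible y \<Longrightarrow> dot n (nd w) y \<le> dot n (nd w) (nd (last xs))"
proof -
  let ?w = "foldl (\<lambda>xs _. extend_walk d k K A l u w xs) [x0] (ticks k l u w)"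
  note p = partial_walk[OF x0, of "ticks k l u w"]
  have xs: "xs = rev ?w" by (simp add: xs_def compute_walk_def)
  show "xs \<noteq> []" "hd xs = x0" "\<And>x. x \<in> set xs \<Longrightarrow> length x = n \<and> feasible (nd x)"
    "successively maximal_step xs"
    using p unfolding xs by (auto simp: hd_rev)
  show "dot n (nd w) y \<le> dot n (nd w) (nd (last xs))" if y: "feasible y" for y
  proof -
    let ?N = "real_of_int N" and ?L = "length (halves (spread w l u))"
    have N1: "1 \<le> ?N" using N_pos by (simp only: of_int_1_le_iff)
    have len: "real (length (ticks k l u w)) = real ?L * ?N"
      unfolding length_ticks dims by (simp add: algebra_simps)
    note q = halving_power[OF N1 len]
    have S: "real_of_int (spread w l u) < 2 ^ ?L"
    proof -
      have "real_of_int (spread w l u) < real_of_int (2 ^ ?L)" using halves_length by (simp only: of_int_less_iff)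
      then show ?thesis by simp
    qed
    have S0: "0 \<le> real_of_int (spread w l u)" using spread_bound[OF x0(2) x0(2)] by simp
    have "real_of_int (dot n (nd w) y - dot n (nd w) (nd (hd ?w))) \<le>
       (1 - 1 / ?N) ^ length (ticks k l u w) * real_of_int (spread w l u)" using p y by blast
    also have "\<dots> \<le> inverse (2 ^ ?L) * real_of_int (spread w l u)" using q S0 by (rule mult_right_mono)
    also have "\<dots> < inverse (2 ^ ?L) * 2 ^ ?L" using S by (intro mult_strict_left_mono) auto
    also have "\<dots> = 1" by simp
    finally have "dot n (nd w) y - dot n (nd w) (nd (hd ?w)) < 1" by (simp only: of_int_less_1_iff)
    then show ?thesis using p by (simp add: xs last_rev)
  qed
qed

end

section \<open>Vectors, matrices and the encoded instance\<close>

definition fn :: "int vec \<Rightarrow> nat \<Rightarrow> int" where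
  "fn y j = (if j < dim_vec y then y $ j else 0)"

lemma nd_list_of_vec: "nd (list_of_vec y) = fn y"
  by (rule ext) (simp add: nth_default_def fn_def list_of_vec_index)

lemma fn_vec: "(\<And>j. n \<le> j \<Longrightarrow> f j = 0) \<Longrightarrow> fn (vec n f) = f"
  by (rule ext) (auto simp: fn_def)

lemma fn_index: "i < dim_vec x \<Longrightarrow> fn x i = x $ i"
  by (simp add: fn_def)

lemma fn_inject:
  assumes "fn x = fn y" "dim_vec x = dim_vec y"
  shows "x = y"
proof (rule eq_vecI)
  fix i assume i: "i < dim_vec y"
  have "fn x i = fn y i" by (rule fun_cong[OF assms(1)])
  then show "x $ i = y $ i" unfolding fn_index[OF i] fn_index[OF i[folded assms(2)]] .
qed (rule assms(2))

lemma vec_of_list_nd: "fn (vec_of_list xs) = nd xs"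
  using nd_list_of_vec[of "vec_of_list xs"] by (simp add: list_vec)

definition row_lists :: "int mat \<Rightarrow> int list list" where
  "row_lists A = map list_of_vec (rows A)"

lemma length_row_lists: "length (row_lists A) = dim_row A"
  by (simp add: row_lists_def)

lemma ent_row_lists: "i < dim_row A \<Longrightarrow> j < dim_col A \<Longrightarrow> ent (row_lists A) i j = A $$ (i, j)"
proof -
  assume ij: "i < dim_row A" "j < dim_col A"
  then have "nth_default [] (row_lists A) i = list_of_vec (row A i)"
    by (simp add: nth_default_def row_lists_def)
  then show ?thesis using ij by (simp add: ent_def nd_list_of_vec fn_def)
qed

lemma dot_row:
  assumes "A \<in> carrier_mat m n" "y \<in> carrier_vec n" "i < m"
  shows "dot n (ent (row_lists A) i) (fn y) = (A *\<^sub>v y) $ i"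
proof -
  have "dot n (ent (row_lists A) i) (fn y) = (\<Sum>j<n. A $$ (i, j) * y $ j)"
    unfolding dot_def by (rule sum.cong) (use assms in \<open>auto simp: ent_row_lists fn_def\<close>)
  also have "\<dots> = (A *\<^sub>v y) $ i"
    using assms by (simp add: scalar_prod_def atLeast0LessThan)
  finally show ?thesis .
qed

lemma dot_scalar_prod: "w \<in> carrier_vec n \<Longrightarrow> y \<in> carrier_vec n \<Longrightarrow> dot n (fn w) (fn y) = w \<bullet> y"
  by (auto simp: dot_def scalar_prod_def atLeast0LessThan fn_def)

lemma conformal_fn: "dim_vec f = n \<Longrightarrow> dim_vec g = n \<Longrightarrow> conformal f g \<longleftrightarrow> cfm (fn f) (fn g)"
  by (auto simp: conformal_def cfm_iff fn_def)

lemma kern_fn: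
  assumes "A \<in> carrier_mat m n" "y \<in> carrier_vec n"
  shows "kern (ent (row_lists A)) {..<m} n (fn y) \<longleftrightarrow> A *\<^sub>v y = 0\<^sub>v m"
proof -
  have "A *\<^sub>v y = 0\<^sub>v m \<longleftrightarrow> (\<forall>i<m. (A *\<^sub>v y) $ i = 0)" using assms by (auto simp: vec_eq_iff)
  moreover have "\<forall>j\<ge>n. fn y j = 0" using assms by (simp add: fn_def)
  ultimately show ?thesis unfolding kern_dot using dot_row[OF assms] by auto
qed

lemma fn_zero: "y \<in> carrier_vec n \<Longrightarrow> fn y = (\<lambda>j. 0) \<longleftrightarrow> y = 0\<^sub>v n"
  using fn_inject[of y "0\<^sub>v n"] by (auto simp: fn_def fun_eq_iff)

lemma graver_element_of_minimal_kern:
  assumes A: "A \<in> carrier_mat m n" and g: "minimal_kern (ent (row_lists A)) {..<m} n f"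
  shows "graver_element A (vec n f)"
proof -
  have k: "kern (ent (row_lists A)) {..<m} n f" "f \<noteq> (\<lambda>j. 0)" using g by (auto simp: minimal_kern_def)
  have ff: "fn (vec n f) = f" by (rule fn_vec) (use k(1) in \<open>simp add: kern_def\<close>)
  have dims: "dim_row A = m" "dim_col A = n" using A by auto
  show ?thesis unfolding graver_element_def dims
  proof (intro conjI notI)
    show "vec n f \<in> carrier_vec n" by simp
    show "vec n f = 0\<^sub>v n \<Longrightarrow> False" using k(2) fn_zero[of "vec n f" n] ff by simp
    show "A *\<^sub>v vec n f = 0\<^sub>v m" using kern_fn[OF A, of "vec n f"] ff k(1) by simp
    assume "\<exists>h. h \<in> carrier_vec n \<and> h \<noteq> 0\<^sub>v n \<and> A *\<^sub>v h = 0\<^sub>v m \<and> conformal h (vec n f) \<and> h \<noteq> vec n f"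
    then obtain h where h: "h \<in> carrier_vec n" "h \<noteq> 0\<^sub>v n" "A *\<^sub>v h = 0\<^sub>v m" "conformal h (vec n f)" "h \<noteq> vec n f"
      by blast
    have "kern (ent (row_lists A)) {..<m} n (fn h)" using kern_fn[OF A h(1)] h(3) by simp
    moreover have "fn h \<noteq> (\<lambda>j. 0)" using fn_zero[OF h(1)] h(2) by simp
    moreover have "cfm (fn h) f" using conformal_fn[of h n "vec n f"] h(1,4) ff by auto
    ultimately have "fn h = f" using g by (auto simp: minimal_kern_def)
    then have "h = vec n f" using ff h(1) by (intro fn_inject) auto
    with h(5) show False by blast
  qed
qed

lemma tdp_adj_mono:
  "tdp adj C d \<Longrightarrow> (\<And>i j. i \<in> C \<Longrightarrow> j \<in> C \<Longrightarrow> adj' i j \<Longrightarrow> adj i j) \<Longrightarrow> tdp adj' C d"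
proof (induction rule: tdp.induct)
  case (tdp_union C d C')
  show ?case
  proof (rule tdp.tdp_union)
    show "tdp adj' C d" by (rule tdp_union.IH(1)) (use tdp_union.prems in blast)
    show "tdp adj' C' d" by (rule tdp_union.IH(2)) (use tdp_union.prems in blast)
    show "\<forall>i\<in>C. \<forall>j\<in>C'. \<not> adj' i j" using tdp_union.hyps(4) tdp_union.prems by blast
  qed (rule tdp_union.hyps(3))
next
  case (tdp_insert C d v)
  show ?case by (rule tdp.tdp_insert, rule tdp_insert.IH) (use tdp_insert.prems in blast)
qed (rule tdp.tdp_empty)

lemma minors_le_cong:
  assumes "minors_le f m n a" "\<And>i j. i < m \<Longrightarrow> j < n \<Longrightarrow> g i j = f i j"
  shows "minors_le g m n a"
  unfolding minors_le_def
proof (intro allI impI, elim conjE)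
  fix k :: nat and \<rho> \<sigma> :: "nat \<Rightarrow> nat"
  assume *: "0 < k" "inj_on \<rho> {..<k}" "inj_on \<sigma> {..<k}" "\<rho> ` {..<k} \<subseteq> {..<m}" "\<sigma> ` {..<k} \<subseteq> {..<n}"
  have "mat k k (\<lambda>(p, q). g (\<rho> p) (\<sigma> q)) = mat k k (\<lambda>(p, q). f (\<rho> p) (\<sigma> q))"
  proof (rule eq_matI)
    fix p q assume "p < dim_row (mat k k (\<lambda>(p, q). f (\<rho> p) (\<sigma> q)))" "q < dim_col (mat k k (\<lambda>(p, q). f (\<rho> p) (\<sigma> q)))"
    then have pq: "p < k" "q < k" by auto
    then have "\<rho> p < m" "\<sigma> q < n" using *(4,5) by auto
    with pq show "mat k k (\<lambda>(p, q). g (\<rho> p) (\<sigma> q)) $$ (p, q) = mat k k (\<lambda>(p, q). f (\<rho> p) (\<sigma> q)) $$ (p, q)"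
      by (simp add: assms(2))
  qed auto
  with assms(1) * show "\<bar>det (mat k k (\<lambda>(p, q). g (\<rho> p) (\<sigma> q)))\<bar> \<le> a" unfolding minors_le_def by simp
qed

text \<open>
  The bound on minors has to be positive, as the empty minor is.
\<close>

definition entry_bound :: "int \<Rightarrow> nat" where
  "entry_bound a = nat (max a 1)"

definition norm_bound :: "int \<Rightarrow> nat \<Rightarrow> nat" where
  "norm_bound a d = nat (l1_bound (max a 1) d)"

lemma ip_instance:
  assumes mn: "0 < m" "0 < n" and A: "A \<in> carrier_mat m n" and a: "max_subdet A \<le> a"
    and td: "min (mat_treedepth A) (mat_treedepth (transpose_mat A)) \<le> d"
    and "w \<in> carrier_vec n" "l \<in> carrier_vec n" "u \<in> carrier_vec n"
  shows "ip (row_lists A) (list_of_vec l) (list_of_vec u) (list_of_vec w) n (entry_bound a) d (norm_bound a d)"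
proof
  have dims: "dim_row A = m" "dim_col A = n" using A by auto
  have ent: "ent (row_lists A) i j = A $$ (i, j)" if "i < m" "j < n" for i j
    using that dims by (simp add: ent_row_lists)
  show "length (list_of_vec l) = n" "length (list_of_vec u) = n" "length (list_of_vec w) = n" "0 < n"
    using assms by auto
  show "0 < entry_bound a" by (simp add: entry_bound_def)
  have a1: "int (entry_bound a) = max a 1" by (simp add: entry_bound_def)
  have minors: "minors_le (ent (row_lists A)) m n (max a 1)"
    by (rule minors_le_cong[OF minors_le_mono[OF minors_le_max_subdet[OF a A]]]) (use ent in auto)
  then show "minors_le (ent (row_lists A)) (length (row_lists A)) n (int (entry_bound a))"
    by (simp add: a1 length_row_lists dims)
  show "tdp (adjc (row_lists A)) {..<n} d \<or>
    (\<forall>g. minimal_kern (ent (row_lists A)) {..<length (row_lists A)} n g \<longrightarrow> l1 n g \<le> int (norm_bound a d))"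
  proof (cases "mat_treedepth A \<le> d")
    case True
    have "tdp (\<lambda>j k. \<exists>i<m. A $$ (i, j) \<noteq> 0 \<and> A $$ (i, k) \<noteq> 0) {..<n} d"
      using tdp_le[OF True tdp_mat_treedepth[of A]] mn dims by simp
    then have "tdp (adjc (row_lists A)) {..<n} d"
      by (rule tdp_adj_mono) (auto simp: adjc_def length_row_lists dims ent)
    then show ?thesis ..
  next
    case False
    with td have "mat_treedepth (transpose_mat A) \<le> d" by auto
    then have "tdp (\<lambda>j k. \<exists>i<n. transpose_mat A $$ (i, j) \<noteq> 0 \<and> transpose_mat A $$ (i, k) \<noteq> 0) {..<m} d"
      using tdp_le[OF _ tdp_mat_treedepth[of "transpose_mat A"]] mn dims by simp
    then have t: "tdp (\<lambda>i i'. \<exists>j<n. ent (row_lists A) i j \<noteq> 0 \<and> ent (row_lists A) i' j \<noteq> 0) {..<m} d"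
      by (rule tdp_adj_mono) (use dims in \<open>auto simp: ent\<close>)
    have "l1 n g \<le> int (norm_bound a d)" if "minimal_kern (ent (row_lists A)) {..<m} n g" for g
    proof -
      have "l1 n g \<le> l1_bound (max a 1) d"
        by (rule l1_minimal_kern_le[OF t _ _ that]) (use minors_le_entry[OF minors] in auto)
      then show ?thesis using l1_nonneg[of n g] by (simp add: norm_bound_def)
    qed
    then show ?thesis by (simp add: length_row_lists dims)
  qed
qed

lemma polyhedron_feasible:
  assumes "ip (row_lists A) (list_of_vec l) (list_of_vec u) (list_of_vec w) n k d K"
    and A: "A \<in> carrier_mat m n" and c: "b \<in> carrier_vec m" "l \<in> carrier_vec n" "u \<in> carrier_vec n" and y: "y \<in> carrier_vec n"
  shows "y \<in> polyhedron A b l u \<longleftrightarrow> ip.feasible (row_lists A) (list_of_vec l) (list_of_vec u) (fn b) n (fn y)"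
proof -
  interpret ip "row_lists A" "list_of_vec l" "list_of_vec u" "list_of_vec w" "fn b" n k d K by (rule assms(1))
  have dims: "dim_row A = m" "dim_col A = n" using A by auto
  have "A *\<^sub>v y = b \<longleftrightarrow> (\<forall>i<m. (A *\<^sub>v y) $ i = b $ i)" using A c(1) by (auto simp: vec_eq_iff)
  also have "\<dots> \<longleftrightarrow> (\<forall>i<m. dot n (ent (row_lists A) i) (fn y) = fn b i)"
    using dot_row[OF A y] c(1) by (auto simp: fn_def)
  finally have 1: "A *\<^sub>v y = b \<longleftrightarrow> (\<forall>i<m. dot n (ent (row_lists A) i) (fn y) = fn b i)" .
  have 2: "l \<le> y \<and> y \<le> u \<longleftrightarrow> (\<forall>j<n. fn l j \<le> fn y j \<and> fn y j \<le> fn u j)"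
    using c y by (auto simp: less_eq_vec_def fn_def)
  have "\<forall>j\<ge>n. fn y j = 0" using y by (simp add: fn_def)
  then show ?thesis unfolding polyhedron_def feasible_def nd_list_of_vec length_row_lists dims
    using 1 2 y by auto
qed

lemma real_polyhedron_rvec:
  assumes A: "A \<in> carrier_mat m n" and c: "b \<in> carrier_vec m" "l \<in> carrier_vec n" "u \<in> carrier_vec n" and y: "y \<in> carrier_vec n"
  shows "rvec y \<in> real_polyhedron A b l u \<longleftrightarrow> y \<in> polyhedron A b l u"
proof -
  have "map_mat real_of_int A *\<^sub>v rvec y = rvec (A *\<^sub>v y)"
    using of_int_hom.mult_mat_vec_hom[OF A y, where 'a = real] by simp
  moreover have "rvec (A *\<^sub>v y) = rvec b \<longleftrightarrow> A *\<^sub>v y = b" using A c(1) by (auto simp: vec_eq_iff)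
  moreover have "rvec l \<le> rvec y \<longleftrightarrow> l \<le> y" "rvec y \<le> rvec u \<longleftrightarrow> y \<le> u"
    using c y by (auto simp: less_eq_vec_def)
  ultimately show ?thesis using A y by (auto simp: polyhedron_def)
qed

text \<open>
  Suppose that a step of real length \<open>\<beta> > c\<close> in direction \<open>f\<close> ends in an integer point. Then \<open>\<beta> f\<close> is an
  integer kernel vector, and so is \<open>(\<beta> - \<lfloor>\<beta>\<rfloor>) f\<close>, which is conformal to \<open>f\<close>. By minimality it is
  zero, so \<open>\<beta>\<close> is an integer; but \<open>c\<close> is the longest integer step.
\<close>

lemma no_longer_step:
  assumes A: "A \<in> carrier_mat m n" and c: "b \<in> carrier_vec m" "l \<in> carrier_vec n" "u \<in> carrier_vec n"
    and x: "x \<in> carrier_vec n" and g: "minimal_kern (ent (row_lists A)) {..<m} n f" and c0: "0 < c"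
    and x': "x' = x + c \<cdot>\<^sub>v vec n f" and max: "\<And>\<mu>. c < \<mu> \<Longrightarrow> x + \<mu> \<cdot>\<^sub>v vec n f \<notin> polyhedron A b l u"
    and xP: "x \<in> polyhedron A b l u" and \<alpha>: "1 < \<alpha>"
  shows "rvec x + \<alpha> \<cdot>\<^sub>v rvec (x' - x) \<notin> real_polyhedron A b l u \<inter> integer_points n"
proof
  assume "rvec x + \<alpha> \<cdot>\<^sub>v rvec (x' - x) \<in> real_polyhedron A b l u \<inter> integer_points n"
  then obtain y where y: "y \<in> carrier_vec n" "rvec x + \<alpha> \<cdot>\<^sub>v rvec (x' - x) = rvec y" "rvec y \<in> real_polyhedron A b l u"
    by (auto simp: integer_points_def)
  then have yP: "y \<in> polyhedron A b l u" using real_polyhedron_rvec[OF A c y(1)] by simp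
  define \<beta> where "\<beta> = \<alpha> * real_of_int c"
  define q where "q = \<lfloor>\<beta>\<rfloor>"
  have \<beta>: "real_of_int c < \<beta>" using \<alpha> c0 by (simp add: \<beta>_def)
  have coord: "real_of_int (y $ j - x $ j) = \<beta> * real_of_int (f j)" if "j < n" for j
  proof -
    have "(rvec x + \<alpha> \<cdot>\<^sub>v rvec (x' - x)) $ j = rvec y $ j" using y(2) by simp
    then have "real_of_int (x $ j) + \<alpha> * real_of_int (c * f j) = real_of_int (y $ j)"
      using that x y(1) by (simp add: x')
    then show ?thesis by (simp add: \<beta>_def)
  qed
  have kf: "kern (ent (row_lists A)) {..<m} n f" and f0: "f \<noteq> (\<lambda>j. 0)" using g by (auto simp: minimal_kern_def)
  have fout: "f j = 0" if "n \<le> j" for j using kf that by (simp add: kern_def)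
  define r where "r j = fn y j - fn x j - q * f j" for j
  have "kern (ent (row_lists A)) {..<m} n (\<lambda>j. fn y j - fn x j)"
    unfolding kern_dot dot_diff
  proof (intro conjI allI impI ballI)
    show "fn y j - fn x j = 0" if "n \<le> j" for j using that x y(1) by (simp add: fn_def)
    have "A *\<^sub>v y = b" "A *\<^sub>v x = b" using yP xP by (auto simp: polyhedron_def)
    then show "dot n (ent (row_lists A) i) (fn y) - dot n (ent (row_lists A) i) (fn x) = 0" if "i \<in> {..<m}" for i
      using dot_row[OF A y(1), of i] dot_row[OF A x, of i] that by simp
  qed
  then have kr: "kern (ent (row_lists A)) {..<m} n r" unfolding r_def
    using kern_diff[OF _ kern_scale[OF kf, of q]] by blast
  define \<theta> where "\<theta> = \<beta> - real_of_int q"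
  have \<theta>: "0 \<le> \<theta>" "\<theta> < 1" by (simp_all add: \<theta>_def q_def, linarith)
  have r\<theta>: "real_of_int (r j) = \<theta> * real_of_int (f j)" for j
  proof (cases "j < n")
    case True
    then have "r j = y $ j - x $ j - q * f j" using x y(1) by (simp add: r_def fn_def)
    then have "real_of_int (r j) = real_of_int (y $ j - x $ j) - real_of_int q * real_of_int (f j)" by simp
    then show ?thesis unfolding coord[OF True] by (simp add: \<theta>_def left_diff_distrib)
  next
    case False
    then show ?thesis using x y(1) fout by (simp add: r_def fn_def)
  qed
  have cr: "cfm r f" unfolding cfm_def
  proof
    fix j
    show "0 \<le> r j \<and> r j \<le> f j \<or> f j \<le> r j \<and> r j \<le> 0"
    proof (cases "0 \<le> f j")
      case True
      then have "0 \<le> real_of_int (r j)" "real_of_int (r j) \<le> real_of_int (f j)"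
        using \<theta> mult_right_mono[of \<theta> 1 "real_of_int (f j)"] by (auto simp: r\<theta>)
      then show ?thesis by simp
    next
      case False
      then have "real_of_int (r j) \<le> 0" "real_of_int (f j) \<le> real_of_int (r j)"
        using \<theta> mult_right_mono_neg[of \<theta> 1 "real_of_int (f j)"] by (auto simp: r\<theta> mult_nonneg_nonpos)
      then show ?thesis by simp
    qed
  qed
  obtain j where j: "f j \<noteq> 0" using f0 by auto
  have "r = (\<lambda>j. 0)"
  proof (rule ccontr)
    assume "r \<noteq> (\<lambda>j. 0)"
    then have "r = f" using minimal_kern_no_split[OF g kr cr] by blast
    then have "\<theta> * real_of_int (f j) = real_of_int (f j)" using r\<theta>[of j] by simp
    then show False using j \<theta> by simp
  qed
  then have rj: "r j = 0" for j by simp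
  have "\<theta> * real_of_int (f j) = 0" using r\<theta>[of j] rj by simp
  then have "\<theta> = 0" using j by simp
  then have "c < q" using \<beta> by (simp add: \<theta>_def)
  moreover have "x + q \<cdot>\<^sub>v vec n f = y"
  proof (rule eq_vecI)
    fix i assume "i < dim_vec y"
    then have "i < n" using y(1) by simp
    then show "(x + q \<cdot>\<^sub>v vec n f) $ i = y $ i" using rj[of i] x y(1) by (simp add: r_def fn_def)
  qed (use x y(1) in simp)
  ultimately show False using max[of q] yP by simp
qed

lemma compute_walk_graver_walk:
  assumes mn: "0 < m" "0 < n" and A: "A \<in> carrier_mat m n" and a: "max_subdet A \<le> a"
    and td: "min (mat_treedepth A) (mat_treedepth (transpose_mat A)) \<le> d"
    and c: "b \<in> carrier_vec m" "w \<in> carrier_vec n" "l \<in> carrier_vec n" "u \<in> carrier_vec n"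
    and x0: "x0 \<in> polyhedron A b l u"
  shows "graver_walk A b w l u x0 (map vec_of_list (compute_walk d (entry_bound a) (norm_bound a d)
     (row_lists A) (list_of_vec l) (list_of_vec u) (list_of_vec w) (list_of_vec x0)))"
proof -
  have ip: "ip (row_lists A) (list_of_vec l) (list_of_vec u) (list_of_vec w) n (entry_bound a) d (norm_bound a d)"
    by (rule ip_instance[OF mn A a td c(2-4)])
  interpret ip "row_lists A" "list_of_vec l" "list_of_vec u" "list_of_vec w" "fn b" n "entry_bound a" d "norm_bound a d"
    by (rule ip)
  have dims: "dim_row A = m" "dim_col A = n" using A by auto
  note feas = polyhedron_feasible[OF ip A c(1,3,4)]
  have x0c: "x0 \<in> carrier_vec n" using x0 dims by (simp add: polyhedron_def)
  have x0f: "length (list_of_vec x0) = n" "feasible (nd (list_of_vec x0))"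
    using feas[OF x0c] x0 x0c by (auto simp: nd_list_of_vec)
  define xs where "xs = compute_walk d (entry_bound a) (norm_bound a d)
     (row_lists A) (list_of_vec l) (list_of_vec u) (list_of_vec w) (list_of_vec x0)"
  note cw = compute_walk_correct[OF x0f, folded xs_def]
  have mem: "vec_of_list x \<in> carrier_vec n" "vec_of_list x \<in> polyhedron A b l u" if "x \<in> set xs" for x
  proof -
    show c: "vec_of_list x \<in> carrier_vec n" using cw(3)[OF that] by (simp add: carrier_vecI)
    show "vec_of_list x \<in> polyhedron A b l u" using cw(3)[OF that] feas[OF c] by (simp add: vec_of_list_nd)
  qed
  have wdot: "dot n (nd (list_of_vec w)) (fn y) = w \<bullet> y" if "y \<in> carrier_vec n" for y
    using dot_scalar_prod[OF c(2) that] by (simp add: nd_list_of_vec)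
  show ?thesis unfolding graver_walk_def xs_def[symmetric] dims
  proof (intro conjI allI impI ballI)
    show "map vec_of_list xs \<noteq> []" using cw(1) by simp
    show "hd (map vec_of_list xs) = x0" using cw(1,2) by (simp add: hd_map vec_list)
    show "rvec x \<in> real_polyhedron A b l u \<inter> integer_points n" if "x \<in> set (map vec_of_list xs)" for x
    proof -
      from that obtain x' where "x' \<in> set xs" "x = vec_of_list x'" by auto
      then show ?thesis using mem[of x'] real_polyhedron_rvec[OF A c(1,3,4), of x] by (auto simp: integer_points_def)
    qed
    show "ip_optimal A b w l u (last (map vec_of_list xs))"
    proof -
      have l: "last xs \<in> set xs" "last (map vec_of_list xs) = vec_of_list (last xs)" using cw(1) by (auto simp: last_map)
      have "w \<bullet> y \<le> w \<bullet> vec_of_list (last xs)" if y: "y \<in> polyhedron A b l u" for y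
      proof -
        have yc: "y \<in> carrier_vec n" using y dims by (simp add: polyhedron_def)
        have "dot n (nd (list_of_vec w)) (fn y) \<le> dot n (nd (list_of_vec w)) (nd (last xs))"
          using cw(5) feas[OF yc] y by blast
        then show ?thesis using wdot[OF yc] wdot[OF mem(1)[OF l(1)]] by (simp add: vec_of_list_nd)
      qed
      then show ?thesis unfolding ip_optimal_def l(2) using mem(2)[OF l(1)] by blast
    qed
    fix k assume k: "1 \<le> k \<and> k < length (map vec_of_list xs)"
    define x x' where "x = xs ! (k - 1)" and "x' = xs ! k"
    have "Suc (k - 1) < length xs" using k by simp
    with cw(4) have "maximal_step (xs ! (k - 1)) (xs ! Suc (k - 1))" unfolding successively_conv_nth by blast
    then have "maximal_step x x'" using k by (simp add: x_def x'_def)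
    then obtain f \<gamma> where f: "minimal_kern (ent (row_lists A)) {..<m} n f" "0 < \<gamma>"
      "nd x' = (\<lambda>j. nd x j + \<gamma> * f j)" "\<And>\<mu>. \<gamma> < \<mu> \<Longrightarrow> \<not> feasible (\<lambda>j. nd x j + \<mu> * f j)"
      "dot n (nd (list_of_vec w)) (nd x) < dot n (nd (list_of_vec w)) (nd x')"
      unfolding maximal_step_def length_row_lists dims by blast
    have xin: "x \<in> set xs" "x' \<in> set xs" using k by (auto simp: x_def x'_def)
    let ?x = "vec_of_list x" and ?x' = "vec_of_list x'"
    have nth: "map vec_of_list xs ! (k - 1) = ?x" "map vec_of_list xs ! k = ?x'" using k by (auto simp: x_def x'_def)
    have fout: "f j = 0" if "n \<le> j" for j using f(1) that by (simp add: minimal_kern_def kern_def)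
    have fx: "fn (?x + \<mu> \<cdot>\<^sub>v vec n f) = (\<lambda>j. nd x j + \<mu> * f j)" for \<mu>
    proof
      fix j
      show "fn (?x + \<mu> \<cdot>\<^sub>v vec n f) j = nd x j + \<mu> * f j"
        using cw(3)[OF xin(1)] fout[of j] unfolding vec_of_list_nd[symmetric]
        by (cases "j < n") (auto simp: fn_def)
    qed
    have x'eq: "?x' = ?x + \<gamma> \<cdot>\<^sub>v vec n f"
      by (rule fn_inject) (use cw(3)[OF xin(1)] cw(3)[OF xin(2)] in \<open>auto simp: fx vec_of_list_nd f(3)\<close>)
    have diff: "?x' - ?x = \<gamma> \<cdot>\<^sub>v vec n f"
      unfolding x'eq by (intro eq_vecI) (use cw(3)[OF xin(1)] in auto)
    show "w \<bullet> (map vec_of_list xs ! (k - 1)) < w \<bullet> (map vec_of_list xs ! k)"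
      unfolding nth using f(5) wdot[OF mem(1)[OF xin(1)]] wdot[OF mem(1)[OF xin(2)]] by (simp add: vec_of_list_nd)
    have longer: "?x + \<mu> \<cdot>\<^sub>v vec n f \<notin> polyhedron A b l u" if "\<gamma> < \<mu>" for \<mu>
      using feas[of "?x + \<mu> \<cdot>\<^sub>v vec n f"] f(4)[OF that] mem(1)[OF xin(1)] fx by simp
    show "let f = map vec_of_list xs ! k - map vec_of_list xs ! (k - 1) in
           (\<exists>g c. graver_element A g \<and> c > 0 \<and> f = c \<cdot>\<^sub>v g) \<and>
           (\<forall>\<alpha>::real. \<alpha> > 1 \<longrightarrow> rvec (map vec_of_list xs ! (k - 1)) + \<alpha> \<cdot>\<^sub>v rvec f
                \<notin> real_polyhedron A b l u \<inter> integer_points n)"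
      unfolding Let_def nth
    proof (intro conjI allI impI)
      show "\<exists>g c. graver_element A g \<and> c > 0 \<and> ?x' - ?x = c \<cdot>\<^sub>v g"
        using graver_element_of_minimal_kern[OF A f(1)] f(2) diff by blast
      show "rvec ?x + \<alpha> \<cdot>\<^sub>v rvec (?x' - ?x) \<notin> real_polyhedron A b l u \<inter> integer_points n" if "1 < \<alpha>" for \<alpha>
        by (rule no_longer_step[OF A c(1,3,4) mem(1)[OF xin(1)] f(1,2) x'eq longer mem(2)[OF xin(1)] that])
    qed
  qed
qed

section \<open>The algorithm runs in polynomial time\<close>

text \<open>
  A function of several arguments is treated as a function of a nested pair. The following rules
  supply the arguments; with them, polynomial time of a composite function follows by
  decomposing its definition.
\<close>

lemma ptime_comp3:
  assumes "ptime (\<lambda>z. h (fst z) (fst (snd z)) (snd (snd z)))" "ptime f1" "ptime f2" "ptime f3"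
  shows "ptime (\<lambda>x. h (f1 x) (f2 x) (f3 x))"
  using ptime_comp[OF assms(1) ptime_Pair[OF assms(2) ptime_Pair[OF assms(3,4)]]] by simp

lemma ptime_comp4:
  assumes "ptime (\<lambda>z. h (fst z) (fst (snd z)) (fst (snd (snd z))) (snd (snd (snd z))))"
    "ptime f1" "ptime f2" "ptime f3" "ptime f4"
  shows "ptime (\<lambda>x. h (f1 x) (f2 x) (f3 x) (f4 x))"
  using ptime_comp[OF assms(1) ptime_Pair[OF assms(2) ptime_Pair[OF assms(3) ptime_Pair[OF assms(4,5)]]]]
  by simp

lemma ptime_comp5:
  assumes "ptime (\<lambda>z. h (fst z) (fst (snd z)) (fst (snd (snd z))) (fst (snd (snd (snd z)))) (snd (snd (snd (snd z)))))"
    "ptime f1" "ptime f2" "ptime f3" "ptime f4" "ptime f5"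
  shows "ptime (\<lambda>x. h (f1 x) (f2 x) (f3 x) (f4 x) (f5 x))"
  using ptime_comp[OF assms(1) ptime_Pair[OF assms(2) ptime_Pair[OF assms(3) ptime_Pair[OF assms(4)
    ptime_Pair[OF assms(5,6)]]]]] by simp

lemma ptime_comp7:
  assumes "ptime (\<lambda>z. h (fst z) (fst (snd z)) (fst (snd (snd z))) (fst (snd (snd (snd z))))
      (fst (snd (snd (snd (snd z))))) (fst (snd (snd (snd (snd (snd z))))))
      (snd (snd (snd (snd (snd (snd z)))))))"
    "ptime f1" "ptime f2" "ptime f3" "ptime f4" "ptime f5" "ptime f6" "ptime f7"
  shows "ptime (\<lambda>x. h (f1 x) (f2 x) (f3 x) (f4 x) (f5 x) (f6 x) (f7 x))"
  using ptime_comp[OF assms(1) ptime_Pair[OF assms(2) ptime_Pair[OF assms(3) ptime_Pair[OF assms(4)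
    ptime_Pair[OF assms(5) ptime_Pair[OF assms(6) ptime_Pair[OF assms(7,8)]]]]]]] by simp

lemma ptime_ent: "ptime (\<lambda>z. ent (fst z) (fst (snd z)) (snd (snd z)))"
  unfolding ent_def by (intro ptime_intros)
lemmas [ptime_intros] = ptime_comp3[OF ptime_ent]

lemma ptime_dotl: "ptime (\<lambda>z. dotl (fst z) (snd z))"
  unfolding dotl_def by (intro ptime_intros)
lemmas [ptime_intros] = ptime_comp2[OF ptime_dotl]

lemma ptime_touch: "ptime (\<lambda>z. touch (fst z) (fst (snd z)) (snd (snd z)))"
  unfolding touch_def by (intro ptime_intros)
lemmas [ptime_intros] = ptime_comp3[OF ptime_touch]

lemma ptime_merge: "ptime (\<lambda>z. merge (fst z) (fst (snd z)) (snd (snd z)))"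
  unfolding merge_def by (intro ptime_intros)

lemma sz_concat_le: "sz (concat xss) \<le> sz xss"
proof (induction xss)
  case (Cons xs xss)
  then show ?case using sz_append[of xs "concat xss"] by simp
qed simp

lemma sz_partition: "sz (filter P xs) + sz (filter (\<lambda>x. \<not> P x) xs) = Suc (sz xs)"
  by (induction xs) auto

text \<open>
  Merging keeps the multiset of columns, so blocks never get longer in total.
\<close>

lemma ptime_comps: "ptime (\<lambda>z. comps (fst z) (snd z))"
proof -
  have "ptime (\<lambda>z :: int list list \<times> nat list. foldl (merge (fst z)) (map (\<lambda>j. [j]) (snd z)) [0..<length (fst z)])"
  proof (rule ptime_foldl[where f = "\<lambda>z. merge (fst z)" and G = "\<lambda>_. 1"])
    show "ptime (\<lambda>z :: (int list list \<times> nat list) \<times> nat list list \<times> nat.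
        merge (fst (fst z)) (fst (snd z)) (snd (snd z)))"
      by (intro ptime_comp3[OF ptime_merge] ptime_intros)
    show "sz (merge (fst c) P i) \<le> sz P + 1" for c :: "int list list \<times> nat list" and P i
      using sz_concat_le[of "filter (touch (fst c) i) P"] sz_partition[of "touch (fst c) i" P]
      by (simp add: merge_def)
  qed (intro ptime_intros pbound_intros)+
  then show ?thesis unfolding comps_def by (intro ptime_intros)
qed
lemmas [ptime_intros] = ptime_comp2[OF ptime_comps]

lemma ptime_join: "ptime (\<lambda>z. join (fst z) (fst (snd z)) (fst (snd (snd z))) (fst (snd (snd (snd z))))
    (snd (snd (snd (snd z)))))"
  unfolding join_def by (intro ptime_intros)
lemmas [ptime_intros] = ptime_comp5[OF ptime_join]

text \<open>
  By induction on the fixed depth \<open>d\<close>: each level calls the previous one polynomially often.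
\<close>

lemma ptime_solve: "ptime (\<lambda>z. solve d (fst z) (fst (snd z)) (fst (snd (snd z))) (fst (snd (snd (snd z))))
      (fst (snd (snd (snd (snd z))))) (fst (snd (snd (snd (snd (snd z))))))
      (snd (snd (snd (snd (snd (snd z)))))))"
proof (induction d)
  case 0
  show ?case unfolding solve.simps by (intro ptime_intros)
next
  case (Suc d)
  show ?case unfolding solve.simps branch_def by (intro ptime_intros ptime_comp7[OF Suc])
qed
lemmas [ptime_intros] = ptime_comp7[OF ptime_solve]

lemma ptime_pad: "ptime (pad k)"
  unfolding pad_def by (intro ptime_intros)
lemmas [ptime_intros] = ptime_comp[OF ptime_pad]

lemma ptime_range_vals: "ptime (range_vals k)"
  unfolding range_vals_def by (intro ptime_intros)
lemmas [ptime_intros] = ptime_comp[OF ptime_range_vals]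

lemma ptime_below: "ptime (\<lambda>z. below d (fst z) (fst (snd z)) (fst (snd (snd z))) (snd (snd (snd z))))"
  unfolding below_def by (intro ptime_intros)
lemmas [ptime_intros] = ptime_comp4[OF ptime_below]

lemma ptime_remainder: "ptime (\<lambda>z. remainder (fst z) (snd z))"
  unfolding remainder_def by (intro ptime_intros)
lemmas [ptime_intros] = ptime_comp2[OF ptime_remainder]

lemma ptime_peel: "ptime (\<lambda>z. peel d (fst z) (fst (snd z)) (fst (snd (snd z))) (snd (snd (snd z))))"
  unfolding peel_def by (intro ptime_intros)
lemmas [ptime_intros] = ptime_comp4[OF ptime_peel]

lemma sz_nd_le: "sz (nd xs j) \<le> sz xs + 1"
proof (cases "j < length xs")
  case True
  then show ?thesis using sz_mem[of "xs ! j" xs] by (simp add: nth_default_def)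
next
  case False
  then show ?thesis using sz_pos[of xs] by (simp add: nth_default_def sz_int floorlog_def)
qed

lemma sz_map_upt_le: "(\<And>j. j < n \<Longrightarrow> sz (f j) \<le> b) \<Longrightarrow> sz (map f [0..<n]) \<le> 1 + n * b"
proof (induction n)
  case (Suc n)
  have "sz (map f [0..<n] @ [f n]) + 1 = sz (map f [0..<n]) + sz [f n]" by (rule sz_append)
  moreover have "sz (map f [0..<n]) \<le> 1 + n * b" using Suc by simp
  moreover have "sz (f n) \<le> b" using Suc.prems by simp
  ultimately show ?case by simp
qed simp

text \<open>
  The test in \<open>peel\<close> bounds the entries of the new summand by those of \<open>g\<close>.
\<close>

lemma sz_peel: "sz (peel d A vals g fs) \<le> sz fs + (1 + sz g * (sz g + 1))"
proof -
  have "sz (map (nd f) [0..<length g]) \<le> 1 + sz g * (sz g + 1)"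
    if "\<forall>k\<in>set [0..<length g]. \<bar>nd f k\<bar> \<le> \<bar>nd g k\<bar>" for f
  proof -
    have "sz (map (nd f) [0..<length g]) \<le> 1 + length g * (sz g + 1)"
    proof (rule sz_map_upt_le)
      fix j assume "j < length g"
      then have "sz (nd f j) \<le> sz (nd g j)" using that by (intro sz_int_mono) simp
      also have "\<dots> \<le> sz g + 1" by (rule sz_nd_le)
      finally show "sz (nd f j) \<le> sz g + 1" .
    qed
    also have "length g * (sz g + 1) \<le> sz g * (sz g + 1)"
      using length_le_sz[of g] by (intro mult_le_mono1) simp
    finally show ?thesis by simp
  qed
  then show ?thesis unfolding peel_def by (auto split: list.split simp: add.commute)
qed

lemma ptime_pieces: "ptime (\<lambda>z. pieces d k (fst z) (snd z))"
  unfolding pieces_def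
proof (rule ptime_foldl[where f = "\<lambda>z fs _. peel d (fst z) (range_vals k (snd z)) (snd z) fs"
      and G = "\<lambda>z. 1 + sz (snd (fst z)) * (sz (snd (fst z)) + 1)"])
  show "sz (peel d (fst c) (range_vals k (snd c)) (snd c) fs)
      \<le> sz fs + (1 + sz (snd (fst (c, y))) * (sz (snd (fst (c, y))) + 1))"
    for c :: "int list list \<times> int list" and fs and y :: int
    using sz_peel[of d "fst c" "range_vals k (snd c)" "snd c" fs] by simp
  show "pbound (\<lambda>z :: (int list list \<times> int list) \<times> int. 1 + sz (snd (fst z)) * (sz (snd (fst z)) + 1))"
    by (intro pbound_intros pbound_fst[OF pbound_snd[OF pbound_sz]])
qed (intro ptime_intros)+
lemmas [ptime_intros] = ptime_comp2[OF ptime_pieces]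

lemma length_halves_le: "length (halves M) \<le> sz M"
proof -
  have "length (halves M) \<le> floorlog 2 (nat M)"
  proof (induction M rule: halves.induct)
    case (1 M)
    show ?case
    proof (cases "M \<le> 0")
      case True
      then show ?thesis by (subst halves.simps) simp
    next
      case False
      then have "length (halves (M div 2)) \<le> floorlog 2 (nat (M div 2))" by (rule 1)
      moreover have "floorlog 2 (nat M) = Suc (floorlog 2 (nat M div 2))"
        using False by (subst compute_floorlog) simp
      moreover have "nat (M div 2) = nat M div 2" using False by (simp add: nat_div_distrib)
      ultimately show ?thesis using False by (subst halves.simps) simp
    qed
  qed
  also have "\<dots> \<le> sz M" unfolding sz_int by (intro trans_le_add2 floorlog_mono) simp
  finally show ?thesis .
qed

lemma ptime_halves: "ptime halves"
proof -
  define s where "s z = (fst z div 2, fst z # snd z)" for z :: "int \<times> int list"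
  define r where "r z = (if fst z \<le> 0 then fst z else 0, rev (halves (fst z)) @ snd z)" for z :: "int \<times> int list"
  have it: "\<exists>j\<le>length (halves M). (s ^^ j) (M, acc) = r (M, acc) \<and>
      (\<forall>i\<le>j. sz ((s ^^ i) (M, acc)) \<le> 1 + sz M + sz acc + i * sz M)" for M acc
  proof (induction M arbitrary: acc rule: halves.induct)
    case (1 M)
    show ?case
    proof (cases "M \<le> 0")
      case True
      then have "halves M = []" by (subst halves.simps) simp
      with True show ?thesis by (intro exI[of _ 0]) (simp add: r_def)
    next
      case False
      then have h: "halves M = M # halves (M div 2)" by (subst halves.simps) simp
      from 1[OF False, of "M # acc"] obtain j where j: "j \<le> length (halves (M div 2))"
        "(s ^^ j) (M div 2, M # acc) = r (M div 2, M # acc)"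
        "\<And>i. i \<le> j \<Longrightarrow> sz ((s ^^ i) (M div 2, M # acc)) \<le> 1 + sz (M div 2) + sz (M # acc) + i * sz (M div 2)" by blast
      have le: "sz (M div 2) \<le> sz M" by (rule sz_int_mono[OF abs_div_le])
      have Suc_s: "(s ^^ Suc i) (M, acc) = (s ^^ i) (M div 2, M # acc)" for i
        by (simp only: funpow_Suc_right comp_apply) (simp add: s_def)
      show ?thesis
      proof (intro exI[of _ "Suc j"] conjI allI impI)
        show "Suc j \<le> length (halves M)" using j(1) h by simp
        have "r (M div 2, M # acc) = r (M, acc)"
          using False by (auto simp: r_def h pos_imp_zdiv_neg_iff)
        then show "(s ^^ Suc j) (M, acc) = r (M, acc)" using j(2) unfolding Suc_s by simp
        fix i assume i: "i \<le> Suc j"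
        show "sz ((s ^^ i) (M, acc)) \<le> 1 + sz M + sz acc + i * sz M"
        proof (cases i)
          case (Suc i')
          have "sz ((s ^^ i) (M, acc)) \<le> 1 + sz (M div 2) + sz (M # acc) + i' * sz (M div 2)"
            unfolding Suc Suc_s using j(3)[of i'] i Suc by simp
          also have "\<dots> \<le> 1 + sz M + sz (M # acc) + i' * sz M"
            using le by (intro add_mono mult_le_mono) auto
          finally show ?thesis by (simp add: Suc)
        qed simp
      qed
    qed
  qed
  have "ptime r"
  proof (rule ptime_while[where b = "\<lambda>z. 0 < fst z" and s = s])
    show "ptime (\<lambda>z :: int \<times> int list. 0 < fst z)" by (intro ptime_intros)
    show "ptime s" unfolding s_def by (intro ptime_intros)
    show "r z = (if 0 < fst z then r (s z) else z)" for z
    proof (cases "0 < fst z")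
      case True
      then have "halves (fst z) = fst z # halves (fst z div 2)" by (subst halves.simps) simp
      with True show ?thesis by (auto simp: r_def s_def pos_imp_zdiv_neg_iff)
    next
      case False
      then have "halves (fst z) = []" by (subst halves.simps) simp
      with False show ?thesis by (cases z) (simp add: r_def)
    qed
    show "pbound (\<lambda>z :: int \<times> int list. sz (fst z))" by (intro pbound_intros)
    show "pbound (\<lambda>z :: int \<times> int list. 1 + sz (fst z) + sz (snd z) + sz (fst z) * sz (fst z))"
      by (intro pbound_intros)
    show "\<exists>j\<le>sz (fst z). \<not> 0 < fst ((s ^^ j) z) \<and>
        (\<forall>i\<le>j. sz ((s ^^ i) z) \<le> 1 + sz (fst z) + sz (snd z) + sz (fst z) * sz (fst z))" for z
    proof -
      obtain j where j: "j \<le> length (halves (fst z))" "(s ^^ j) z = r z"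
        "\<And>i. i \<le> j \<Longrightarrow> sz ((s ^^ i) z) \<le> 1 + sz (fst z) + sz (snd z) + i * sz (fst z)"
        using it[of "fst z" "snd z"] by auto
      have "j \<le> sz (fst z)" using j(1) length_halves_le le_trans by blast
      moreover have "\<not> 0 < fst ((s ^^ j) z)" unfolding j(2) by (simp add: r_def)
      moreover have "sz ((s ^^ i) z) \<le> 1 + sz (fst z) + sz (snd z) + sz (fst z) * sz (fst z)" if "i \<le> j" for i
      proof -
        have "i * sz (fst z) \<le> sz (fst z) * sz (fst z)"
          using that \<open>j \<le> sz (fst z)\<close> by (intro mult_le_mono1) simp
        with j(3)[OF that] show ?thesis by linarith
      qed
      ultimately show ?thesis by blast
    qed
  qed
  then have "ptime (\<lambda>M. r (M, []))" by (rule ptime_comp) (intro ptime_intros)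
  then have "ptime (\<lambda>M. rev (snd (r (M, []))))" by (intro ptime_intros)
  then show ?thesis by (simp add: r_def)
qed
lemmas [ptime_intros] = ptime_comp[OF ptime_halves]

lemma ptime_spread: "ptime (\<lambda>z. spread (fst z) (fst (snd z)) (snd (snd z)))"
  unfolding spread_def by (intro ptime_intros)
lemmas [ptime_intros] = ptime_comp3[OF ptime_spread]

lemma ptime_primal_dirs: "ptime (\<lambda>z. primal_dirs d k (fst z) (fst (snd z)) (fst (snd (snd z)))
    (fst (snd (snd (snd z)))) (snd (snd (snd (snd z)))))"
  unfolding primal_dirs_def by (intro ptime_intros)
lemmas [ptime_intros] = ptime_comp5[OF ptime_primal_dirs]

lemma ptime_short_vecs: "ptime (short_vecs K)"
proof (induction K)
  case 0
  have "ptime (\<lambda>w :: int list. [map (\<lambda>j. 0 :: int) [0..<length w]])" by (intro ptime_intros)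
  then show ?case by (rule ptime_cong) simp
next
  case (Suc K)
  have "ptime (\<lambda>w. short_vecs K w @
     concat (map (\<lambda>v. concat (map (\<lambda>j. [bump v j 1, bump v j (- 1)]) [0..<length w])) (short_vecs K w)))"
    unfolding bump_def by (intro ptime_intros ptime_comp[OF Suc])
  then show ?case by (rule ptime_cong) simp
qed
lemmas [ptime_intros] = ptime_comp[OF ptime_short_vecs]

lemma ptime_short_kern: "ptime (\<lambda>z. short_kern K (fst z) (snd z))"
  unfolding short_kern_def by (intro ptime_intros)
lemmas [ptime_intros] = ptime_comp2[OF ptime_short_kern]

lemma ptime_dual_dirs: "ptime (\<lambda>z. dual_dirs K (fst z) (snd z))"
  unfolding dual_dirs_def by (intro ptime_intros)
lemmas [ptime_intros] = ptime_comp2[OF ptime_dual_dirs]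

lemma ptime_step_length: "ptime (\<lambda>z. step_length (fst z) (fst (snd z)) (fst (snd (snd z))) (snd (snd (snd z))))"
  unfolding step_length_def by (intro ptime_intros)
lemmas [ptime_intros] = ptime_comp4[OF ptime_step_length]

lemma ptime_gain: "ptime (\<lambda>z. gain (fst z) (fst (snd z)) (fst (snd (snd z)))
    (fst (snd (snd (snd z)))) (snd (snd (snd (snd z)))))"
  unfolding gain_def by (intro ptime_intros)
lemmas [ptime_intros] = ptime_comp5[OF ptime_gain]

lemma ptime_move: "ptime (\<lambda>z. move (fst z) (fst (snd z)) (fst (snd (snd z))) (snd (snd (snd z))))"
  unfolding move_def by (intro ptime_intros)
lemmas [ptime_intros] = ptime_comp4[OF ptime_move]

lemma ptime_next_point: "ptime (\<lambda>z. next_point d k K (fst z) (fst (snd z)) (fst (snd (snd z)))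
    (fst (snd (snd (snd z)))) (snd (snd (snd (snd z)))))"
  unfolding next_point_def by (intro ptime_intros)
lemmas [ptime_intros] = ptime_comp5[OF ptime_next_point]

lemma ptime_extend_walk: "ptime (\<lambda>z. extend_walk d k K (fst z) (fst (snd z)) (fst (snd (snd z)))
    (fst (snd (snd (snd z)))) (snd (snd (snd (snd z)))))"
  unfolding extend_walk_def by (intro ptime_intros)
lemmas [ptime_intros] = ptime_comp5[OF ptime_extend_walk]

lemma ptime_ticks: "ptime (\<lambda>z. ticks k (fst z) (fst (snd z)) (snd (snd z)))"
  unfolding ticks_def by (intro ptime_intros)
lemmas [ptime_intros] = ptime_comp3[OF ptime_ticks]

text \<open>
  The test in \<open>next_point\<close> bounds the entries of the new point by those of \<open>l\<close> and \<open>u\<close>. So the walk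
  grows by an amount that does not depend on the points reached before.
\<close>

lemma sz_next_point: "sz (next_point d k K A l u w x) \<le> 2 + sz w * (sz l + sz u + 2)"
proof -
  have "sz (move l u x f) \<le> 1 + sz w * (sz l + sz u + 2)"
    if f: "length x = length w" "\<forall>j\<in>set [0..<length w]. nd l j \<le> nd (move l u x f) j \<and> nd (move l u x f) j \<le> nd u j" for f
  proof -
    have eq: "move l u x f = map (nd (move l u x f)) [0..<length w]"
      by (rule nth_equalityI) (use f(1) in \<open>auto simp: move_def nth_default_def\<close>)
    have "sz (map (nd (move l u x f)) [0..<length w]) \<le> 1 + length w * (sz l + sz u + 2)"
    proof (rule sz_map_upt_le)
      fix j assume "j < length w"
      then have "nd l j \<le> nd (move l u x f) j \<and> nd (move l u x f) j \<le> nd u j" using f(2) by simp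
      then have "\<bar>nd (move l u x f) j\<bar> \<le> \<bar>nd l j\<bar> \<or> \<bar>nd (move l u x f) j\<bar> \<le> \<bar>nd u j\<bar>" by linarith
      then have "sz (nd (move l u x f) j) \<le> sz (nd l j) \<or> sz (nd (move l u x f) j) \<le> sz (nd u j)"
        using sz_int_mono by blast
      then show "sz (nd (move l u x f) j) \<le> sz l + sz u + 2"
        using sz_nd_le[of l j] sz_nd_le[of u j] by linarith
    qed
    also have "length w * (sz l + sz u + 2) \<le> sz w * (sz l + sz u + 2)"
      using length_le_sz[of w] by (intro mult_le_mono1) simp
    finally show ?thesis unfolding eq[symmetric] by simp
  qed
  then show ?thesis unfolding next_point_def by (auto split: list.split)
qed

lemma ptime_compute_walk: "ptime (\<lambda>z. compute_walk d k K (fst z) (fst (snd z)) (fst (snd (snd z)))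
    (fst (snd (snd (snd z)))) (snd (snd (snd (snd z)))))"
proof -
  let ?T = "\<lambda>z :: int list list \<times> int list \<times> int list \<times> int list \<times> int list. ticks k (fst (snd z)) (fst (snd (snd z))) (fst (snd (snd (snd z))))"
  have "ptime (\<lambda>z :: int list list \<times> int list \<times> int list \<times> int list \<times> int list.
    foldl (\<lambda>xs _. extend_walk d k K (fst z) (fst (snd z)) (fst (snd (snd z))) (fst (snd (snd (snd z)))) xs)
      [snd (snd (snd (snd z)))] (?T z))"
  proof (rule ptime_foldl[where f = "\<lambda>z xs _. extend_walk d k K (fst z) (fst (snd z)) (fst (snd (snd z))) (fst (snd (snd (snd z)))) xs"
      and G = "\<lambda>z. 2 + sz (fst z) * (sz (fst z) + sz (fst z) + 2)"])
    fix c :: "int list list \<times> int list \<times> int list \<times> int list \<times> int list" and xs and y :: int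
    obtain A l u w x0 where c: "c = (A, l, u, w, x0)" by (cases c)
    have "sz (extend_walk d k K A l u w xs) \<le> sz xs + (2 + sz w * (sz l + sz u + 2))"
    proof (cases xs)
      case (Cons x ys)
      then show ?thesis
        using sz_append[of "next_point d k K A l u w x" xs] sz_next_point[of d k K A l u w x]
        by (simp add: extend_walk_def)
    qed (simp add: extend_walk_def)
    also have "sz w * (sz l + sz u + 2) \<le> sz c * (sz c + sz c + 2)"
      unfolding c by (intro mult_le_mono) auto
    finally show "sz (extend_walk d k K (fst c) (fst (snd c)) (fst (snd (snd c))) (fst (snd (snd (snd c)))) xs)
      \<le> sz xs + (2 + sz (fst (c, y)) * (sz (fst (c, y)) + sz (fst (c, y)) + 2))"
      unfolding c by simp
  qed (intro ptime_intros pbound_intros)+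
  then show ?thesis unfolding compute_walk_def by (intro ptime_intros)
qed

section \<open>From the encoded instance to the encoded walk\<close>

lemma enc_vec_enc: "enc_vec v = enc (list_of_vec v)"
  by (simp add: enc_vec_def enc_list_def) (auto simp: enc_int_def)

lemma enc_rows: "ListV (map enc_vec (rows A)) = enc (row_lists A)"
  by (simp add: row_lists_def enc_list_def[of "map list_of_vec _"] enc_vec_enc)

lemma enc_walk_enc: "enc_walk (map vec_of_list xs) = enc xs"
  by (simp add: enc_walk_def enc_vec_enc list_vec enc_list_def[of xs])

text \<open>
  The input is a list of eight values of different kinds. It is not the encoding of a value of one of
  the types above, so it is taken apart by explicit expressions.
\<close>

definition component :: "nat \<Rightarrow> expr" where
  "component i = Prim1 Head ((Prim1 Tail ^^ i) (Var 0))"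

lemma evals_within_tails:
  "i \<le> length vs \<Longrightarrow>
    evals_within P [ListV vs] ((Prim1 Tail ^^ i) (Var 0)) (ListV (drop i vs)) (Suc i * (1 + val_size (ListV vs)))"
proof (induction i)
  case 0
  show ?case using evals_within_Var0[of P "ListV vs" "[]"] by simp
next
  case (Suc i)
  have d: "drop i vs = vs ! i # drop (Suc i) vs" using Suc.prems by (simp add: Cons_nth_drop_Suc)
  have "evals_within P [ListV vs] (Prim1 Tail ((Prim1 Tail ^^ i) (Var 0))) (ListV (drop (Suc i) vs))
      (1 + val_size (ListV (drop (Suc i) vs)) + Suc i * (1 + val_size (ListV vs)))"
    by (rule evals_within_Prim1[OF Suc.IH]) (use Suc.prems in \<open>simp_all add: d\<close>)
  moreover have "val_size (ListV vs) =
      1 + (sum_list (map val_size (take (Suc i) vs)) + sum_list (map val_size (drop (Suc i) vs)))"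
    by (simp only: val_size.simps sum_list_append[symmetric] map_append[symmetric] append_take_drop_id)
  then have "val_size (ListV (drop (Suc i) vs)) \<le> val_size (ListV vs)" by simp
  ultimately show ?case by (auto elim!: evals_within_mono)
qed

lemma evals_within_component:
  assumes "i < length vs"
  shows "evals_within P [ListV vs] (component i) (vs ! i) ((i + 2) * (1 + val_size (ListV vs)))"
proof -
  have d: "drop i vs = vs ! i # drop (Suc i) vs" using assms by (simp add: Cons_nth_drop_Suc)
  have "evals_within P [ListV vs] (component i) (vs ! i) (1 + val_size (vs ! i) + Suc i * (1 + val_size (ListV vs)))"
    unfolding component_def
    by (rule evals_within_Prim1[OF evals_within_tails]) (use assms in \<open>simp_all add: d\<close>)
  moreover have "val_size (vs ! i) \<le> val_size (ListV vs)"
    using member_le_sum_list[of "val_size (vs ! i)" "map val_size vs"] assms by simp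
  ultimately show ?thesis by (auto elim!: evals_within_mono)
qed

text \<open>
  The positions are those of the matrix rows, of \<open>l\<close>, \<open>u\<close>, \<open>w\<close> and of the starting point. The
  dimensions are given by the lengths of the lists, and the right-hand side by the starting point, from
  which all feasible points differ by kernel vectors.
\<close>

definition read_instance :: expr where
  "read_instance = pair_expr (component 2) (pair_expr (component 5) (pair_expr (component 6)
     (pair_expr (component 4) (component 7))))"

lemma evals_within_read_instance:
  "evals_within P [enc_instance A b w l u x0] read_instance
     (enc (row_lists A, list_of_vec l, list_of_vec u, list_of_vec w, list_of_vec x0))
     (100 * (1 + val_size (enc_instance A b w l u x0)))"
  (is "evals_within P [?I] _ _ (100 * (1 + ?S))")
proof -
  define vs where "vs = [IntV (int (dim_row A)), IntV (int (dim_col A)), enc (row_lists A), enc_vec b,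
      enc (list_of_vec w), enc (list_of_vec l), enc (list_of_vec u), enc (list_of_vec x0)]"
  have I: "?I = ListV vs" by (simp add: enc_instance_def vs_def enc_rows enc_vec_enc)
  have S: "sz (row_lists A) + sz (list_of_vec w) + sz (list_of_vec l) + sz (list_of_vec u) + sz (list_of_vec x0) \<le> ?S"
    unfolding I by (simp add: vs_def sz_def)
  have c: "evals_within P [?I] (component i) (vs ! i) (9 * (1 + ?S))" if "i < 8" for i
    unfolding I
    by (rule evals_within_mono[OF evals_within_component mult_le_mono1]) (use that in \<open>simp_all add: vs_def\<close>)
  have nth: "vs ! 2 = enc (row_lists A)" "vs ! 4 = enc (list_of_vec w)" "vs ! 5 = enc (list_of_vec l)"
    "vs ! 6 = enc (list_of_vec u)" "vs ! 7 = enc (list_of_vec x0)" by (simp_all add: vs_def eval_nat_numeral)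
  note evals_within_pair[OF c[of 2, unfolded nth] evals_within_pair[OF c[of 5, unfolded nth]
      evals_within_pair[OF c[of 6, unfolded nth] evals_within_pair[OF c[of 4, unfolded nth] c[of 7, unfolded nth]]]]]
  then show ?thesis unfolding read_instance_def by (rule evals_within_mono) (use S in simp_all)
qed

theorem theorem3p6:
  fixes a :: int and d :: nat
  shows "\<exists>(alg :: expr list) (p :: nat poly).
    \<forall>(m :: nat) (n :: nat) (A :: int mat) (b :: int vec) (w :: int vec) (l :: int vec)
      (u :: int vec) (x0 :: int vec).
      0 < m \<and> 0 < n \<and> A \<in> carrier_mat m n \<and>
      max_subdet A \<le> a \<and> min (mat_treedepth A) (mat_treedepth (transpose_mat A)) \<le> d \<and>
      b \<in> carrier_vec m \<and> w \<in> carrier_vec n \<and> l \<in> carrier_vec n \<and> u \<in> carrier_vec n \<and>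
      x0 \<in> polyhedron A b l u
      \<longrightarrow> (\<exists>xs t. runs alg (enc_instance A b w l u x0) (enc_walk xs) t \<and>
                  t \<le> poly p (val_size (enc_instance A b w l u x0)) \<and>
                  graver_walk A b w l u x0 xs)"
proof -
  let ?walk = "compute_walk d (entry_bound a) (norm_bound a d)"
  have "ptime (\<lambda>z. ?walk (fst z) (fst (snd z)) (fst (snd (snd z))) (fst (snd (snd (snd z)))) (snd (snd (snd (snd z)))))"
    by (rule ptime_compute_walk)
  then obtain P e T where T: "pbound T" and P: "computes P e T
      (\<lambda>z. ?walk (fst z) (fst (snd z)) (fst (snd (snd z))) (fst (snd (snd (snd z)))) (snd (snd (snd (snd z)))))"
    by (rule ptimeE)
  obtain k where k: "\<And>z. T z \<le> (sz z + 2) ^ k" using T unfolding pbound_def by blast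
  \<comment> \<open>Function 0 reads the instance and runs the expression for the walk; the remaining functions
    are those of the walk, moved up by one place.\<close>
  let ?Q = "[LetIn read_instance (relocate 1 e)]"
  define alg where "alg = ?Q @ map (relocate 1) P"
  \<comment> \<open>Reading costs at most \<open>100 (1 + S)\<close> for an input of size \<open>S\<close>; the tuple read has size at most \<open>S + 4\<close>,
    which \<open>(sz + 2) ^ k\<close> turns into \<open>(S + 6) ^ k\<close>.\<close>
  define p :: "nat poly" where "p = [:101, 100:] + [:6, 1:] ^ k"
  show ?thesis
  proof (intro exI[of _ alg] exI[of _ p] allI impI, elim conjE)
    fix m n :: nat and A :: "int mat" and b w l u x0 :: "int vec"
    assume mn: "0 < m" "0 < n" and A: "A \<in> carrier_mat m n" "max_subdet A \<le> a"
      "min (mat_treedepth A) (mat_treedepth (transpose_mat A)) \<le> d"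
      and c: "b \<in> carrier_vec m" "w \<in> carrier_vec n" "l \<in> carrier_vec n" "u \<in> carrier_vec n"
      and x0: "x0 \<in> polyhedron A b l u"
    let ?I = "enc_instance A b w l u x0"
    let ?z = "(row_lists A, list_of_vec l, list_of_vec u, list_of_vec w, list_of_vec x0)"
    let ?xs = "?walk (row_lists A) (list_of_vec l) (list_of_vec u) (list_of_vec w) (list_of_vec x0)"
    let ?T = "1 + 100 * (1 + val_size ?I) + T ?z"
    have "computes alg (relocate 1 e) T
      (\<lambda>z. ?walk (fst z) (fst (snd z)) (fst (snd (snd z))) (fst (snd (snd (snd z)))) (snd (snd (snd (snd z)))))"
      using computes_relocate[OF P, of ?Q] by (simp add: alg_def)
    from computesD[OF this, of ?z "[?I]"]
    have "evals_within alg (enc ?z # [?I]) (relocate 1 e) (enc ?xs) (T ?z)" by simp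
    from evals_within_LetIn[OF evals_within_read_instance this]
    have "evals_within alg [?I] (LetIn read_instance (relocate 1 e)) (enc ?xs) ?T" .
    then obtain t where t: "runs alg ?I (enc_walk (map vec_of_list ?xs)) t" "t \<le> ?T"
      unfolding runs_def enc_walk_enc evals_within_def by (auto simp: alg_def)
    moreover have "t \<le> poly p (val_size ?I)"
    proof -
      have "sz ?z \<le> 4 + val_size ?I"
        by (simp add: enc_instance_def enc_rows enc_vec_enc sz_def enc_prod_def)
      then have "(sz ?z + 2) ^ k \<le> (6 + val_size ?I) ^ k" by (intro power_mono) auto
      then have "T ?z \<le> (6 + val_size ?I) ^ k" using k[of ?z] by linarith
      then show ?thesis using t(2) by (simp add: p_def poly_power)
    qed
    moreover have "graver_walk A b w l u x0 (map vec_of_list ?xs)"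
      by (rule compute_walk_graver_walk[OF mn A c x0])
    ultimately show "\<exists>xs t. runs alg ?I (enc_walk xs) t \<and> t \<le> poly p (val_size ?I) \<and> graver_walk A b w l u x0 xs"
      by blast
  qed
qed

end
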